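(* Let $p$ be a prime and $R=\mathbb{F}_p[t]$. Let $\mathbb{F}$ be a finite extension of $\mathbb{F}_p(t)$ and let $K$ be a finitely generated field extension of $\mathbb{F}$ of (arbitrary finite) transcendence degree at least $1$, with $\mathbb{F}$ algebraically closed in $K$, such that $K$ is the function field of a smooth, projective, geometrically irreducible variety $\mathcal{V}$ over $\mathbb{F}$. Let $\Omega$ be the set of places of $K$ attached to the irreducible divisors of $\mathcal{V}$, let $\Omega_1\subseteq\Omega$ be a cofinite subset, and let $\mathbf{A}_K=\prod_{v\in\Omega_1}(K_v,\mathcal{O}_v)$ be the corresponding ring of adèles. Let $\Phi:R\to\operatorname{End}_K(\mathbb{G}_a)$ be a Drinfeld module of generic characteristic defined over $K$, and let $g\geq 1$. Then for every affine subvariety $V\subseteq\mathbb{G}_a^g$ defined over $K$ and every finitely generated $\Phi(R)$-submodule $\Gamma\subseteq K^g$, we have $$V(K)\cap\Gamma=V(\mathbf{A}_K)\cap\overline{\Gamma},$$ where $\overline{\Gamma}$ is the closure of $\Gamma$ in $\mathbf{A}_K^g$.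
   Context: Places: each $v\in\Omega$ is the discrete valuation of $K$ given by an irreducible divisor of $\mathcal{V}$, with absolute value $|\cdot|_v$, completion $K_v$ and valuation ring $\mathcal{O}_v\subseteq K_v$; every nonzero element of $\mathbb{F}$ has $|x|_v=1$. The adèle ring $\mathbf{A}_K$ is the restricted direct product of the $K_v$ ($v\in\Omega_1$) with respect to the $\mathcal{O}_v$: tuples $(x_v)_{v\in\Omega_1}$ with $x_v\in K_v$ and $x_v\in\mathcal{O}_v$ for all but finitely many $v$, with the restricted product topology (so $\prod_{v\in\Omega_1}\mathcal{O}_v$ is open with the product topology). $\mathbf{A}_K^g$ carries the product topology and $K^g$ embeds diagonally; $V(\mathbf{A}_K)\subseteq\mathbf{A}_K^g$ denotes the adèlic points of $V$. $\operatorname{End}_K(\mathbb{G}_a)$ is the ring of additive polynomials over $K$ under addition and composition; write $\Phi_a=\Phi(a)$. $\Phi$ is of generic characteristic if $\Phi_t(x)=tx+c_1x^p+\cdots+c_Dx^{p^D}$ with $c_i\in K$, $D\geq1$, $c_D\neq0$. $R$ acts on $K^g$ and on $\mathbf{A}_K^g$ coordinatewise via $a\cdot x=\Phi_a(x)$; a $\Phi(R)$-submodule of $K^g$ is a submodule for this action. *)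

theory Defs
  imports
    "HOL-Analysis.Analysis"
    "HOL-Algebra.Algebraic_Closure_Type"
    "HOL-Algebra.QuotRing"
    "HOL-Algebra.Generated_Fields"
    "HOL-Library.Poly_Mapping"
    "HOL-Library.Function_Algebras"
    "HOL-Computational_Algebra.Fraction_Field"
    "Berlekamp_Zassenhaus.Finite_Field"
begin

section \<open>Multivariate polynomials\<close>

type_synonym 'a mpol = "(nat \<Rightarrow>\<^sub>0 nat) \<Rightarrow>\<^sub>0 'a"

text \<open>The polynomial ring in the variables \<open>X k\<close>, \<open>k \<in> A\<close>.\<close>

definition mpol_ring :: "nat set \<Rightarrow> 'a::comm_ring_1 mpol ring" where
  "mpol_ring A =
    \<lparr>carrier = {f. \<forall>m\<in>Poly_Mapping.keys f. Poly_Mapping.keys m \<subseteq> A},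
     monoid.mult = (*), one = 1, ring.zero = 0, add = (+)\<rparr>"

definition mpol_var :: "nat \<Rightarrow> 'a::comm_ring_1 mpol" where
  "mpol_var k = Poly_Mapping.single (Poly_Mapping.single k 1) 1"

definition homog :: "nat \<Rightarrow> 'a::comm_ring_1 mpol \<Rightarrow> bool" where
  "homog d f \<longleftrightarrow>
    (\<forall>m\<in>Poly_Mapping.keys f. (\<Sum>k\<in>Poly_Mapping.keys m. Poly_Mapping.lookup m k) = d)"

definition mpol_eval ::
  "('a::comm_ring_1 \<Rightarrow> 'b::comm_ring_1) \<Rightarrow> (nat \<Rightarrow> 'b) \<Rightarrow> 'a mpol \<Rightarrow> 'b" where
  "mpol_eval \<phi> x f =
    (\<Sum>m\<in>Poly_Mapping.keys f. \<phi> (Poly_Mapping.lookup f m) *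
       (\<Prod>k\<in>Poly_Mapping.keys m. x k ^ Poly_Mapping.lookup m k))"

text \<open>The same evaluation, with values in a ring given by a record.\<close>

definition mpol_eval_in ::
  "('b, 'c) ring_scheme \<Rightarrow> ('a::comm_ring_1 \<Rightarrow> 'b) \<Rightarrow> (nat \<Rightarrow> 'b) \<Rightarrow> 'a mpol \<Rightarrow> 'b" where
  "mpol_eval_in A \<phi> x f =
    finsum A (\<lambda>m. \<phi> (Poly_Mapping.lookup f m) \<otimes>\<^bsub>A\<^esub>
       finprod A (\<lambda>k. x k [^]\<^bsub>A\<^esub> Poly_Mapping.lookup m k) (Poly_Mapping.keys m))
     (Poly_Mapping.keys f)"

definition mpol_pderiv :: "nat \<Rightarrow> 'a::comm_ring_1 mpol \<Rightarrow> 'a mpol" where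
  "mpol_pderiv k f =
    (\<Sum>m\<in>Poly_Mapping.keys f. Poly_Mapping.single (m - Poly_Mapping.single k 1)
       (of_nat (Poly_Mapping.lookup m k) * Poly_Mapping.lookup f m))"


section \<open>Field extensions\<close>

text \<open>An extension of fields is given by a field homomorphism \<open>\<iota> :: 'f \<Rightarrow> 'k\<close>.\<close>

definition algebraic_over :: "'k::field set \<Rightarrow> 'k \<Rightarrow> bool" where
  "algebraic_over L x \<longleftrightarrow>
    (\<exists>q. q \<noteq> 0 \<and> (\<forall>k. Polynomial.coeff q k \<in> L) \<and> poly q x = 0)"

definition algebraically_closed_in :: "'k::field set \<Rightarrow> bool" where
  "algebraically_closed_in L \<longleftrightarrow> (\<forall>x. algebraic_over L x \<longrightarrow> x \<in> L)"

definition finite_field_extension :: "('f::field \<Rightarrow> 'k::field) \<Rightarrow> bool" where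
  "finite_field_extension \<iota> \<longleftrightarrow>
    (\<exists>B. finite B \<and> module.span (\<lambda>c x. \<iota> c * x) B = UNIV)"

definition finitely_generated_extension :: "('f::field \<Rightarrow> 'k::field) \<Rightarrow> bool" where
  "finitely_generated_extension \<iota> \<longleftrightarrow>
    (\<exists>B. finite B \<and> generate_field ring_of_type_algebra (range \<iota> \<union> B) = UNIV)"

definition has_transcendence_degree :: "('f::field \<Rightarrow> 'k::field) \<Rightarrow> nat \<Rightarrow> bool" where
  "has_transcendence_degree \<iota> d \<longleftrightarrow>
    (\<exists>b. (\<forall>f\<in>carrier (mpol_ring {..<d}). mpol_eval \<iota> b f = 0 \<longrightarrow> f = 0) \<and>
         (\<forall>x. algebraic_over
                (generate_field ring_of_type_algebra (range \<iota> \<union> b ` {..<d})) x))"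


section \<open>Projective varieties\<close>

text \<open>
  An integral closed subscheme of projective \<open>n\<close>-space is given by its homogeneous prime ideal,
  which must not contain the irrelevant ideal.
\<close>

definition projective_variety :: "nat \<Rightarrow> 'f::field mpol set \<Rightarrow> bool" where
  "projective_variety n I \<longleftrightarrow>
    primeideal I (mpol_ring {..n}) \<and>
    I = genideal (mpol_ring {..n}) {f \<in> I. \<exists>d. homog d f} \<and>
    (\<exists>k\<le>n. mpol_var k \<notin> I)"

text \<open>
  Homogeneous coordinates, over the algebraic closure, of the common zeros in projective
  \<open>n\<close>-space. Coordinates beyond \<open>n\<close> are irrelevant.
\<close>

definition geometric_points :: "nat \<Rightarrow> 'f::field mpol set \<Rightarrow> (nat \<Rightarrow> 'f alg_closure) set" where
  "geometric_points n I = {x. (\<exists>k\<le>n. x k \<noteq> 0) \<and> (\<forall>f\<in>I. mpol_eval to_ac x f = 0)}"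

definition projective_zeros :: "nat \<Rightarrow> 'a::field mpol set \<Rightarrow> (nat \<Rightarrow> 'a) set" where
  "projective_zeros n S = {x. (\<exists>k\<le>n. x k \<noteq> 0) \<and> (\<forall>f\<in>S. mpol_eval id x f = 0)}"

definition homogeneous_family :: "nat \<Rightarrow> 'a::field mpol set \<Rightarrow> bool" where
  "homogeneous_family n S \<longleftrightarrow> (\<forall>f\<in>S. f \<in> carrier (mpol_ring {..n}) \<and> (\<exists>d. homog d f))"

definition geometrically_irreducible :: "nat \<Rightarrow> 'f::field mpol set \<Rightarrow> bool" where
  "geometrically_irreducible n I \<longleftrightarrow>
    geometric_points n I \<noteq> {} \<and>
    (\<forall>S T. homogeneous_family n S \<and> homogeneous_family n T \<and>
        geometric_points n I \<subseteq> projective_zeros n S \<union> projective_zeros n T \<longrightarrow>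
        geometric_points n I \<subseteq> projective_zeros n S \<or>
        geometric_points n I \<subseteq> projective_zeros n T)"

text \<open>
  Jacobian criterion: at each geometric point, the gradients of the equations of the affine cone
  (which has dimension \<open>d + 1\<close> in affine \<open>(n + 1)\<close>-space) span a space of dimension \<open>n - d\<close>.
\<close>

definition smooth_of_dimension :: "nat \<Rightarrow> nat \<Rightarrow> 'f::field mpol set \<Rightarrow> bool" where
  "smooth_of_dimension n d I \<longleftrightarrow>
    (\<forall>x\<in>geometric_points n I.
       vector_space.dim (\<lambda>(c::'f alg_closure) (w::nat \<Rightarrow> 'f alg_closure) k. c * w k)
         {(\<lambda>k. mpol_eval to_ac x (mpol_pderiv k f)) | f. f \<in> I} + d = n)"

text \<open>
  The isomorphism from the function field of the variety of \<open>I\<close> (homogeneous fractions of degree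
  \<open>0\<close> with denominator outside \<open>I\<close>, modulo \<open>I\<close>) onto \<open>'k\<close> is recorded by the homogeneous
  coordinates \<open>z\<close> of the generic point: it maps the class of \<open>f / g\<close> to \<open>f z / g z\<close>.
\<close>

definition is_function_field ::
  "('f::field \<Rightarrow> 'k::field) \<Rightarrow> nat \<Rightarrow> 'f mpol set \<Rightarrow> (nat \<Rightarrow> 'k) \<Rightarrow> bool" where
  "is_function_field \<iota> n I z \<longleftrightarrow>
    (\<forall>d. \<forall>f\<in>carrier (mpol_ring {..n}). homog d f \<longrightarrow> (f \<in> I \<longleftrightarrow> mpol_eval \<iota> z f = 0)) \<and>
    (\<forall>x. \<exists>d. \<exists>f\<in>carrier (mpol_ring {..n}). \<exists>g\<in>carrier (mpol_ring {..n}).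
       homog d f \<and> homog d g \<and> g \<notin> I \<and> x = mpol_eval \<iota> z f / mpol_eval \<iota> z g)"

text \<open>
  Irreducible divisors, i.e. irreducible closed subsets of codimension one: the maximal proper
  irreducible closed subsets.
\<close>

definition irreducible_divisor :: "nat \<Rightarrow> 'f::field mpol set \<Rightarrow> 'f mpol set \<Rightarrow> bool" where
  "irreducible_divisor n I P \<longleftrightarrow>
    projective_variety n P \<and> I \<subset> P \<and>
    \<not> (\<exists>Q. projective_variety n Q \<and> I \<subset> Q \<and> Q \<subset> P)"

definition local_ring_at ::
  "('f::field \<Rightarrow> 'k::field) \<Rightarrow> nat \<Rightarrow> (nat \<Rightarrow> 'k) \<Rightarrow> 'f mpol set \<Rightarrow> 'k set" where
  "local_ring_at \<iota> n z P =
    {mpol_eval \<iota> z f / mpol_eval \<iota> z g | d f g.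
       f \<in> carrier (mpol_ring {..n}) \<and> g \<in> carrier (mpol_ring {..n}) \<and>
       homog d f \<and> homog d g \<and> g \<notin> P}"


section \<open>Places\<close>

text \<open>
  Normalized discrete valuations. The value at \<open>0\<close> (infinity in the literature) is fixed to the
  dummy value \<open>0\<close>, so that a valuation is determined by its values on nonzero elements.
\<close>

type_synonym 'k place = "'k \<Rightarrow> int"

definition discrete_valuation :: "'k::field place \<Rightarrow> bool" where
  "discrete_valuation v \<longleftrightarrow>
    v 0 = 0 \<and>
    (\<forall>x y. x \<noteq> 0 \<and> y \<noteq> 0 \<longrightarrow> v (x * y) = v x + v y) \<and>
    (\<forall>x y. x \<noteq> 0 \<and> y \<noteq> 0 \<and> x + y \<noteq> 0 \<longrightarrow> min (v x) (v y) \<le> v (x + y)) \<and>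
    (\<exists>x. x \<noteq> 0 \<and> v x = 1)"

definition valuation_ring :: "'k::field place \<Rightarrow> 'k set" where
  "valuation_ring v = {x. x = 0 \<or> 0 \<le> v x}"

definition divisor_places ::
  "('f::field \<Rightarrow> 'k::field) \<Rightarrow> nat \<Rightarrow> 'f mpol set \<Rightarrow> (nat \<Rightarrow> 'k) \<Rightarrow> 'k place set" where
  "divisor_places \<iota> n I z =
    {v. discrete_valuation v \<and>
        (\<exists>P. irreducible_divisor n I P \<and> valuation_ring v = local_ring_at \<iota> n z P)}"

text \<open>The base \<open>2\<close> is immaterial: all bases greater than \<open>1\<close> give the same completion.\<close>

definition vabs :: "'k::field place \<Rightarrow> 'k \<Rightarrow> real" where
  "vabs v x = (if x = 0 then 0 else 2 powi (- v x))"


section \<open>Completions\<close>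

text \<open>The completion at \<open>v\<close> is the ring of Cauchy sequences modulo the null sequences.\<close>

definition cauchy_ring :: "'k::field place \<Rightarrow> (nat \<Rightarrow> 'k) ring" where
  "cauchy_ring v =
    \<lparr>carrier = {s. \<forall>e>0. \<exists>N. \<forall>m\<ge>N. \<forall>n\<ge>N. vabs v (s m - s n) < e},
     monoid.mult = (\<lambda>s t n. s n * t n), one = (\<lambda>n. 1),
     ring.zero = (\<lambda>n. 0), add = (\<lambda>s t n. s n + t n)\<rparr>"

definition null_sequences :: "'k::field place \<Rightarrow> (nat \<Rightarrow> 'k) set" where
  "null_sequences v = {s. (\<lambda>n. vabs v (s n)) \<longlonglongrightarrow> 0}"

definition completion :: "'k::field place \<Rightarrow> (nat \<Rightarrow> 'k) set ring" where
  "completion v = cauchy_ring v Quot null_sequences v"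

definition to_completion :: "'k::field place \<Rightarrow> 'k \<Rightarrow> (nat \<Rightarrow> 'k) set" where
  "to_completion v x = null_sequences v +>\<^bsub>cauchy_ring v\<^esub> (\<lambda>n. x)"

definition completion_abs :: "'k::field place \<Rightarrow> (nat \<Rightarrow> 'k) set \<Rightarrow> real" where
  "completion_abs v a = lim (\<lambda>n. vabs v ((SOME s. s \<in> a) n))"

definition completion_integers :: "'k::field place \<Rightarrow> (nat \<Rightarrow> 'k) set set" where
  "completion_integers v = {a \<in> carrier (completion v). completion_abs v a \<le> 1}"

text \<open>The locale \<open>Metric_space\<close> also constrains distances outside the carrier, hence the guard.\<close>

definition completion_topology :: "'k::field place \<Rightarrow> (nat \<Rightarrow> 'k) set topology" where
  "completion_topology v =
    Metric_space.mtopology (carrier (completion v))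
      (\<lambda>a b. if a \<in> carrier (completion v) \<and> b \<in> carrier (completion v)
             then completion_abs v (a \<ominus>\<^bsub>completion v\<^esub> b) else 0)"


section \<open>Adeles\<close>

type_synonym 'k adele = "'k place \<Rightarrow> (nat \<Rightarrow> 'k) set"

definition adele_ring :: "'k::field place set \<Rightarrow> 'k adele ring" where
  "adele_ring \<Omega> =
    \<lparr>carrier = {x \<in> (\<Pi>\<^sub>E v\<in>\<Omega>. carrier (completion v)).
                  finite {v \<in> \<Omega>. x v \<notin> completion_integers v}},
     monoid.mult = (\<lambda>x y. \<lambda>v\<in>\<Omega>. x v \<otimes>\<^bsub>completion v\<^esub> y v),
     one = (\<lambda>v\<in>\<Omega>. \<one>\<^bsub>completion v\<^esub>),
     ring.zero = (\<lambda>v\<in>\<Omega>. \<zero>\<^bsub>completion v\<^esub>),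
     add = (\<lambda>x y. \<lambda>v\<in>\<Omega>. x v \<oplus>\<^bsub>completion v\<^esub> y v)\<rparr>"

definition adele_topology :: "'k::field place set \<Rightarrow> 'k adele topology" where
  "adele_topology \<Omega> = topology_generated_by
    {(\<Pi>\<^sub>E v\<in>\<Omega>. U v) | U.
       (\<forall>v\<in>\<Omega>. openin (completion_topology v) (U v)) \<and>
       finite {v \<in> \<Omega>. U v \<noteq> completion_integers v}}"

definition to_adele :: "'k::field place set \<Rightarrow> 'k \<Rightarrow> 'k adele" where
  "to_adele \<Omega> x = (\<lambda>v\<in>\<Omega>. to_completion v x)"

text \<open>
  \<open>K\<^sup>g\<close> consists of the functions vanishing outside \<open>{..<g}\<close> (so that pointwise addition
  of functions is its addition), whereas adelic \<open>g\<close>-space follows the convention of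
  \<^const>\<open>product_topology\<close>: functions that are \<^const>\<open>undefined\<close> outside \<open>{..<g}\<close>.
\<close>

definition affine_space :: "nat \<Rightarrow> (nat \<Rightarrow> 'k::field) set" where
  "affine_space g = {x. \<forall>k\<ge>g. x k = 0}"

definition adelic_space_topology :: "'k::field place set \<Rightarrow> nat \<Rightarrow> (nat \<Rightarrow> 'k adele) topology" where
  "adelic_space_topology \<Omega> g = product_topology (\<lambda>_. adele_topology \<Omega>) {..<g}"

definition diagonal :: "'k::field place set \<Rightarrow> nat \<Rightarrow> (nat \<Rightarrow> 'k) \<Rightarrow> (nat \<Rightarrow> 'k adele)" where
  "diagonal \<Omega> g x = (\<lambda>k\<in>{..<g}. to_adele \<Omega> (x k))"

text \<open>Points of the affine variety defined by a family \<open>S\<close> of polynomials over \<open>K\<close>.\<close>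

definition rational_points :: "nat \<Rightarrow> 'k::field mpol set \<Rightarrow> (nat \<Rightarrow> 'k) set" where
  "rational_points g S = {x \<in> affine_space g. \<forall>f\<in>S. mpol_eval id x f = 0}"

definition adelic_points ::
  "'k::field place set \<Rightarrow> nat \<Rightarrow> 'k mpol set \<Rightarrow> (nat \<Rightarrow> 'k adele) set" where
  "adelic_points \<Omega> g S =
    {x \<in> (\<Pi>\<^sub>E k\<in>{..<g}. carrier (adele_ring \<Omega>)).
       \<forall>f\<in>S. mpol_eval_in (adele_ring \<Omega>) (to_adele \<Omega>) x f = \<zero>\<^bsub>adele_ring \<Omega>\<^esub>}"


section \<open>Drinfeld modules\<close>

text \<open>The identity \<open>f (x + y) = f x + f y\<close> in \<open>K[x][y]\<close>.\<close>

definition additive_poly :: "'k::field poly \<Rightarrow> bool" where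
  "additive_poly f \<longleftrightarrow>
    pcompose (map_poly (\<lambda>c. [:c:]) f) [:[:0, 1:], 1:] = [:f:] + map_poly (\<lambda>c. [:c:]) f"

definition End_Ga :: "'k::field poly ring" where
  "End_Ga = \<lparr>carrier = {f. additive_poly f}, monoid.mult = pcompose, one = [:0, 1:],
             ring.zero = 0, add = (+)\<rparr>"

text \<open>Here \<open>\<theta>\<close> is the image of \<open>t\<close> in \<open>K\<close>.\<close>

definition drinfeld_module_generic ::
  "'k::field \<Rightarrow> ('p::prime_card mod_ring poly \<Rightarrow> 'k poly) \<Rightarrow> bool" where
  "drinfeld_module_generic \<theta> \<Phi> \<longleftrightarrow>
    \<Phi> \<in> Ring.ring_hom ring_of_type_algebra End_Ga \<and>
    (\<exists>D c. D \<ge> 1 \<and> c 0 = \<theta> \<and> c D \<noteq> 0 \<and>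
       \<Phi> [:0, 1:] = (\<Sum>i\<le>D. Polynomial.monom (c i) (CARD('p) ^ i)))"

definition drinfeld_action ::
  "('p::prime_card mod_ring poly \<Rightarrow> 'k::field poly) \<Rightarrow> 'p mod_ring poly \<Rightarrow> (nat \<Rightarrow> 'k) \<Rightarrow> (nat \<Rightarrow> 'k)"
  where "drinfeld_action \<Phi> a x = (\<lambda>k. poly (\<Phi> a) (x k))"

definition fg_drinfeld_submodule ::
  "('p::prime_card mod_ring poly \<Rightarrow> 'k::field poly) \<Rightarrow> nat \<Rightarrow> (nat \<Rightarrow> 'k) set \<Rightarrow> bool" where
  "fg_drinfeld_submodule \<Phi> g \<Gamma> \<longleftrightarrow>
    \<Gamma> \<subseteq> affine_space g \<and> module.subspace (drinfeld_action \<Phi>) \<Gamma> \<and>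
    (\<exists>B. finite B \<and> B \<subseteq> \<Gamma> \<and> \<Gamma> = module.span (drinfeld_action \<Phi>) B)"

end

theory Submission
  imports Defs
begin

hide_const (open) Polynomials.degree Polynomials.lead_coeff Poly_Mapping.degree Module.smult UnivPoly.coeff UnivPoly.monom
  Divisibility.prime

text \<open>
  The closure of \<open>\<Gamma>\<close> is \<open>\<Gamma>\<close> itself, because \<open>\<Gamma>\<close> is discrete already in the completion at any single place
  \<open>w\<close>. Since \<open>t\<close> is a unit at \<open>w\<close>, every \<open>\<Phi>\<^sub>a\<close> with \<open>a \<noteq> 0\<close> preserves the order at \<open>w\<close> of all sufficiently
  small elements. Elements of \<open>\<Gamma>\<close> of pairwise different large orders are therefore linearly independent
  over the polynomial ring in \<open>t\<close>, and there are at most as many of those as \<open>\<Gamma>\<close> has generators.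

  Two geometric facts are needed: there are infinitely many places, so that \<open>\<Omega>1\<close> is nonempty, and a
  function has only finitely many poles, so that \<open>K\<close> embeds into the adeles. The second one is the
  finiteness of the minimal primes over an ideal in a Noetherian ring. For the first one, the places
  \<open>b\<^sub>0 = c\<close> of a rational function field \<open>F(b\<^sub>0, \<dots>, b\<^sub>d\<^sub>-\<^sub>1)\<close> are extended along a finite separable and then
  a purely inseparable extension to \<open>K\<close>, keeping the property that the valuation rings are
  localizations of one finitely generated ring.
\<close>

section \<open>Subrings and subfields\<close>

text \<open>Discreteness needs a threshold of smallness that is independent of a. It comes from t
  alone: in \<Phi>_t(x) = \<theta> x + sum of c_i x^(p^i) the terms with i \<ge> 1 have order at
  least v(c_i) + 2 v(x), so for large v(x) they are negligible against \<theta> x. This congruence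
  passes to every a by adding and composing, because constants are integral: \<Phi>_a(x) is
  a(\<theta>) x up to higher order, and a(\<theta>) is a nonzero constant. On the geometric side the
  obstacle is that a discrete valuation of K trivial on the constants need not belong to a divisor
  of the given variety. One finite generating set, over which every ring of the family is a
  localization, singles out suitable ones: after dropping finitely many rings it can be traded for
  coordinates of the variety, and being a localization forces the center to have codimension one.
  Rings are subsets of a fixed field, so that a tower of subfields of K costs no change of
  type.\<close>

definition subring_set :: "'a::comm_ring_1 set \<Rightarrow> bool" where
  "subring_set A \<longleftrightarrow> 1 \<in> A \<and> (\<forall>x\<in>A. \<forall>y\<in>A. x - y \<in> A \<and> x * y \<in> A)"

definition subfield_set :: "'a::field set \<Rightarrow> bool" where
  "subfield_set L \<longleftrightarrow> subring_set L \<and> (\<forall>x\<in>L. inverse x \<in> L)"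

lemma subring_setI:
  assumes "1 \<in> A" "\<And>x y. x \<in> A \<Longrightarrow> y \<in> A \<Longrightarrow> x - y \<in> A"
    and "\<And>x y. x \<in> A \<Longrightarrow> y \<in> A \<Longrightarrow> x * y \<in> A"
  shows "subring_set A"
  using assms by (auto simp: subring_set_def)

lemma subring_set_one: "subring_set A \<Longrightarrow> 1 \<in> A"
  and subring_set_diff: "subring_set A \<Longrightarrow> x \<in> A \<Longrightarrow> y \<in> A \<Longrightarrow> x - y \<in> A"
  and subring_set_mult: "subring_set A \<Longrightarrow> x \<in> A \<Longrightarrow> y \<in> A \<Longrightarrow> x * y \<in> A"
  by (auto simp: subring_set_def)

lemma subring_set_zero: "subring_set A \<Longrightarrow> 0 \<in> A"
  using subring_set_diff[of A 1 1] subring_set_one[of A] by simp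

lemma subring_set_uminus: "subring_set A \<Longrightarrow> x \<in> A \<Longrightarrow> - x \<in> A"
  using subring_set_diff[of A 0 x] subring_set_zero[of A] by simp

lemma subring_set_add: "subring_set A \<Longrightarrow> x \<in> A \<Longrightarrow> y \<in> A \<Longrightarrow> x + y \<in> A"
  using subring_set_diff[of A x "- y"] subring_set_uminus[of A y] by simp

lemma subring_set_power: "subring_set A \<Longrightarrow> x \<in> A \<Longrightarrow> x ^ n \<in> A"
  by (induction n) (auto simp: subring_set_one subring_set_mult)

lemma subring_set_sum: "subring_set A \<Longrightarrow> (\<And>i. i \<in> S \<Longrightarrow> f i \<in> A) \<Longrightarrow> sum f S \<in> A"
  by (induction S rule: infinite_finite_induct) (auto simp: subring_set_zero subring_set_add)

lemma subring_set_prod: "subring_set A \<Longrightarrow> (\<And>i. i \<in> S \<Longrightarrow> f i \<in> A) \<Longrightarrow> prod f S \<in> A"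
  by (induction S rule: infinite_finite_induct) (auto simp: subring_set_one subring_set_mult)

lemma subring_set_of_nat: "subring_set A \<Longrightarrow> of_nat n \<in> A"
  by (induction n) (auto simp: subring_set_zero subring_set_one subring_set_add)

lemmas subring_set_closed = subring_set_one subring_set_diff subring_set_mult subring_set_zero
  subring_set_uminus subring_set_add subring_set_power subring_set_sum subring_set_prod
  subring_set_of_nat

lemma subfield_set_subring: "subfield_set L \<Longrightarrow> subring_set L"
  and subfield_set_inverse: "subfield_set L \<Longrightarrow> x \<in> L \<Longrightarrow> inverse x \<in> L"
  by (auto simp: subfield_set_def)

lemma subfield_set_divide: "subfield_set L \<Longrightarrow> x \<in> L \<Longrightarrow> y \<in> L \<Longrightarrow> x / y \<in> L"
  by (simp add: divide_inverse subring_set_mult subfield_set_subring subfield_set_inverse)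

inductive_set rgen :: "'a::comm_ring_1 set \<Rightarrow> 'a set" for S where
  rgen_incl: "x \<in> S \<Longrightarrow> x \<in> rgen S"
| rgen_one: "1 \<in> rgen S"
| rgen_diff: "x \<in> rgen S \<Longrightarrow> y \<in> rgen S \<Longrightarrow> x - y \<in> rgen S"
| rgen_mult: "x \<in> rgen S \<Longrightarrow> y \<in> rgen S \<Longrightarrow> x * y \<in> rgen S"

lemma subring_set_rgen: "subring_set (rgen S)"
  by (auto simp: subring_set_def rgen.intros)

lemma rgen_minimal:
  assumes "subring_set A" "S \<subseteq> A"
  shows "rgen S \<subseteq> A"
proof
  fix x assume "x \<in> rgen S"
  then show "x \<in> A"
    by induction (use assms in \<open>auto simp: subring_set_closed\<close>)
qed

lemma rgen_mono: "S \<subseteq> T \<Longrightarrow> rgen S \<subseteq> rgen T"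
  by (intro rgen_minimal subring_set_rgen) (auto intro: rgen_incl)

text \<open>The generated subfield. Zero denominators are harmless: \<open>x / 0 = 0\<close> lies in
  it anyway, which saves a side condition in every membership proof.\<close>

definition fgen :: "'a::field set \<Rightarrow> 'a set" where
  "fgen S = {x / y | x y. x \<in> rgen S \<and> y \<in> rgen S}"

lemma rgen_subset_fgen: "rgen S \<subseteq> fgen S"
proof
  fix x assume "x \<in> rgen S"
  then show "x \<in> fgen S"
    unfolding fgen_def using rgen_one[of S] by (intro CollectI exI[of _ x] exI[of _ 1]) auto
qed

lemma subset_fgen: "S \<subseteq> fgen S"
  using rgen_subset_fgen[of S] by (auto intro: rgen_incl)

lemma subfield_set_fgen: "subfield_set (fgen S)"
  unfolding subfield_set_def
proof (intro conjI subring_setI ballI)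
  note cl = subring_set_closed[OF subring_set_rgen]
  show "1 \<in> fgen S" using rgen_subset_fgen rgen_one by blast
  show "inverse x \<in> fgen S" if "x \<in> fgen S" for x
    using that unfolding fgen_def by force
  fix x y assume "x \<in> fgen S" "y \<in> fgen S"
  then obtain a b c d where *: "x = a / b" "y = c / d" "a \<in> rgen S" "b \<in> rgen S" "c \<in> rgen S" "d \<in> rgen S"
    unfolding fgen_def by blast
  show "x * y \<in> fgen S"
    unfolding fgen_def using * by (intro CollectI exI[of _ "a * c"] exI[of _ "b * d"]) (auto simp: cl)
  show "x - y \<in> fgen S"
  proof (cases "b = 0 \<or> d = 0")
    case True
    then have "x - y = (if b = 0 then - c else a) / (if b = 0 then d else b)"
      using * by auto
    then show ?thesis unfolding fgen_def using *
      by (intro CollectI exI[of _ "if b = 0 then - c else a"] exI[of _ "if b = 0 then d else b"])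
        (auto simp: cl)
  next
    case False
    then show ?thesis unfolding fgen_def using *
      by (intro CollectI exI[of _ "a * d - c * b"] exI[of _ "b * d"]) (auto simp: cl field_simps)
  qed
qed

lemma fgen_minimal:
  assumes "subfield_set L" "S \<subseteq> L"
  shows "fgen S \<subseteq> L"
  using rgen_minimal[OF subfield_set_subring[OF assms(1)] assms(2)]
  by (auto simp: fgen_def intro!: subfield_set_divide[OF assms(1)])

lemma fgen_mono: "S \<subseteq> T \<Longrightarrow> fgen S \<subseteq> fgen T"
  by (rule fgen_minimal[OF subfield_set_fgen]) (use subset_fgen in blast)

lemma fgen_union_fgen: "fgen (fgen S \<union> T) = fgen (S \<union> T)"
proof
  have "fgen S \<subseteq> fgen (S \<union> T)" by (rule fgen_mono) auto
  then show "fgen (fgen S \<union> T) \<subseteq> fgen (S \<union> T)"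
    using subset_fgen[of "S \<union> T"] by (intro fgen_minimal subfield_set_fgen) auto
  show "fgen (S \<union> T) \<subseteq> fgen (fgen S \<union> T)"
    using subset_fgen[of S] by (intro fgen_mono) auto
qed

text \<open>The hypotheses on K speak of \<open>generate_field\<close>; this inclusion is the bridge
  to subfields given as sets closed under the type class operations.\<close>

lemma generate_field_subset:
  assumes L: "subfield_set L" and S: "S \<subseteq> L"
  shows "generate_field ring_of_type_algebra S \<subseteq> L"
proof
  let ?R = "ring_of_type_algebra :: 'a ring"
  interpret R: Ring.field ?R by (rule field_from_type_algebra)
  note [simp] = ring_of_type_algebra_def
  fix x assume "x \<in> generate_field ?R S"
  then show "x \<in> L"
  proof induction
    case one
    show ?case using L by (simp add: subring_set_closed subfield_set_subring)
  next
    case (incl h)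
    then show ?case using S by auto
  next
    case (a_inv h)
    have "\<ominus>\<^bsub>?R\<^esub> h = - h"
      using R.minus_equality[of "-h" h] by simp
    then show ?case using a_inv L by (simp add: subring_set_closed subfield_set_subring)
  next
    case (m_inv h)
    have "inv\<^bsub>?R\<^esub> h = inverse h"
      using R.comm_inv_char[of h "inverse h"] m_inv by simp
    then show ?case using m_inv L by (simp add: subfield_set_inverse)
  next
    case (eng_add h1 h2)
    then show ?case using L by (simp add: subring_set_closed subfield_set_subring)
  next
    case (eng_mult h1 h2)
    then show ?case using L by (simp add: subring_set_closed subfield_set_subring)
  qed
qed

section \<open>Polynomials with coefficients in a subring\<close>

definition coeffs_in :: "'a::comm_ring_1 set \<Rightarrow> 'a poly \<Rightarrow> bool" where
  "coeffs_in A h \<longleftrightarrow> (\<forall>i. coeff h i \<in> A)"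

lemma coeffs_in_mono: "A \<subseteq> B \<Longrightarrow> coeffs_in A h \<Longrightarrow> coeffs_in B h"
  by (auto simp: coeffs_in_def)

context
  fixes A :: "'a::comm_ring_1 set"
  assumes A: "subring_set A"
begin

lemma coeffs_in_0: "coeffs_in A 0"
  and coeffs_in_1: "coeffs_in A 1"
  and coeffs_in_const: "c \<in> A \<Longrightarrow> coeffs_in A [:c:]"
  and coeffs_in_var: "coeffs_in A [:0, 1:]"
  and coeffs_in_add: "coeffs_in A f \<Longrightarrow> coeffs_in A h \<Longrightarrow> coeffs_in A (f + h)"
  and coeffs_in_diff: "coeffs_in A f \<Longrightarrow> coeffs_in A h \<Longrightarrow> coeffs_in A (f - h)"
  and coeffs_in_mult: "coeffs_in A f \<Longrightarrow> coeffs_in A h \<Longrightarrow> coeffs_in A (f * h)"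
  and coeffs_in_smult: "c \<in> A \<Longrightarrow> coeffs_in A h \<Longrightarrow> coeffs_in A (smult c h)"
  and coeffs_in_monom: "c \<in> A \<Longrightarrow> coeffs_in A (monom c n)"
  and coeffs_in_uminus: "coeffs_in A f \<Longrightarrow> coeffs_in A (- f)"
  using A by (auto simp: coeffs_in_def subring_set_closed coeff_mult coeff_pCons
      split: nat.splits)

lemmas coeffs_in_closed = coeffs_in_0 coeffs_in_1 coeffs_in_const coeffs_in_var coeffs_in_add
  coeffs_in_diff coeffs_in_mult coeffs_in_smult coeffs_in_monom coeffs_in_uminus

lemma poly_in_subring:
  assumes "coeffs_in A h" "x \<in> A"
  shows "poly h x \<in> A"
  unfolding poly_altdef using assms A by (auto simp: coeffs_in_def subring_set_closed)

lemma subring_set_adjoin: "subring_set {poly h x | h. coeffs_in A h}"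
proof (rule subring_setI)
  show "1 \<in> {poly h x | h. coeffs_in A h}"
    by (auto intro!: exI[of _ 1] coeffs_in_1)
  fix u v assume "u \<in> {poly h x | h. coeffs_in A h}" "v \<in> {poly h x | h. coeffs_in A h}"
  then obtain f h where *: "u = poly f x" "v = poly h x" "coeffs_in A f" "coeffs_in A h" by auto
  show "u - v \<in> {poly h x | h. coeffs_in A h}"
    using * by (auto intro!: exI[of _ "f - h"] coeffs_in_diff)
  show "u * v \<in> {poly h x | h. coeffs_in A h}"
    using * by (auto intro!: exI[of _ "f * h"] coeffs_in_mult)
qed

lemma adjoin_superset: "A \<subseteq> {poly h x | h. coeffs_in A h}"
  by (auto intro!: exI[of _ "[:_:]"] coeffs_in_const)

lemma adjoin_elem: "x \<in> {poly h x | h. coeffs_in A h}"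
  by (auto intro!: exI[of _ "[:0, 1:]"] coeffs_in_var)

lemma rgen_insert_adjoin:
  assumes "S \<subseteq> A"
  shows "rgen (insert x S) \<subseteq> {poly h x | h. coeffs_in A h}"
  using assms adjoin_superset adjoin_elem[of x]
  by (intro rgen_minimal subring_set_adjoin) blast

text \<open>Division by a monic polynomial never divides by a coefficient, so quotient and remainder
  stay over A, although the type may be a much larger ring.\<close>

lemma monic_division:
  assumes "monic d" "coeffs_in A d" "coeffs_in A h"
  shows "\<exists>s r. coeffs_in A s \<and> coeffs_in A r \<and> h = d * s + r \<and> (r = 0 \<or> degree r < degree d)"
  using assms(3)
proof (induction "degree h" arbitrary: h rule: less_induct)
  case less
  show ?case
  proof (cases "degree h < degree d \<or> h = 0")
    case True
    then show ?thesis using less.prems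
      by (intro exI[of _ 0] exI[of _ h]) (auto simp: coeffs_in_0)
  next
    case False
    define m where "m = monom (lead_coeff h) (degree h - degree d)"
    define h' where "h' = h - d * m"
    have m: "coeffs_in A m" using less.prems
      unfolding m_def by (intro coeffs_in_monom) (auto simp: coeffs_in_def)
    have h': "coeffs_in A h'" unfolding h'_def by (intro coeffs_in_diff coeffs_in_mult less.prems m assms(2))
    have dm: "degree (d * m) \<le> degree h"
    proof -
      have "degree (d * m) \<le> degree d + degree m" by (rule degree_mult_le)
      also have "\<dots> \<le> degree d + (degree h - degree d)"
        unfolding m_def using degree_monom_le by (intro add_left_mono) blast
      finally show ?thesis using False by auto
    qed
    have co: "coeff (d * m) (degree h) = lead_coeff h"
    proof -
      have "coeff (m * d) (degree h) = lead_coeff h * coeff d (degree h - (degree h - degree d))"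
        unfolding m_def by (subst coeff_monom_mult) auto
      then show ?thesis using False assms(1) by (simp add: mult.commute)
    qed
    have "h' = 0 \<or> degree h' < degree h"
    proof -
      have "degree h' \<le> degree h" unfolding h'_def using dm by (intro degree_diff_le) auto
      moreover have "coeff h' (degree h) = 0" unfolding h'_def using co by simp
      ultimately show ?thesis
        by (metis le_neq_implies_less leading_coeff_0_iff)
    qed
    then consider "h' = 0" | "degree h' < degree h" by blast
    then obtain s r where sr: "coeffs_in A s" "coeffs_in A r" "h' = d * s + r" "r = 0 \<or> degree r < degree d"
    proof cases
      case 1 then show ?thesis using that[of 0 0] by (auto simp: coeffs_in_0)
    next
      case 2 then show ?thesis using less.hyps[OF 2 h'] that by blast
    qed
    have "h = d * (m + s) + r" using sr(3) by (simp add: h'_def algebra_simps)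
    then show ?thesis using sr m by (intro exI[of _ "m + s"] exI[of _ r]) (auto simp: coeffs_in_add)
  qed
qed

end

lemma coeffs_in_pderiv:
  "subring_set A \<Longrightarrow> coeffs_in A f \<Longrightarrow> coeffs_in A (pderiv f)" for A :: "'a::field set"
  by (auto simp: coeffs_in_def subring_set_mult subring_set_of_nat[of A "Suc _", simplified] coeff_pderiv)

section \<open>Minimal polynomials and separability\<close>

definition min_poly :: "'a::field set \<Rightarrow> 'a \<Rightarrow> 'a poly \<Rightarrow> bool" where
  "min_poly L x f \<longleftrightarrow> monic f \<and> coeffs_in L f \<and> poly f x = 0 \<and>
    (\<forall>h. coeffs_in L h \<and> h \<noteq> 0 \<and> poly h x = 0 \<longrightarrow> degree f \<le> degree h)"

text \<open>The Bezout identity replaces coprimality of f and f', and f need not be minimal. An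
  identity between finitely many coefficients survives passing to a larger field and to almost all
  rings of a family, where it can be read modulo \<pi>.\<close>

definition separable_over :: "'a::field set \<Rightarrow> 'a \<Rightarrow> bool" where
  "separable_over L x \<longleftrightarrow> (\<exists>f u v. coeffs_in L f \<and> coeffs_in L u \<and> coeffs_in L v \<and>
     poly f x = 0 \<and> u * f + v * pderiv f = 1)"

lemma ex_min_poly:
  assumes L: "subfield_set L" and h: "coeffs_in L h" "h \<noteq> 0" "poly h x = 0"
  obtains f where "min_poly L x f"
proof -
  define P where "P = (\<lambda>h. coeffs_in L h \<and> h \<noteq> 0 \<and> poly h x = 0)"
  have "P h" using h by (auto simp: P_def)
  then obtain f where f: "P f" "\<And>h. P h \<Longrightarrow> degree f \<le> degree h"
    using ex_has_least_nat[of P h degree] by auto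
  define f' where "f' = smult (inverse (lead_coeff f)) f"
  have "inverse (lead_coeff f) \<in> L"
    using f(1) L by (auto simp: P_def coeffs_in_def subfield_set_inverse)
  then have "coeffs_in L f'" unfolding f'_def using f(1) L
    by (intro coeffs_in_smult) (auto simp: P_def subfield_set_subring)
  then have "min_poly L x f'" using f unfolding min_poly_def
    by (auto simp: f'_def P_def)
  then show ?thesis using that by blast
qed

lemma min_poly_dvd:
  assumes L: "subfield_set L" and f: "min_poly L x f" and h: "coeffs_in L h" "poly h x = 0"
  obtains e where "coeffs_in L e" "h = f * e"
proof -
  obtain s r where sr: "coeffs_in L s" "coeffs_in L r" "h = f * s + r" "r = 0 \<or> degree r < degree f"
    using monic_division[OF subfield_set_subring[OF L], of f h] f h by (auto simp: min_poly_def)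
  have "poly r x = 0" using sr(3) h f by (auto simp: min_poly_def)
  then have "r = 0" using f sr unfolding min_poly_def by force
  then show ?thesis using sr that by simp
qed

lemma min_poly_degree_pos: "min_poly L x f \<Longrightarrow> degree f > 0"
  unfolding min_poly_def by (metis gr0I monic_degree_0 poly_1 zero_neq_one)

text \<open>An element d of least degree in the ideal of L[T] generated by f and h divides both. It
  does not vanish at x because h does not, so the cofactor of d in f vanishes at x, and the
  minimality of f leaves d = 1.\<close>

lemma min_poly_bezout:
  assumes L: "subfield_set L" and f: "min_poly L x f" and h: "coeffs_in L h" "poly h x \<noteq> 0"
  obtains u v where "coeffs_in L u" "coeffs_in L v" "u * f + v * h = 1"
proof -
  note R = subfield_set_subring[OF L]
  note cl = coeffs_in_closed[OF R]
  have fL: "coeffs_in L f" "monic f" "f \<noteq> 0" using f by (auto simp: min_poly_def)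
  define S where "S = (\<lambda>d. \<exists>u v. coeffs_in L u \<and> coeffs_in L v \<and> d = u * f + v * h)"
  have S0: "S f" "S h" unfolding S_def
    by (intro exI[of _ 1] exI[of _ 0], simp add: cl) (intro exI[of _ 0] exI[of _ 1], simp add: cl)
  have Sc: "S (a * s - c * t)" if st: "S s" "S t" and ac: "coeffs_in L a" "coeffs_in L c" for a c s t
  proof -
    obtain u v u' v' where "coeffs_in L u" "coeffs_in L v" "s = u * f + v * h"
      "coeffs_in L u'" "coeffs_in L v'" "t = u' * f + v' * h" using st unfolding S_def by blast
    then show ?thesis unfolding S_def using ac
      by (intro exI[of _ "a * u - c * u'"] exI[of _ "a * v - c * v'"]) (auto simp: cl algebra_simps)
  qed
  have SL: "coeffs_in L s" if "S s" for s using that h fL unfolding S_def by (auto simp: cl)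
  have "\<exists>d. (S d \<and> d \<noteq> 0) \<and> (\<forall>e. S e \<and> e \<noteq> 0 \<longrightarrow> degree d \<le> degree e)"
    by (rule ex_has_least_nat[of "\<lambda>d. S d \<and> d \<noteq> 0" f]) (use S0 fL in auto)
  then obtain d0 where d0: "S d0" "d0 \<noteq> 0" "\<And>e. S e \<Longrightarrow> e \<noteq> 0 \<Longrightarrow> degree d0 \<le> degree e" by blast
  define d where "d = smult (inverse (lead_coeff d0)) d0"
  have "inverse (lead_coeff d0) \<in> L" using SL[OF d0(1)] L by (auto simp: coeffs_in_def subfield_set_inverse)
  then have "S ([:inverse (lead_coeff d0):] * d0 - 0 * d0)" using d0 by (intro Sc) (auto simp: cl)
  then have d: "S d" by (simp add: d_def)
  have dm: "monic d" "d \<noteq> 0" and ddeg: "degree d = degree d0" using d0 by (auto simp: d_def)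
  have dvd: "\<exists>e. coeffs_in L e \<and> s = d * e" if s: "S s" for s
  proof -
    obtain e r where er: "coeffs_in L e" "coeffs_in L r" "s = d * e + r" "r = 0 \<or> degree r < degree d"
      using monic_division[OF R dm(1) SL[OF d] SL[OF s]] by blast
    have "S (1 * s - e * d)" by (rule Sc[OF s d]) (auto simp: cl er)
    moreover have "1 * s - e * d = r" using er by (simp add: algebra_simps)
    ultimately have "S r" by simp
    then have "r = 0" using d0(3)[of r] er ddeg by fastforce
    then show ?thesis using er by auto
  qed
  obtain e where e: "coeffs_in L e" "f = d * e" using dvd[OF S0(1)] by blast
  have "poly d x \<noteq> 0"
  proof
    assume "poly d x = 0"
    moreover obtain e' where "h = d * e'" using dvd[OF S0(2)] by blast
    ultimately show False using h by simp
  qed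
  then have "poly e x = 0" using e f by (auto simp: min_poly_def)
  then have "degree f \<le> degree e" using e fL f unfolding min_poly_def by auto
  moreover have "degree f = degree d + degree e" using e fL dm by (metis degree_mult_eq mult_eq_0_iff)
  ultimately have "degree d = 0" by simp
  then have "d = 1" using dm by (metis monic_degree_0)
  then show ?thesis using d that unfolding S_def by metis
qed

text \<open>A factor of a separable polynomial is separable: if f = g * e, the product rule turns
  the Bezout identity of f and f' into one of g and g'. Here g is the minimal polynomial over the
  larger field.\<close>

lemma separable_over_min_poly:
  assumes L: "subfield_set L" and x: "separable_over L0 x" and L0: "L0 \<subseteq> L"
  obtains f u v where "min_poly L x f" "coeffs_in L u" "coeffs_in L v" "u * f + v * pderiv f = 1"
proof -
  note R = subfield_set_subring[OF L]
  note cl = coeffs_in_closed[OF R]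
  obtain f u v where *: "coeffs_in L f" "coeffs_in L u" "coeffs_in L v" "poly f x = 0" "u * f + v * pderiv f = 1"
    using x coeffs_in_mono[OF L0] unfolding separable_over_def by blast
  have "f \<noteq> 0" using *(5) by auto
  then obtain g where g: "min_poly L x g" using ex_min_poly[OF L *(1) _ *(4)] by blast
  obtain e where e: "coeffs_in L e" "f = g * e" using min_poly_dvd[OF L g *(1,4)] by blast
  have gL: "coeffs_in L g" using g by (auto simp: min_poly_def)
  have "(u * e + v * pderiv e) * g + (v * e) * pderiv g = 1"
    using *(5) unfolding e by (simp add: pderiv_mult algebra_simps)
  then show ?thesis using that[OF g, of "u * e + v * pderiv e" "v * e"] * e by (auto simp: cl coeffs_in_pderiv[OF R])
qed

lemma pderiv_eq_0_char:
  fixes f :: "'a::field poly"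
  assumes "CHAR('a) = p" "prime p" "pderiv f = 0" "coeff f i \<noteq> 0"
  shows "p dvd i"
proof (cases i)
  case (Suc k)
  have "of_nat (Suc k) * coeff f (Suc k) = 0"
    using assms(3) by (metis coeff_pderiv coeff_0)
  then have "of_nat i = (0::'a)" using assms(4) Suc by auto
  then show ?thesis using assms(1) of_nat_eq_0_iff_char_dvd by blast
qed auto

text \<open>Either the minimal polynomial f has a nonzero derivative, which by its degree cannot
  vanish at x and so is coprime to f, or f is a polynomial g in T^p, and x^p is a root of g, whose
  degree is smaller.\<close>

lemma ex_separable_power:
  fixes x :: "'a::field"
  assumes L: "subfield_set L" and p: "CHAR('a) = p" "prime p"
    and h: "coeffs_in L h" "h \<noteq> 0" "poly h x = 0"
  shows "\<exists>e. separable_over L (x ^ (p ^ e))"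
  using h
proof (induction "degree h" arbitrary: h x rule: less_induct)
  case less
  note R = subfield_set_subring[OF L]
  obtain f where f: "min_poly L x f" using ex_min_poly[OF L less.prems] by blast
  have fL: "coeffs_in L f" "monic f" "poly f x = 0" using f by (auto simp: min_poly_def)
  have dfh: "degree f \<le> degree h" using f less.prems by (auto simp: min_poly_def)
  show ?case
  proof (cases "pderiv f = 0")
    case False
    have "poly (pderiv f) x \<noteq> 0"
    proof
      assume "poly (pderiv f) x = 0"
      then have "degree f \<le> degree (pderiv f)"
        using f False coeffs_in_pderiv[OF R fL(1)] by (auto simp: min_poly_def)
      then show False using min_poly_degree_pos[OF f] degree_pderiv_le[of f] by linarith
    qed
    then obtain u v where "coeffs_in L u" "coeffs_in L v" "u * f + v * pderiv f = 1"
      using min_poly_bezout[OF L f coeffs_in_pderiv[OF R fL(1)]] by blast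
    then have "separable_over L (x ^ (p ^ 0))" using fL unfolding separable_over_def by auto
    then show ?thesis by blast
  next
    case True
    note pd = pderiv_eq_0_char[OF p True]
    have p1: "p > 1" using p prime_gt_1_nat by blast
    define n where "n = degree f div p"
    have pn: "p dvd degree f" using pd[of "degree f"] fL by auto
    then have dn: "degree f = p * n" by (simp add: n_def)
    \<comment> \<open>f(T) = g(T^p), as only exponents divisible by p occur in f.\<close>
    define g where "g = (\<Sum>i\<le>n. monom (coeff f (p * i)) i)"
    have cg: "coeff g i = (if i \<le> n then coeff f (p * i) else 0)" for i
      unfolding g_def by (simp add: coeff_sum coeff_monom)
    have gL: "coeffs_in L g" using fL(1) R by (auto simp: coeffs_in_def cg subring_set_zero)
    have g0: "g \<noteq> 0" using cg[of n] fL(2) dn by auto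
    have gx: "poly g (x ^ p) = 0"
    proof -
      have "poly g (x ^ p) = (\<Sum>i\<le>n. coeff f (p * i) * x ^ (p * i))"
        unfolding g_def by (simp add: poly_sum poly_monom power_mult)
      also have "\<dots> = (\<Sum>j\<in>(\<lambda>i. p * i) ` {..n}. coeff f j * x ^ j)"
        using p1 by (subst sum.reindex) (auto simp: inj_on_def)
      also have "\<dots> = (\<Sum>j\<le>degree f. coeff f j * x ^ j)"
      proof (rule sum.mono_neutral_left)
        show "(\<lambda>i. p * i) ` {..n} \<subseteq> {..degree f}" using dn by auto
        show "\<forall>j\<in>{..degree f} - (\<lambda>i. p * i) ` {..n}. coeff f j * x ^ j = 0"
        proof
          fix j assume j: "j \<in> {..degree f} - (\<lambda>i. p * i) ` {..n}"
          have "\<not> p dvd j"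
          proof
            assume "p dvd j"
            then obtain k where "j = p * k" by auto
            then show False using j dn p1 by auto
          qed
          then show "coeff f j * x ^ j = 0" using pd[of j] by auto
        qed
      qed auto
      also have "\<dots> = poly f x" by (simp add: poly_altdef)
      finally show ?thesis using fL by simp
    qed
    have "degree g \<le> n" unfolding g_def
      by (intro degree_sum_le) (auto intro: order.trans[OF degree_monom_le])
    moreover have "n < degree f" using min_poly_degree_pos[OF f] dn p1 by (metis mult_less_cancel2 nat_mult_1 mult_0_right gr0I less_irrefl)
    ultimately have "degree g < degree h" using dfh by simp
    then obtain e where "separable_over L ((x ^ p) ^ (p ^ e))"
      using less.hyps[OF _ gL g0 gx] by blast
    then have "separable_over L (x ^ (p ^ Suc e))" by (simp add: power_mult[symmetric])
    then show ?thesis by blast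
  qed
qed

lemma subfield_set_adjoin:
  assumes L: "subfield_set L" and f: "min_poly L x f"
  shows "subfield_set {poly h x | h. coeffs_in L h}"
  unfolding subfield_set_def
proof (intro conjI subring_set_adjoin subfield_set_subring[OF L] ballI)
  fix y assume "y \<in> {poly h x | h. coeffs_in L h}"
  then obtain h where h: "y = poly h x" "coeffs_in L h" by blast
  show "inverse y \<in> {poly h x | h. coeffs_in L h}"
  proof (cases "y = 0")
    case False
    then obtain u v where uv: "coeffs_in L u" "coeffs_in L v" "u * f + v * h = 1"
      using min_poly_bezout[OF L f h(2)] h(1) by metis
    have "poly v x * y = 1" using arg_cong[OF uv(3), of "\<lambda>q. poly q x"] f h by (simp add: min_poly_def)
    then have "inverse y = poly v x" by (metis inverse_unique mult.commute)
    then show ?thesis using uv by blast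
  qed (use h in auto)
qed

section \<open>Discrete valuation rings in a field\<close>

text \<open>R sits in a larger field and its fraction field is left open, so that the rings
  belonging to all subfields of a tower have one type. That R is a valuation ring of a subfield L is
  stated separately as \<open>x \<in> R \<or> inverse x \<in> R\<close> for x in L.\<close>

definition dvr :: "'a::field set \<Rightarrow> 'a \<Rightarrow> bool" where
  "dvr R \<pi> \<longleftrightarrow> subring_set R \<and> \<pi> \<in> R \<and> inverse \<pi> \<notin> R \<and>
    (\<forall>x\<in>R. x \<noteq> 0 \<longrightarrow> (\<exists>k u. x = u * \<pi> ^ k \<and> u \<in> R \<and> inverse u \<in> R))"

text \<open>For C contained in R, this is the localization of \<open>rgen C\<close> at its
  intersection with the maximal ideal of R: the denominators are the elements that become units in
  R.\<close>

definition loc :: "'a::field set \<Rightarrow> 'a set \<Rightarrow> 'a set" where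
  "loc C R = {a / g | a g. a \<in> rgen C \<and> g \<in> rgen C \<and> g \<noteq> 0 \<and> inverse g \<in> R}"

text \<open>
  All members of \<open>W\<close> are localizations of the same ring \<open>rgen C\<close>. Two finitely generated rings with
  the same fraction field have the same localizations almost everywhere, so almost all members of
  such a family are local rings of any given projective model.
\<close>

definition dvr_family :: "'a::field set \<Rightarrow> 'a set \<Rightarrow> 'a set set \<Rightarrow> 'a set \<Rightarrow> bool" where
  "dvr_family F L W C \<longleftrightarrow> subfield_set L \<and> finite C \<and> infinite W \<and>
    (\<forall>R\<in>W. R \<subseteq> L \<and> (\<exists>\<pi>. dvr R \<pi>) \<and> F \<subseteq> R \<and> C \<subseteq> R \<and> R \<subseteq> loc C R \<and>
       (\<forall>x\<in>L. x \<in> R \<or> inverse x \<in> R)) \<and>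
    (\<forall>x\<in>L. finite {R\<in>W. x \<notin> R})"

lemma dvr_subring: "dvr R \<pi> \<Longrightarrow> subring_set R"
  and dvr_uniformizer_in: "dvr R \<pi> \<Longrightarrow> \<pi> \<in> R"
  and dvr_uniformizer_nonunit: "dvr R \<pi> \<Longrightarrow> inverse \<pi> \<notin> R"
  by (auto simp: dvr_def)

lemma dvr_uniformizer_nonzero: "dvr R \<pi> \<Longrightarrow> \<pi> \<noteq> 0"
  by (auto simp: dvr_def subring_set_zero)

lemma dvr_decomp:
  "dvr R \<pi> \<Longrightarrow> x \<in> R \<Longrightarrow> x \<noteq> 0 \<Longrightarrow> \<exists>k u. x = u * \<pi> ^ k \<and> u \<in> R \<and> inverse u \<in> R"
  by (simp add: dvr_def)

lemma dvr_nonunit_factor: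
  assumes R: "dvr R \<pi>" and x: "x \<in> R" "x = 0 \<or> inverse x \<notin> R"
  obtains y where "y \<in> R" "x = \<pi> * y"
proof (cases "x = 0")
  case True
  then show ?thesis using that[of 0] dvr_subring[OF R] by (auto simp: subring_set_zero)
next
  case False
  then obtain k u where ku: "x = u * \<pi> ^ k" "u \<in> R" "inverse u \<in> R"
    using dvr_decomp[OF R x(1)] by blast
  then obtain j where "k = Suc j" using x False by (cases k) auto
  then show ?thesis using that[of "u * \<pi> ^ j"] ku R
    by (auto simp: algebra_simps subring_set_closed dvr_subring dvr_uniformizer_in)
qed

text \<open>An element outside a discrete valuation ring has an inverse divisible by \<pi>, so a
  ring containing it and R would invert \<pi>. This recovers R from an extension as its trace on the
  smaller field, so that extending rings is injective.\<close>

lemma dvr_trace: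
  assumes R: "dvr R \<pi>" and R': "subring_set R'" "R \<subseteq> R'" "inverse \<pi> \<notin> R'"
    and x: "x \<in> R'" "x \<in> R \<or> inverse x \<in> R"
  shows "x \<in> R"
proof (rule ccontr)
  assume "x \<notin> R"
  then have ix: "inverse x \<in> R" "x \<noteq> 0" using x dvr_subring[OF R] by (auto simp: subring_set_zero)
  obtain y where y: "y \<in> R" "inverse x = \<pi> * y"
    using dvr_nonunit_factor[OF R ix(1)] \<open>x \<notin> R\<close> by auto
  then have "inverse \<pi> = x * y" using ix(2) dvr_uniformizer_nonzero[OF R]
    by (auto simp: field_simps)
  then show False using R' x y by (auto simp: subring_set_mult)
qed

lemma subring_set_loc:
  assumes R: "subring_set R"
  shows "subring_set (loc C R)"
proof (rule subring_setI)
  note cl = subring_set_closed[OF subring_set_rgen]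
  show "1 \<in> loc C R" unfolding loc_def using R
    by (intro CollectI exI[of _ 1]) (auto simp: cl subring_set_closed)
  fix x y assume "x \<in> loc C R" "y \<in> loc C R"
  then obtain a g b h where *: "x = a / g" "a \<in> rgen C" "g \<in> rgen C" "g \<noteq> 0" "inverse g \<in> R"
      "y = b / h" "b \<in> rgen C" "h \<in> rgen C" "h \<noteq> 0" "inverse h \<in> R"
    unfolding loc_def by blast
  have "x - y = (a * h - b * g) / (g * h)" using * by (simp add: field_simps)
  then show "x - y \<in> loc C R" unfolding loc_def using *
    by (intro CollectI exI[of _ "a * h - b * g"] exI[of _ "g * h"])
       (auto simp: cl subring_set_mult[OF R])
  show "x * y \<in> loc C R" unfolding loc_def using *
    by (intro CollectI exI[of _ "a * b"] exI[of _ "g * h"]) (auto simp: cl subring_set_mult[OF R])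
qed

lemma rgen_subset_loc:
  assumes "subring_set R"
  shows "rgen C \<subseteq> loc C R"
proof
  fix x assume "x \<in> rgen C"
  then show "x \<in> loc C R"
    unfolding loc_def using assms rgen_one[of C]
    by (intro CollectI exI[of _ x] exI[of _ 1]) (simp add: subring_set_one)
qed

lemma loc_inverse:
  assumes R: "subring_set R" and x: "x \<in> loc C R" "inverse x \<in> R"
  shows "inverse x \<in> loc C R"
proof (cases "x = 0")
  case True
  then show ?thesis using x by simp
next
  case False
  obtain a g where *: "x = a / g" "a \<in> rgen C" "g \<in> rgen C" "g \<noteq> 0" "inverse g \<in> R"
    using x unfolding loc_def by blast
  have "inverse a = inverse x * inverse g" using * by (simp add: field_simps)
  then have "inverse a \<in> R" using subring_set_mult[OF R x(2) *(5)] by (simp only:)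
  then show ?thesis unfolding loc_def using * False by (intro CollectI exI[of _ g] exI[of _ a]) auto
qed

lemma loc_quotient:
  assumes R: "subring_set R" and x: "x \<in> loc C R" "y \<in> loc C R" "inverse y \<in> R"
  shows "x / y \<in> loc C R"
  using loc_inverse[OF R x(2,3)] x(1) subring_set_loc[OF R]
  by (simp add: divide_inverse subring_set_mult)

lemma loc_trans:
  assumes R: "subring_set R" "subring_set R'" "R \<subseteq> R'" and C: "C \<subseteq> loc D R'"
  shows "loc C R \<subseteq> loc D R'"
proof
  fix x assume "x \<in> loc C R"
  then obtain a g where *: "x = a / g" "a \<in> rgen C" "g \<in> rgen C" "g \<noteq> 0" "inverse g \<in> R"
    unfolding loc_def by blast
  have "rgen C \<subseteq> loc D R'" by (rule rgen_minimal[OF subring_set_loc[OF R(2)] C])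
  then show "x \<in> loc D R'" using * R by (auto intro!: loc_quotient)
qed

lemma dvr_family_subfield: "dvr_family F L W C \<Longrightarrow> subfield_set L"
  and dvr_family_finite_gen: "dvr_family F L W C \<Longrightarrow> finite C"
  and dvr_family_infinite: "dvr_family F L W C \<Longrightarrow> infinite W"
  and dvr_family_cofinite: "dvr_family F L W C \<Longrightarrow> x \<in> L \<Longrightarrow> finite {R\<in>W. x \<notin> R}"
  unfolding dvr_family_def by simp_all

lemma dvr_familyD:
  assumes "dvr_family F L W C" "R \<in> W"
  shows "R \<subseteq> L" "\<exists>\<pi>. dvr R \<pi>" "F \<subseteq> R" "C \<subseteq> R" "R \<subseteq> loc C R"
    "\<And>x. x \<in> L \<Longrightarrow> x \<in> R \<or> inverse x \<in> R"
  using assms unfolding dvr_family_def by simp_all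

lemma dvr_family_subring: "dvr_family F L W C \<Longrightarrow> R \<in> W \<Longrightarrow> subring_set R"
  using dvr_familyD(2) dvr_subring by metis

lemma dvr_family_cofinite_poly:
  assumes W: "dvr_family F L W C" and h: "coeffs_in L h"
  shows "finite {R\<in>W. \<not> coeffs_in R h}"
proof -
  have "{R\<in>W. \<not> coeffs_in R h} \<subseteq> (\<Union>i\<le>degree h. {R\<in>W. coeff h i \<notin> R})"
  proof
    fix R assume R: "R \<in> {R\<in>W. \<not> coeffs_in R h}"
    then obtain i where i: "coeff h i \<notin> R" by (auto simp: coeffs_in_def)
    have "0 \<in> R" using subring_set_zero[OF dvr_family_subring[OF W]] R by blast
    then have "i \<le> degree h" using i by (metis coeff_eq_0 not_le)
    then show "R \<in> (\<Union>i\<le>degree h. {R\<in>W. coeff h i \<notin> R})" using R i by auto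
  qed
  moreover have "finite (\<Union>i\<le>degree h. {R\<in>W. coeff h i \<notin> R})"
    using dvr_family_cofinite[OF W] h unfolding coeffs_in_def by auto
  ultimately show ?thesis by (rule finite_subset)
qed

section \<open>Extension of a family along a separable element\<close>

text \<open>Zorn's lemma for the ideals containing p and avoiding 1; the last conjunct says that A /
  N is a field.\<close>

lemma ex_maximal_proper_ideal:
  fixes A :: "'a::comm_ring_1 set"
  assumes A: "subring_set A" and p: "p \<in> A" "\<And>a. a \<in> A \<Longrightarrow> p * a \<noteq> 1"
  shows "\<exists>N\<subseteq>A. p \<in> N \<and> 1 \<notin> N \<and> (\<forall>x\<in>N. \<forall>y\<in>N. x - y \<in> N) \<and>
    (\<forall>a\<in>A. \<forall>x\<in>N. a * x \<in> N) \<and> (\<forall>a\<in>A - N. \<exists>b\<in>A. 1 - a * b \<in> N)"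
proof -
  define Is where "Is = {J. J \<subseteq> A \<and> p \<in> J \<and> 1 \<notin> J \<and> (\<forall>x\<in>J. \<forall>y\<in>J. x - y \<in> J) \<and> (\<forall>a\<in>A. \<forall>x\<in>J. a * x \<in> J)}"
  have "\<exists>M\<in>Is. \<forall>Q\<in>Is. M \<subseteq> Q \<longrightarrow> Q = M"
  proof (rule subset_Zorn_nonempty)
    have "(\<lambda>a. p * a) ` A \<in> Is"
      unfolding Is_def
    proof (intro CollectI conjI ballI)
      show "(\<lambda>a. p * a) ` A \<subseteq> A" using A p by (auto simp: subring_set_mult)
      show "p \<in> (\<lambda>a. p * a) ` A" using A by (auto intro!: image_eqI[of _ _ 1] simp: subring_set_one)
      show "1 \<notin> (\<lambda>a. p * a) ` A" using p by force
    next
      fix x y assume "x \<in> (\<lambda>a. p * a) ` A" "y \<in> (\<lambda>a. p * a) ` A"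
      then show "x - y \<in> (\<lambda>a. p * a) ` A" using A
        by (auto simp: subring_set_diff right_diff_distrib[symmetric])
    next
      fix a x assume "a \<in> A" "x \<in> (\<lambda>a. p * a) ` A"
      then show "a * x \<in> (\<lambda>a. p * a) ` A" using A by (auto simp: subring_set_mult mult.left_commute[of a p])
    qed
    then show "Is \<noteq> {}" by blast
  next
    fix \<C> assume c: "\<C> \<noteq> {}" "subset.chain Is \<C>"
    then have ci: "\<C> \<subseteq> Is" and tot: "\<And>Q Y. Q \<in> \<C> \<Longrightarrow> Y \<in> \<C> \<Longrightarrow> Q \<subseteq> Y \<or> Y \<subseteq> Q"
      unfolding subset.chain_def by auto
    show "\<Union>\<C> \<in> Is" unfolding Is_def
    proof (intro CollectI conjI ballI)
      fix x y assume "x \<in> \<Union>\<C>" "y \<in> \<Union>\<C>"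
      then obtain Q Y where XY: "Q \<in> \<C>" "x \<in> Q" "Y \<in> \<C>" "y \<in> Y" by blast
      then obtain Z where "Z \<in> \<C>" "x \<in> Z" "y \<in> Z" using tot by blast
      then show "x - y \<in> \<Union>\<C>" using ci unfolding Is_def by blast
    next
      fix a x assume "a \<in> A" "x \<in> \<Union>\<C>"
      then obtain Z where "Z \<in> \<C>" "x \<in> Z" by blast
      moreover have "a * x \<in> Z" using ci \<open>Z \<in> \<C>\<close> \<open>x \<in> Z\<close> \<open>a \<in> A\<close> unfolding Is_def by blast
      ultimately show "a * x \<in> \<Union>\<C>" by blast
    qed (use c ci in \<open>auto simp: Is_def\<close>)
  qed
  then obtain N where N: "N \<in> Is" and max: "\<And>Q. Q \<in> Is \<Longrightarrow> N \<subseteq> Q \<Longrightarrow> Q = N" by blast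
  have NA: "N \<subseteq> A" "p \<in> N" "1 \<notin> N" and Nd: "\<And>x y. x \<in> N \<Longrightarrow> y \<in> N \<Longrightarrow> x - y \<in> N"
    and Nm: "\<And>a x. a \<in> A \<Longrightarrow> x \<in> N \<Longrightarrow> a * x \<in> N" using N by (auto simp: Is_def)
  have N0: "0 \<in> N" using Nd[OF NA(2,2)] by simp
  have inv: "\<exists>b\<in>A. 1 - a * b \<in> N" if a: "a \<in> A" "a \<notin> N" for a
  proof (rule ccontr)
    assume con: "\<not> (\<exists>b\<in>A. 1 - a * b \<in> N)"
    \<comment> \<open>The ideal N + a A; without an inverse of a modulo N it would be a proper ideal
      larger than N.\<close>
    define Q where "Q = {x + a * b | x b. x \<in> N \<and> b \<in> A}"
    have NQ: "N \<subseteq> Q" unfolding Q_def using A by (force intro: subring_set_zero)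
    have "a \<in> Q" unfolding Q_def using N0 A by (force intro: subring_set_one)
    then have "Q \<noteq> N" using a by auto
    moreover have "Q \<in> Is" unfolding Is_def
    proof (intro CollectI conjI ballI)
      show "Q \<subseteq> A" using NA a A by (auto simp: Q_def subring_set_closed)
      show "p \<in> Q" using NQ NA by auto
      show "1 \<notin> Q"
      proof
        assume "1 \<in> Q"
        then obtain x b where "1 = x + a * b" "x \<in> N" "b \<in> A" by (auto simp: Q_def)
        moreover from this have "1 - a * b = x" by (simp add: algebra_simps)
        ultimately show False using con by auto
      qed
    next
      fix x y assume "x \<in> Q" "y \<in> Q"
      then obtain x' b y' c where *: "x = x' + a * b" "x' \<in> N" "b \<in> A" "y = y' + a * c" "y' \<in> N" "c \<in> A"
        by (auto simp: Q_def)
      then have "x - y = (x' - y') + a * (b - c)" by (simp add: algebra_simps)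
      then show "x - y \<in> Q" using * A Nd unfolding Q_def by (blast intro: subring_set_diff)
    next
      fix c x assume c: "c \<in> A" "x \<in> Q"
      then obtain x' b where *: "x = x' + a * b" "x' \<in> N" "b \<in> A" by (auto simp: Q_def)
      then have "c * x = c * x' + a * (c * b)" by (simp add: algebra_simps)
      then show "c * x \<in> Q" using * c A Nm unfolding Q_def by (blast intro: subring_set_mult)
    qed
    ultimately show False using max[of Q] NQ by auto
  qed
  show ?thesis using NA Nd Nm inv by (intro exI[of _ N]) auto
qed

text \<open>The exponent k in \<open>x * y = \<pi> ^ k\<close> drops each time a factor \<pi> is
  split off x, so the splitting stops without any chain condition on R.\<close>

lemma dvr_from_divisors:
  assumes R: "subring_set R" "\<pi> \<in> R" "inverse \<pi> \<notin> R"
    and fac: "\<And>x. x \<in> R \<Longrightarrow> inverse x \<notin> R \<Longrightarrow> \<exists>y\<in>R. x = \<pi> * y"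
    and div: "\<And>x. x \<in> R \<Longrightarrow> x \<noteq> 0 \<Longrightarrow> \<exists>y\<in>R. \<exists>k. x * y = \<pi> ^ k"
  shows "dvr R \<pi>"
proof -
  have p0: "\<pi> \<noteq> 0" using R by (auto simp: subring_set_zero)
  have "\<exists>m u. x = u * \<pi> ^ m \<and> u \<in> R \<and> inverse u \<in> R"
    if "x \<in> R" "y \<in> R" "x * y = \<pi> ^ k" for x y k
    using that
  proof (induction k arbitrary: x)
    case 0
    then have "inverse x = y" by (simp add: inverse_unique)
    then show ?case using 0 by (intro exI[of _ 0] exI[of _ x]) auto
  next
    case (Suc k)
    show ?case
    proof (cases "inverse x \<in> R")
      case True
      then show ?thesis using Suc by (intro exI[of _ 0] exI[of _ x]) auto
    next
      case False
      then obtain z where z: "z \<in> R" "x = \<pi> * z" using fac Suc.prems by blast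
      then have "z * y = \<pi> ^ k" using Suc.prems p0 by auto
      then obtain m u where "z = u * \<pi> ^ m \<and> u \<in> R \<and> inverse u \<in> R" using Suc.IH[OF z(1) Suc.prems(2)] by blast
      then show ?thesis using z by (intro exI[of _ "Suc m"] exI[of _ u]) auto
    qed
  qed
  then show ?thesis unfolding dvr_def using R div by blast
qed

lemma dvr_clear_denominators:
  assumes R: "dvr R \<pi>" and val: "\<And>y. y \<in> L \<Longrightarrow> y \<in> R \<or> inverse y \<in> R" and h: "coeffs_in L h"
  shows "\<exists>k. coeffs_in R (smult (\<pi> ^ k) h)"
proof -
  note Rr = dvr_subring[OF R]
  note p0 = dvr_uniformizer_nonzero[OF R]
  note pR = dvr_uniformizer_in[OF R]
  have den: "\<exists>k. c * \<pi> ^ k \<in> R" if c: "c \<in> L" for c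
  proof (cases "c \<in> R")
    case True then show ?thesis by (intro exI[of _ 0]) auto
  next
    case False
    then have "inverse c \<in> R" "inverse c \<noteq> 0" using val[OF c] subring_set_zero[OF Rr] by auto
    then obtain k u where "inverse c = u * \<pi> ^ k" "u \<in> R" "inverse u \<in> R" using dvr_decomp[OF R] by blast
    moreover from this have "c = inverse (u * \<pi> ^ k)" by (metis inverse_inverse_eq)
    ultimately have "c * \<pi> ^ k = inverse u" using p0 by simp
    then show ?thesis using \<open>inverse u \<in> R\<close> by (intro exI[of _ k]) simp
  qed
  have "\<exists>k. \<forall>i\<le>n. coeff h i * \<pi> ^ k \<in> R" for n
  proof (induction n)
    case 0 then show ?case using den h by (auto simp: coeffs_in_def)
  next
    case (Suc n)
    obtain k l where k: "\<forall>i\<le>n. coeff h i * \<pi> ^ k \<in> R" "coeff h (Suc n) * \<pi> ^ l \<in> R"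
      using Suc den h by (meson coeffs_in_def)
    have "coeff h i * \<pi> ^ (k + l) \<in> R" if "i \<le> Suc n" for i
    proof (cases "i \<le> n")
      case True
      then have "(coeff h i * \<pi> ^ k) * \<pi> ^ l \<in> R" using k pR Rr by (auto simp: subring_set_closed)
      then show ?thesis by (simp add: power_add mult.assoc)
    next
      case False
      then have "i = Suc n" using that by auto
      then have "(coeff h i * \<pi> ^ l) * \<pi> ^ k \<in> R" using k pR Rr by (auto simp: subring_set_closed)
      then show ?thesis by (simp add: power_add mult_ac)
    qed
    then show ?case by blast
  qed
  then obtain k where k: "\<forall>i\<le>degree h. coeff h i * \<pi> ^ k \<in> R" by blast
  have "coeffs_in R (smult (\<pi> ^ k) h)" unfolding coeffs_in_def
  proof
    fix i show "coeff (smult (\<pi> ^ k) h) i \<in> R"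
      using k subring_set_zero[OF Rr] by (cases "i \<le> degree h") (auto simp: mult.commute coeff_eq_0)
  qed
  then show ?thesis by blast
qed

text \<open>
  The extension is \<open>R[x]\<close> localized at a maximal ideal \<open>N\<close> above \<open>\<pi>\<close>. Modulo \<open>\<pi>\<close> the minimal
  polynomial \<open>f\<close> is squarefree, so the factor \<open>\<phi>\<close> of \<open>f\<close> belonging to \<open>N\<close> is, up to a unit of the
  localization, divisible by \<open>\<pi>\<close>; hence \<open>\<pi>\<close> still generates the maximal ideal.
\<close>

lemma dvr_adjoin_separable:
  fixes x :: "'a::field"
  assumes L: "subfield_set L" and RL: "R \<subseteq> L" and R: "dvr R \<pi>"
    and val: "\<And>y. y \<in> L \<Longrightarrow> y \<in> R \<or> inverse y \<in> R"
    and f: "min_poly L x f" and fR: "coeffs_in R f" and uR: "coeffs_in R u" and vR: "coeffs_in R v"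
    and sep: "u * f + v * pderiv f = 1"
  defines "A \<equiv> {poly h x | h. coeffs_in R h}"
  shows "\<exists>R'. dvr R' \<pi> \<and> A \<subseteq> R' \<and> R' \<subseteq> {poly h x | h. coeffs_in L h} \<and>
    (\<forall>y\<in>R'. \<exists>a\<in>A. \<exists>s\<in>A. y = a / s \<and> s \<noteq> 0 \<and> inverse s \<in> R')"
proof -
  note Rr = dvr_subring[OF R]
  note cl = coeffs_in_closed[OF Rr]
  have f0: "poly f x = 0" "monic f" "coeffs_in L f" using f by (auto simp: min_poly_def)
  have A: "subring_set A" unfolding A_def by (rule subring_set_adjoin[OF Rr])
  have pA: "\<pi> \<in> A" using adjoin_superset[OF Rr] dvr_uniformizer_in[OF R] unfolding A_def by blast
  have p0: "\<pi> \<noteq> 0" by (rule dvr_uniformizer_nonzero[OF R])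
  have pR: "\<pi> \<in> R" by (rule dvr_uniformizer_in[OF R])
  have AI: "poly h x \<in> A" if "coeffs_in R h" for h using that by (auto simp: A_def)
  \<comment> \<open>\<pi> is not a unit of A: after reduction modulo f, the polynomial \<pi> r - 1
    has degree below that of f and vanishes at x, so it is 0 and its constant coefficient would
    invert \<pi> in R.\<close>
  have unit: "\<pi> * a \<noteq> 1" if "a \<in> A" for a
  proof
    assume a1: "\<pi> * a = 1"
    obtain h where h: "coeffs_in R h" "a = poly h x" using \<open>a \<in> A\<close> by (auto simp: A_def)
    obtain s r where sr: "coeffs_in R s" "coeffs_in R r" "h = f * s + r" "r = 0 \<or> degree r < degree f"
      using monic_division[OF Rr f0(2) fR h(1)] by blast
    define q where "q = smult \<pi> r - 1"
    have "poly q x = 0" using a1 h sr f0 by (simp add: q_def)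
    moreover have "coeffs_in L q" unfolding q_def
      by (intro coeffs_in_mono[OF RL] cl sr pR)
    moreover have "degree q < degree f"
    proof -
      have "degree q \<le> degree r" unfolding q_def
        by (intro degree_diff_le) auto
      then show ?thesis using sr(4) min_poly_degree_pos[OF f] by auto
    qed
    ultimately have "q = 0" using f unfolding min_poly_def by force
    then have "coeff (smult \<pi> r) 0 = coeff 1 0" by (simp add: q_def)
    then have "\<pi> * coeff r 0 = 1" by simp
    then have "inverse \<pi> = coeff r 0" by (simp add: inverse_unique)
    then show False using sr(2) dvr_uniformizer_nonunit[OF R] by (simp add: coeffs_in_def)
  qed
  have "\<exists>N\<subseteq>A. \<pi> \<in> N \<and> 1 \<notin> N \<and> (\<forall>x\<in>N. \<forall>y\<in>N. x - y \<in> N) \<and>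
    (\<forall>a\<in>A. \<forall>x\<in>N. a * x \<in> N) \<and> (\<forall>a\<in>A - N. \<exists>b\<in>A. 1 - a * b \<in> N)"
    by (rule ex_maximal_proper_ideal[OF A pA]) (rule unit)
  then obtain N where NN: "N \<subseteq> A \<and> \<pi> \<in> N \<and> 1 \<notin> N \<and> (\<forall>x\<in>N. \<forall>y\<in>N. x - y \<in> N) \<and>
    (\<forall>a\<in>A. \<forall>x\<in>N. a * x \<in> N) \<and> (\<forall>a\<in>A - N. \<exists>b\<in>A. 1 - a * b \<in> N)"
    by (elim exE) (rule that)
  then have N: "N \<subseteq> A" "\<pi> \<in> N" "1 \<notin> N" and Nd: "\<And>x y. x \<in> N \<Longrightarrow> y \<in> N \<Longrightarrow> x - y \<in> N"
    and Nm: "\<And>a x. a \<in> A \<Longrightarrow> x \<in> N \<Longrightarrow> a * x \<in> N"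
    and Ninv: "\<And>a. a \<in> A \<Longrightarrow> a \<notin> N \<Longrightarrow> \<exists>b\<in>A. 1 - a * b \<in> N"
    by simp_all
  have N0: "0 \<in> N" using Nd[OF N(2,2)] by simp
  have Na: "a + b \<in> N" if "a \<in> N" "b \<in> N" for a b
    using Nd[OF that(1) Nd[OF N0 that(2)]] by simp
  have Nm': "x * a \<in> N" if "a \<in> A" "x \<in> N" for a x using Nm[OF that] by (simp add: mult.commute)
  have Np: "a * b \<notin> N" if ab: "a \<in> A" "a \<notin> N" "b \<in> A" "b \<notin> N" for a b
  proof
    assume "a * b \<in> N"
    obtain a' where a': "a' \<in> A" "1 - a * a' \<in> N" using Ninv ab by blast
    have "b * (1 - a * a') + a' * (a * b) \<in> N"
      by (rule Na[OF Nm[OF ab(3) a'(2)] Nm[OF a'(1) \<open>a * b \<in> N\<close>]])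
    moreover have "b * (1 - a * a') + a' * (a * b) = b" by (simp add: algebra_simps)
    ultimately show False using ab by simp
  qed
  define R' where "R' = {a / s | a s. a \<in> A \<and> s \<in> A \<and> s \<notin> N}"
  have R'I: "a / s \<in> R'" if "a \<in> A" "s \<in> A" "s \<notin> N" for a s using that by (auto simp: R'_def)
  have AR': "A \<subseteq> R'"
  proof
    fix a assume "a \<in> A"
    then show "a \<in> R'" using R'I[of a 1] N A by (auto simp: subring_set_one)
  qed
  have R's: "subring_set R'"
  proof (rule subring_setI)
    show "1 \<in> R'" using AR' A by (auto simp: subring_set_one)
    fix y z assume "y \<in> R'" "z \<in> R'"
    then obtain a s b t where *: "y = a / s" "a \<in> A" "s \<in> A" "s \<notin> N" "z = b / t" "b \<in> A" "t \<in> A" "t \<notin> N"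
      unfolding R'_def by blast
    then have n0: "s \<noteq> 0" "t \<noteq> 0" using N0 by auto
    have "y - z = (a * t - b * s) / (s * t)" "y * z = (a * b) / (s * t)" using * n0 by (auto simp: field_simps)
    then show "y - z \<in> R'" "y * z \<in> R'" using * A Np by (auto intro!: R'I simp: subring_set_closed)
  qed
  have unitR': "inverse (a / s) \<in> R'" if "a \<in> A" "s \<in> A" "a \<notin> N" for a s
    using R'I[of s a] that by (simp add: field_simps)
  have ip: "inverse \<pi> \<notin> R'"
  proof
    assume "inverse \<pi> \<in> R'"
    then obtain a s where *: "inverse \<pi> = a / s" "a \<in> A" "s \<in> A" "s \<notin> N" by (auto simp: R'_def)
    then have "s = a * \<pi>" using p0 N0 by (auto simp: field_simps)
    then show False using * Nm N by auto
  qed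
  \<comment> \<open>\<phi> is a monic lift of the minimal polynomial of the class of x over the
    residue field of R.\<close>
  have "\<exists>\<phi>. (monic \<phi> \<and> coeffs_in R \<phi> \<and> poly \<phi> x \<in> N) \<and> (\<forall>h. (monic h \<and> coeffs_in R h \<and> poly h x \<in> N) \<longrightarrow> degree \<phi> \<le> degree h)"
    by (rule ex_has_least_nat[of "\<lambda>\<phi>. monic \<phi> \<and> coeffs_in R \<phi> \<and> poly \<phi> x \<in> N" f]) (use f0 fR N0 in auto)
  then obtain \<phi> where \<phi>: "monic \<phi>" "coeffs_in R \<phi>" "poly \<phi> x \<in> N"
    and \<phi>min: "\<And>h. monic h \<Longrightarrow> coeffs_in R h \<Longrightarrow> poly h x \<in> N \<Longrightarrow> degree \<phi> \<le> degree h" by blast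
  \<comment> \<open>In degrees below that of \<phi> only multiples of \<pi> take a value in N: a
    leading coefficient that is a unit would contradict the choice of \<phi>, and otherwise the
    leading term is a multiple of \<pi> and can be removed.\<close>
  have small: "\<exists>r'. coeffs_in R r' \<and> r = smult \<pi> r'"
    if "coeffs_in R r" "poly r x \<in> N" "r = 0 \<or> degree r < degree \<phi>" for r
    using that
  proof (induction "degree r" arbitrary: r rule: less_induct)
    case less
    show ?case
    proof (cases "r = 0")
      case True
      then show ?thesis by (intro exI[of _ 0]) (auto simp: cl)
    next
      case False
      define c where "c = lead_coeff r"
      have c: "c \<in> R" "c \<noteq> 0" using less.prems False by (auto simp: c_def coeffs_in_def)
      have "inverse c \<notin> R"
      proof
        assume ic: "inverse c \<in> R"
        have "inverse c * poly r x \<in> N" using ic less.prems(2) adjoin_superset[OF Rr, of x] Nm unfolding A_def by blast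
        then have "degree \<phi> \<le> degree (smult (inverse c) r)"
          using ic less.prems c by (intro \<phi>min) (auto simp: cl c_def)
        then show False using less.prems(3) False c by auto
      qed
      then obtain c' where c': "c' \<in> R" "c = \<pi> * c'" using dvr_nonunit_factor[OF R c(1)] by blast
      define r1 where "r1 = r - monom c (degree r)"
      have mc: "coeffs_in R (monom c' (degree r))" using c' by (simp add: cl)
      have "coeffs_in R r1" unfolding r1_def using less.prems c by (simp add: cl)
      moreover have "poly r1 x \<in> N"
      proof -
        have "poly r1 x = poly r x - poly (monom c' (degree r)) x * \<pi>"
          unfolding r1_def c' by (simp add: poly_monom algebra_simps)
        then show ?thesis using less.prems N Nm AI[OF mc] by (auto intro: Nd)
      qed
      moreover have deg: "r1 = 0 \<or> degree r1 < degree r"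
      proof -
        have "degree r1 \<le> degree r" unfolding r1_def by (intro degree_diff_le) (auto intro: degree_monom_le)
        moreover have "coeff r1 (degree r) = 0" by (simp add: r1_def c_def)
        ultimately show ?thesis by (metis le_neq_implies_less leading_coeff_0_iff)
      qed
      ultimately have "\<exists>r'. coeffs_in R r' \<and> r1 = smult \<pi> r'"
        using less.hyps[of r1] less.prems(3) False by (cases "r1 = 0") (auto intro!: exI[of _ 0] simp: cl)
      then obtain r' where r': "coeffs_in R r'" "r1 = smult \<pi> r'" by blast
      have "r = smult \<pi> (r' + monom c' (degree r))"
        using r' c' by (simp add: r1_def smult_add_right smult_monom algebra_simps)
      then show ?thesis using coeffs_in_add[OF Rr r'(1) mc] by blast
    qed
  qed
  have dec: "\<exists>s r. coeffs_in R s \<and> coeffs_in R r \<and> h = \<phi> * s + smult \<pi> r"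
    if h: "coeffs_in R h" "poly h x \<in> N" for h
  proof -
    obtain s r where sr: "coeffs_in R s" "coeffs_in R r" "h = \<phi> * s + r" "r = 0 \<or> degree r < degree \<phi>"
      using monic_division[OF Rr \<phi>(1,2) h(1)] by blast
    have "poly r x = poly h x - poly \<phi> x * poly s x" using sr by simp
    then have "poly r x \<in> N" using h \<phi> AI[OF sr(1)] by (auto intro!: Nd Nm')
    then show ?thesis using small[OF sr(2) _ sr(4)] sr by blast
  qed
  obtain \<psi> \<rho> where \<psi>: "coeffs_in R \<psi>" "coeffs_in R \<rho>" "f = \<phi> * \<psi> + smult \<pi> \<rho>"
    using dec[OF fR] f0 N0 by auto
  \<comment> \<open>Separability enters here: if \<phi> and \<psi> both vanished at x modulo N, f
    would have a double root there and f'(x) would lie in N, although v(x) f'(x) = 1.\<close>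
  have \<psi>N: "poly \<psi> x \<notin> N"
  proof
    assume "poly \<psi> x \<in> N"
    have "poly (pderiv f) x = poly (pderiv \<phi>) x * poly \<psi> x + poly \<phi> x * poly (pderiv \<psi>) x + poly (pderiv \<rho>) x * \<pi>"
      unfolding \<psi> by (simp add: pderiv_add pderiv_mult pderiv_smult algebra_simps)
    also have "\<dots> \<in> N"
      using \<open>poly \<psi> x \<in> N\<close> \<phi> N \<psi> by (intro Na Nm Nm' AI coeffs_in_pderiv[OF Rr])
    finally have "poly v x * poly (pderiv f) x \<in> N" using AI[OF vR] Nm by blast
    moreover have "poly v x * poly (pderiv f) x = 1" using arg_cong[OF sep, of "\<lambda>q. poly q x"] f0 by simp
    ultimately show False using N by simp
  qed
  have \<phi>fac: "\<exists>y\<in>R'. poly \<phi> x = \<pi> * y"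
  proof
    have "poly \<phi> x * poly \<psi> x + \<pi> * poly \<rho> x = 0" using f0(1) unfolding \<psi> by simp
    then have "poly \<phi> x * poly \<psi> x = \<pi> * (- poly \<rho> x)" by (simp add: eq_neg_iff_add_eq_0)
    moreover have "poly \<psi> x \<noteq> 0" using \<psi>N N0 by auto
    ultimately show "poly \<phi> x = \<pi> * ((- poly \<rho> x) / poly \<psi> x)"
      by (metis nonzero_eq_divide_eq times_divide_eq_right)
    show "(- poly \<rho> x) / poly \<psi> x \<in> R'" using AI \<psi> \<psi>N A by (intro R'I) (auto simp: subring_set_uminus)
  qed
  have Nfac: "\<exists>y\<in>R'. a = \<pi> * y" if a: "a \<in> N" for a
  proof -
    obtain h where h: "coeffs_in R h" "a = poly h x" using a N by (auto simp: A_def)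
    obtain s r where sr: "coeffs_in R s" "coeffs_in R r" "h = \<phi> * s + smult \<pi> r"
      using dec[OF h(1)] a h by auto
    obtain y where y: "y \<in> R'" "poly \<phi> x = \<pi> * y" using \<phi>fac by blast
    have "a = \<pi> * (y * poly s x + poly r x)" unfolding h sr using y by (simp add: algebra_simps)
    moreover have "y * poly s x + poly r x \<in> R'" using y AI sr AR' R's by (auto intro!: subring_set_closed[OF R's])
    ultimately show ?thesis by blast
  qed
  have fac: "\<exists>z\<in>R'. y = \<pi> * z" if y: "y \<in> R'" "inverse y \<notin> R'" for y
  proof -
    obtain a s where *: "y = a / s" "a \<in> A" "s \<in> A" "s \<notin> N" using y by (auto simp: R'_def)
    then have "a \<in> N" using unitR'[of a s] y by auto
    then obtain z where z: "z \<in> R'" "a = \<pi> * z" using Nfac by blast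
    have "y = \<pi> * (z * (1 / s))" using * z by simp
    moreover have "z * (1 / s) \<in> R'"
      using subring_set_mult[OF R's z(1) R'I[OF subring_set_one[OF A] *(3,4)]] .
    ultimately show ?thesis by blast
  qed
  \<comment> \<open>Coprimality with f gives an inverse of a in L[x]; a power of \<pi> moves its
    coefficients into R.\<close>
  have Adiv: "\<exists>b\<in>A. \<exists>k. a * b = \<pi> ^ k" if a: "a \<in> A" "a \<noteq> 0" for a
  proof -
    obtain h where h: "coeffs_in R h" "a = poly h x" using a by (auto simp: A_def)
    obtain w y where wy: "coeffs_in L w" "coeffs_in L y" "w * f + y * h = 1"
      using min_poly_bezout[OF L f coeffs_in_mono[OF RL h(1)]] h a by metis
    have 1: "poly y x * a = 1" using arg_cong[OF wy(3), of "\<lambda>q. poly q x"] f0 h by simp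
    obtain k where "coeffs_in R (smult (\<pi> ^ k) y)"
      using dvr_clear_denominators[OF R val wy(2)] by blast
    then have "poly (smult (\<pi> ^ k) y) x \<in> A" by (rule AI)
    moreover have "a * poly (smult (\<pi> ^ k) y) x = \<pi> ^ k" using 1 by (simp add: algebra_simps)
    ultimately show ?thesis by blast
  qed
  have div: "\<exists>z\<in>R'. \<exists>k. y * z = \<pi> ^ k" if y: "y \<in> R'" "y \<noteq> 0" for y
  proof -
    obtain a s where *: "y = a / s" "a \<in> A" "s \<in> A" "s \<notin> N" using y by (auto simp: R'_def)
    then obtain b k where b: "b \<in> A" "a * b = \<pi> ^ k" using Adiv[of a] y by auto
    have "y * (s * b) = \<pi> ^ k" using * b y by (auto simp: field_simps)
    moreover have "s * b \<in> R'" using AR' * b A by (auto simp: subring_set_mult)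
    ultimately show ?thesis by blast
  qed
  show ?thesis
  proof (intro exI[of _ R'] conjI ballI)
    show "dvr R' \<pi>" using dvr_from_divisors[OF R's _ ip fac div] pA AR' by blast
    show "A \<subseteq> R'" by (rule AR')
    show "R' \<subseteq> {poly h x | h. coeffs_in L h}"
    proof
      fix y assume "y \<in> R'"
      then obtain a s where *: "y = a / s" "a \<in> A" "s \<in> A" by (auto simp: R'_def)
      have "A \<subseteq> {poly h x | h. coeffs_in L h}" unfolding A_def using coeffs_in_mono[OF RL] by blast
      then show "y \<in> {poly h x | h. coeffs_in L h}"
        using * subfield_set_divide[OF subfield_set_adjoin[OF L f]] by blast
    qed
    fix y assume "y \<in> R'"
    then obtain a s where *: "y = a / s" "a \<in> A" "s \<in> A" "s \<notin> N" by (auto simp: R'_def)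
    then show "\<exists>a\<in>A. \<exists>s\<in>A. y = a / s \<and> s \<noteq> 0 \<and> inverse s \<in> R'"
      using N0 unitR'[of s 1] A by (auto simp: subring_set_one)
  qed
qed

text \<open>For almost all R the polynomials f, u, v have coefficients in R, and every such R
  extends. The trace of the extension on L is R, which keeps the family infinite, and x is the only
  new generator.\<close>

lemma dvr_family_adjoin_separable:
  assumes W: "dvr_family F L W C" and x: "separable_over L0 x" "L0 \<subseteq> L"
  shows "\<exists>W' C'. dvr_family F (fgen (insert x L)) W' C'"
proof -
  note L = dvr_family_subfield[OF W]
  note Lr = subfield_set_subring[OF L]
  obtain f u v where fuv: "min_poly L x f" "coeffs_in L u" "coeffs_in L v" "u * f + v * pderiv f = 1"
    using separable_over_min_poly[OF L x] by blast
  have fL: "coeffs_in L f" using fuv(1) by (simp add: min_poly_def)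
  define L' where "L' = {poly h x | h. coeffs_in L h}"
  have L': "subfield_set L'" unfolding L'_def by (rule subfield_set_adjoin[OF L fuv(1)])
  have "fgen (insert x L) = L'"
  proof
    show "fgen (insert x L) \<subseteq> L'"
      using adjoin_superset[OF Lr, of x] adjoin_elem[OF Lr, of x]
      by (intro fgen_minimal L') (auto simp: L'_def)
    have "L \<subseteq> fgen (insert x L)" "x \<in> fgen (insert x L)" using subset_fgen[of "insert x L"] by auto
    then show "L' \<subseteq> fgen (insert x L)" unfolding L'_def
      using poly_in_subring[OF subfield_set_subring[OF subfield_set_fgen]] coeffs_in_mono by blast
  qed
  define W0 where "W0 = {R\<in>W. coeffs_in R f \<and> coeffs_in R u \<and> coeffs_in R v}"
  have "finite (W - W0)"
  proof (rule finite_subset)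
    show "W - W0 \<subseteq> {R\<in>W. \<not> coeffs_in R f} \<union> {R\<in>W. \<not> coeffs_in R u} \<union> {R\<in>W. \<not> coeffs_in R v}"
      by (auto simp: W0_def)
    show "finite \<dots>" using dvr_family_cofinite_poly[OF W] fL fuv by auto
  qed
  then have infW0: "infinite W0" using dvr_family_infinite[OF W]
    by (metis finite_Diff2)
  define good where "good = (\<lambda>R R'. (\<exists>\<pi>. dvr R \<pi> \<and> dvr R' \<pi>) \<and> {poly h x | h. coeffs_in R h} \<subseteq> R' \<and> R' \<subseteq> L' \<and>
    (\<forall>y\<in>R'. \<exists>a\<in>{poly h x | h. coeffs_in R h}. \<exists>s\<in>{poly h x | h. coeffs_in R h}. y = a / s \<and> s \<noteq> 0 \<and> inverse s \<in> R'))"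
  have "\<forall>R\<in>W0. \<exists>R'. good R R'"
  proof
    fix R assume R: "R \<in> W0"
    then have RW: "R \<in> W" and co: "coeffs_in R f" "coeffs_in R u" "coeffs_in R v" by (auto simp: W0_def)
    obtain \<pi> where \<pi>: "dvr R \<pi>" using dvr_familyD(2)[OF W RW] by blast
    have "\<exists>R'. dvr R' \<pi> \<and> {poly h x | h. coeffs_in R h} \<subseteq> R' \<and> R' \<subseteq> {poly h x | h. coeffs_in L h} \<and>
      (\<forall>y\<in>R'. \<exists>a\<in>{poly h x | h. coeffs_in R h}. \<exists>s\<in>{poly h x | h. coeffs_in R h}. y = a / s \<and> s \<noteq> 0 \<and> inverse s \<in> R')"
      by (rule dvr_adjoin_separable[OF L dvr_familyD(1)[OF W RW] \<pi> dvr_familyD(6)[OF W RW] fuv(1) co fuv(4)])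
    then obtain R' where R': "dvr R' \<pi> \<and> {poly h x | h. coeffs_in R h} \<subseteq> R' \<and> R' \<subseteq> {poly h x | h. coeffs_in L h} \<and>
      (\<forall>y\<in>R'. \<exists>a\<in>{poly h x | h. coeffs_in R h}. \<exists>s\<in>{poly h x | h. coeffs_in R h}. y = a / s \<and> s \<noteq> 0 \<and> inverse s \<in> R')"
      by (elim exE) (rule that)
    have "good R R'" unfolding good_def L'_def
      by (intro conjI exI[of _ \<pi>]) (use \<pi> R' in simp_all)
    then show "\<exists>R'. good R R'" by blast
  qed
  then obtain E where E: "\<And>R. R \<in> W0 \<Longrightarrow> good R (E R)" by metis
  have sub: "R \<subseteq> E R" "x \<in> E R" "subring_set (E R)" if "R \<in> W0" for R
  proof -
    have Rr: "subring_set R" using dvr_family_subring[OF W] that by (auto simp: W0_def)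
    have *: "{poly h x | h. coeffs_in R h} \<subseteq> E R" using E[OF that] unfolding good_def by simp
    show "R \<subseteq> E R" using order.trans[OF adjoin_superset[OF Rr] *] .
    show "x \<in> E R" using adjoin_elem[OF Rr] * by blast
    show "subring_set (E R)" using E[OF that] dvr_subring unfolding good_def by metis
  qed
  have trace: "E R \<inter> L = R" if R: "R \<in> W0" for R
  proof -
    have RW: "R \<in> W" using R by (auto simp: W0_def)
    obtain \<pi> where \<pi>: "dvr R \<pi>" "dvr (E R) \<pi>" using E[OF R] unfolding good_def by auto
    have "y \<in> R" if "y \<in> E R" "y \<in> L" for y
      using dvr_trace[OF \<pi>(1) sub(3,1)[OF R] dvr_uniformizer_nonunit[OF \<pi>(2)] that(1)] dvr_familyD(6)[OF W RW that(2)]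
      by blast
    then show ?thesis using sub[OF R] dvr_familyD(1)[OF W RW] by auto
  qed
  have "inj_on E W0" by (metis inj_onI trace)
  then have infW': "infinite (E ` W0)" using infW0 finite_imageD by blast
  have "dvr_family F L' (E ` W0) (insert x C)"
    unfolding dvr_family_def
  proof (intro conjI ballI L' infW')
    show "finite (insert x C)" using dvr_family_finite_gen[OF W] by simp
    fix R' assume "R' \<in> E ` W0"
    then obtain R where R: "R' = E R" "R \<in> W0" by auto
    have RW: "R \<in> W" using R by (auto simp: W0_def)
    show "R' \<subseteq> L'" "\<exists>\<pi>. dvr R' \<pi>" using E[OF R(2)] R(1) unfolding good_def by auto
    show "F \<subseteq> R'" "insert x C \<subseteq> R'" using dvr_familyD(3,4)[OF W RW] sub[OF R(2)] R by auto
    have Cl: "insert x C \<subseteq> loc (insert x C) R'"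
      using rgen_subset_loc[OF sub(3)[OF R(2)]] R rgen_incl[of _ "insert x C"] by blast
    have "loc C R \<subseteq> loc (insert x C) R'" unfolding R(1)
      using Cl R by (intro loc_trans dvr_family_subring[OF W RW] sub) auto
    then have Rl: "R \<subseteq> loc (insert x C) R'" using dvr_familyD(5)[OF W RW] by blast
    have Al: "{poly h x | h. coeffs_in R h} \<subseteq> loc (insert x C) R'"
      using poly_in_subring[OF subring_set_loc[OF sub(3)[OF R(2)]]] R Cl coeffs_in_mono[OF Rl] by auto
    show "R' \<subseteq> loc (insert x C) R'"
    proof
      fix y assume "y \<in> R'"
      then obtain a s where "a \<in> {poly h x | h. coeffs_in R h}" "s \<in> {poly h x | h. coeffs_in R h}" "y = a / s" "inverse s \<in> R'"
        using E[OF R(2)] R(1) unfolding good_def by blast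
      then show "y \<in> loc (insert x C) R'"
        using Al loc_quotient[OF sub(3)[OF R(2)]] R by blast
    qed
    \<comment> \<open>Some \<pi>^k y lies in R', so y is a unit times an integral power of \<pi>,
      and the sign of the exponent decides.\<close>
    fix y assume "y \<in> L'"
    then obtain h where h: "y = poly h x" "coeffs_in L h" by (auto simp: L'_def)
    obtain \<pi> where \<pi>: "dvr R \<pi>" "dvr R' \<pi>" using E[OF R(2)] R(1) unfolding good_def by auto
    obtain k where "coeffs_in R (smult (\<pi> ^ k) h)"
      using dvr_clear_denominators[OF \<pi>(1) dvr_familyD(6)[OF W RW] h(2)] by blast
    then have "poly (smult (\<pi> ^ k) h) x \<in> R'" using E[OF R(2)] R(1) unfolding good_def by blast
    then have ky: "\<pi> ^ k * y \<in> R'" using h by simp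
    show "y \<in> R' \<or> inverse y \<in> R'"
    proof (cases "y = 0")
      case True
      then show ?thesis using subring_set_zero[OF sub(3)[OF R(2)]] R by simp
    next
      case False
      note p0 = dvr_uniformizer_nonzero[OF \<pi>(1)]
      obtain m u where mu: "\<pi> ^ k * y = u * \<pi> ^ m" "u \<in> R'" "inverse u \<in> R'"
        using dvr_decomp[OF \<pi>(2) ky] False p0 by auto
      have pw: "\<pi> ^ i \<in> R'" for i using \<pi>(2) by (simp add: subring_set_power dvr_subring dvr_uniformizer_in)
      show ?thesis
      proof (cases "k \<le> m")
        case True
        then have "y = u * \<pi> ^ (m - k)" using mu(1) p0 by (simp add: power_diff field_simps)
        then show ?thesis using mu pw \<pi>(2) by (simp add: subring_set_mult dvr_subring)
      next
        case False
        then have "\<pi> ^ k = \<pi> ^ (k - m) * \<pi> ^ m" by (simp flip: power_add)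
        then have "\<pi> ^ (k - m) * y = u" using mu(1) p0 by simp
        then have "inverse y = inverse u * \<pi> ^ (k - m)" using \<open>y \<noteq> 0\<close> p0 by auto
        then show ?thesis using mu pw \<pi>(2) by (simp add: subring_set_mult dvr_subring)
      qed
    qed
  next
    fix y assume "y \<in> L'"
    then obtain h where h: "y = poly h x" "coeffs_in L h" by (auto simp: L'_def)
    have "{R' \<in> E ` W0. y \<notin> R'} \<subseteq> E ` {R\<in>W. \<not> coeffs_in R h}"
      using E h unfolding good_def W0_def by blast
    then show "finite {R' \<in> E ` W0. y \<notin> R'}"
      using dvr_family_cofinite_poly[OF W h(2)] finite_subset by blast
  qed
  then show ?thesis using \<open>fgen (insert x L) = L'\<close> by metis
qed

lemma dvr_family_adjoin_separable_finite:
  assumes W: "dvr_family F L W C" and D: "finite D" "\<And>x. x \<in> D \<Longrightarrow> separable_over L x"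
  shows "\<exists>W' C'. dvr_family F (fgen (L \<union> D)) W' C'"
  using D
proof (induction D rule: finite_induct)
  case empty
  have "fgen L \<subseteq> L" by (rule fgen_minimal[OF dvr_family_subfield[OF W]]) auto
  then have "fgen L = L" using subset_fgen[of L] by auto
  then show ?case using W by auto
next
  case (insert x D)
  then obtain W' C' where W': "dvr_family F (fgen (L \<union> D)) W' C'" by auto
  have "L \<subseteq> fgen (L \<union> D)" using subset_fgen[of "L \<union> D"] by auto
  then have "\<exists>W' C'. dvr_family F (fgen (insert x (fgen (L \<union> D)))) W' C'"
    using dvr_family_adjoin_separable[OF W'] insert by blast
  moreover have "fgen (insert x (fgen (L \<union> D))) = fgen (L \<union> insert x D)"
    using fgen_union_fgen[of "L \<union> D" "{x}"] by (simp add: insert_commute)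
  ultimately show ?case by simp
qed

section \<open>The valuation of a discrete valuation ring\<close>

text \<open>The order at \<pi>. It is meaningful only where x or its inverse lies in R, since the
  fraction field of R may be smaller than the type; hence that assumption in the lemmas.\<close>

definition dvr_val :: "'a::field set \<Rightarrow> 'a \<Rightarrow> 'a \<Rightarrow> int" where
  "dvr_val R \<pi> x = (if x = 0 then 0 else THE k. \<exists>u\<in>R. inverse u \<in> R \<and> x = u * \<pi> powi k)"

context
  fixes R :: "'a::field set" and \<pi> :: 'a
  assumes R: "dvr R \<pi>"
begin

lemma dvr_power_unit_le:
  assumes "u \<in> R" "inverse w \<in> R" "w \<noteq> 0" "u * \<pi> powi k = w * \<pi> powi l"
  shows "k \<le> l"
proof (rule ccontr)
  assume "\<not> k \<le> l"
  then obtain m where m: "k = l + 1 + int m" by (metis add.commute add.left_commute linorder_not_le zless_iff_Suc_zadd of_nat_Suc)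
  have p0: "\<pi> \<noteq> 0" by (rule dvr_uniformizer_nonzero[OF R])
  have "u * (\<pi> powi l * \<pi> * \<pi> ^ m) = w * \<pi> powi l"
    using assms(4) p0 unfolding m by (simp add: power_int_add)
  then have "inverse w * u * \<pi> ^ m * \<pi> = 1" using p0 assms(3) by (simp add: field_simps)
  then have "inverse \<pi> = inverse w * u * \<pi> ^ m" by (metis inverse_unique mult.commute)
  moreover have "inverse w * u * \<pi> ^ m \<in> R"
    using assms R by (auto simp: subring_set_closed dvr_subring dvr_uniformizer_in)
  ultimately show False using dvr_uniformizer_nonunit[OF R] by simp
qed

lemma dvr_val_eqI:
  assumes "u \<in> R" "inverse u \<in> R" "x = u * \<pi> powi k" "x \<noteq> 0"
  shows "dvr_val R \<pi> x = k"
proof -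
  have "(THE k. \<exists>u\<in>R. inverse u \<in> R \<and> x = u * \<pi> powi k) = k"
  proof (rule the_equality)
    show "\<exists>u\<in>R. inverse u \<in> R \<and> x = u * \<pi> powi k" using assms by blast
    fix l assume "\<exists>u\<in>R. inverse u \<in> R \<and> x = u * \<pi> powi l"
    then obtain w where w: "w \<in> R" "inverse w \<in> R" "x = w * \<pi> powi l" by blast
    have "u \<noteq> 0" "w \<noteq> 0" using assms w by auto
    then show "l = k" using dvr_power_unit_le[of u w k l] dvr_power_unit_le[of w u l k] assms w by auto
  qed
  then show ?thesis using assms by (simp add: dvr_val_def)
qed

lemma dvr_val_decomp:
  assumes "x \<in> R \<or> inverse x \<in> R" "x \<noteq> 0"
  obtains u where "u \<in> R" "inverse u \<in> R" "u \<noteq> 0" "x = u * \<pi> powi dvr_val R \<pi> x"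
proof -
  have "\<exists>u k. u \<in> R \<and> inverse u \<in> R \<and> x = u * \<pi> powi k"
  proof (cases "x \<in> R")
    case True
    then obtain k u where "x = u * \<pi> ^ k \<and> u \<in> R \<and> inverse u \<in> R"
      using dvr_decomp[OF R _ assms(2)] by blast
    then show ?thesis by (intro exI[of _ u] exI[of _ "int k"]) simp
  next
    case False
    then obtain k u where ku: "inverse x = u * \<pi> ^ k" "u \<in> R" "inverse u \<in> R"
      using dvr_decomp[OF R, of "inverse x"] assms by auto
    have "x = inverse (u * \<pi> ^ k)" using ku(1) by (metis inverse_inverse_eq)
    then show ?thesis using ku
      by (intro exI[of _ "inverse u"] exI[of _ "- int k"]) (simp add: power_int_minus)
  qed
  then obtain u k where uk: "u \<in> R" "inverse u \<in> R" "x = u * \<pi> powi k" by blast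
  then show ?thesis using that[of u] dvr_val_eqI[OF uk assms(2)] assms(2) by auto
qed

lemma dvr_val_mult:
  assumes "x \<in> R \<or> inverse x \<in> R" "x \<noteq> 0" "y \<in> R \<or> inverse y \<in> R" "y \<noteq> 0"
  shows "dvr_val R \<pi> (x * y) = dvr_val R \<pi> x + dvr_val R \<pi> y"
proof -
  obtain u where u: "u \<in> R" "inverse u \<in> R" "u \<noteq> 0" "x = u * \<pi> powi dvr_val R \<pi> x"
    by (rule dvr_val_decomp[OF assms(1,2)])
  obtain w where w: "w \<in> R" "inverse w \<in> R" "w \<noteq> 0" "y = w * \<pi> powi dvr_val R \<pi> y"
    by (rule dvr_val_decomp[OF assms(3,4)])
  show ?thesis
  proof (rule dvr_val_eqI[of "u * w"])
    show "u * w \<in> R" "inverse (u * w) \<in> R" using u w R by (auto simp: subring_set_mult dvr_subring)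
    have "x * y = (u * \<pi> powi dvr_val R \<pi> x) * (w * \<pi> powi dvr_val R \<pi> y)" using u w by simp
    then show "x * y = u * w * \<pi> powi (dvr_val R \<pi> x + dvr_val R \<pi> y)"
      using dvr_uniformizer_nonzero[OF R] by (simp add: power_int_add mult_ac)
  qed (use assms in auto)
qed

lemma dvr_val_nonneg_iff:
  assumes "x \<in> R \<or> inverse x \<in> R" "x \<noteq> 0"
  shows "dvr_val R \<pi> x \<ge> 0 \<longleftrightarrow> x \<in> R"
proof
  obtain u where u: "u \<in> R" "inverse u \<in> R" "u \<noteq> 0" "x = u * \<pi> powi dvr_val R \<pi> x"
    by (rule dvr_val_decomp[OF assms])
  show "x \<in> R" if "dvr_val R \<pi> x \<ge> 0"
  proof -
    have "x = u * \<pi> ^ nat (dvr_val R \<pi> x)" using u(4) that by (simp add: power_int_def)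
    moreover have "u * \<pi> ^ nat (dvr_val R \<pi> x) \<in> R"
      using u R by (auto simp: subring_set_closed dvr_subring dvr_uniformizer_in)
    ultimately show ?thesis by simp
  qed
  show "dvr_val R \<pi> x \<ge> 0" if "x \<in> R"
  proof -
    obtain k w where "x = w * \<pi> ^ k" "w \<in> R" "inverse w \<in> R"
      using dvr_decomp[OF R \<open>x \<in> R\<close> assms(2)] by blast
    then show ?thesis using dvr_val_eqI[of w x "int k"] assms(2) by simp
  qed
qed

lemma dvr_val_uniformizer: "dvr_val R \<pi> \<pi> = 1"
  using R by (intro dvr_val_eqI[of 1]) (auto simp: subring_set_one dvr_subring dvr_uniformizer_nonzero)

lemma dvr_val_inverse:
  assumes "x \<in> R \<or> inverse x \<in> R" "x \<noteq> 0"
  shows "dvr_val R \<pi> (inverse x) = - dvr_val R \<pi> x"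
proof -
  have "dvr_val R \<pi> (x * inverse x) = dvr_val R \<pi> x + dvr_val R \<pi> (inverse x)"
    using assms by (intro dvr_val_mult) auto
  moreover have "dvr_val R \<pi> 1 = 0"
    using R by (intro dvr_val_eqI[of 1]) (auto simp: subring_set_one dvr_subring)
  ultimately show ?thesis using assms by simp
qed

end

section \<open>Extension of a family along a purely inseparable extension\<close>

text \<open>For a subring S this is the S-submodule generated by M.\<close>

inductive_set fin_span :: "'a::comm_ring_1 set \<Rightarrow> 'a set \<Rightarrow> 'a set" for S M where
  fin_span_zero: "0 \<in> fin_span S M"
| fin_span_add: "x \<in> fin_span S M \<Longrightarrow> s \<in> S \<Longrightarrow> m \<in> M \<Longrightarrow> x + s * m \<in> fin_span S M"

lemma fin_span_plus:
  assumes "x \<in> fin_span S M" "y \<in> fin_span S M"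
  shows "x + y \<in> fin_span S M"
  using assms(2)
proof induction
  case fin_span_zero
  then show ?case using assms(1) by simp
next
  case (fin_span_add y s m)
  then have "(x + y) + s * m \<in> fin_span S M" by (intro fin_span.fin_span_add)
  then show ?case by (simp add: add.assoc)
qed

lemma fin_span_sum: "(\<And>i. i \<in> I \<Longrightarrow> f i \<in> fin_span S M) \<Longrightarrow> sum f I \<in> fin_span S M"
  by (induction I rule: infinite_finite_induct) (auto intro: fin_span_zero fin_span_plus)

lemma fin_span_mult_right:
  assumes "x \<in> fin_span S M" "\<And>m. m \<in> M \<Longrightarrow> m * c \<in> M'"
  shows "x * c \<in> fin_span S M'"
  using assms(1)
proof induction
  case fin_span_zero
  then show ?case by (simp add: fin_span.fin_span_zero)
next
  case (fin_span_add y s m)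
  then have "y * c + s * (m * c) \<in> fin_span S M'" using assms(2) by (intro fin_span.fin_span_add)
  then show ?case by (simp add: algebra_simps)
qed

text \<open>Each c in D is a root of the monic polynomial T^q - c^q over S. Division by it leaves
  only the powers c^i with i < q, so adjoining c multiplies the spanning set by these powers and
  keeps it finite.\<close>

lemma finite_span_over_powers:
  fixes S :: "'a::comm_ring_1 set"
  assumes S: "subring_set S" and D: "finite D" "\<And>c. c \<in> D \<Longrightarrow> c ^ q \<in> S" and q: "q > 0"
  shows "\<exists>M N. finite M \<and> subring_set N \<and> D \<subseteq> N \<and> S \<subseteq> N \<and> N \<subseteq> fin_span S M"
  using D
proof (induction D rule: finite_induct)
  case empty
  have "s \<in> fin_span S {1}" if "s \<in> S" for s
    using fin_span_add[OF fin_span_zero that, of 1 "{1}"] by simp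
  then show ?case using S by (intro exI[of _ "{1}"] exI[of _ S]) auto
next
  case (insert c D)
  then obtain M N where MN: "finite M" "subring_set N" "D \<subseteq> N" "S \<subseteq> N" "N \<subseteq> fin_span S M" by auto
  define M' where "M' = (\<lambda>(m, i). m * c ^ i) ` (M \<times> {..<q})"
  define N' where "N' = {poly h c | h. coeffs_in N h}"
  have N': "subring_set N'" "N \<subseteq> N'" "c \<in> N'" unfolding N'_def
    by (rule subring_set_adjoin[OF MN(2)], rule adjoin_superset[OF MN(2)], rule adjoin_elem[OF MN(2)])
  have "N' \<subseteq> fin_span S M'"
  proof
    fix y assume "y \<in> N'"
    then obtain h where h: "coeffs_in N h" "y = poly h c" by (auto simp: N'_def)
    define d where "d = monom 1 q - [:c ^ q:]"
    have cd: "coeff d i = (if i = q then 1 else if i = 0 then - (c ^ q) else 0)" for i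
      using q by (auto simp: d_def coeff_pCons split: nat.splits)
    have dd: "degree d = q"
    proof (rule antisym)
      show "degree d \<le> q" by (rule degree_le) (use q in \<open>auto simp: cd\<close>)
      show "q \<le> degree d" by (rule le_degree) (simp add: cd)
    qed
    have "coeffs_in N d" unfolding coeffs_in_def cd using MN insert.prems[of c]
      by (auto simp: subring_set_closed)
    moreover have "monic d" by (simp add: dd cd)
    ultimately obtain s r where sr: "coeffs_in N r" "h = d * s + r" "r = 0 \<or> degree r < q"
      using monic_division[OF MN(2) _ _ h(1), of d] dd by metis
    have "poly d c = 0" by (simp add: d_def poly_monom)
    then have "y = poly r c" using h sr by simp
    also have "\<dots> = (\<Sum>i<q. coeff r i * c ^ i)"
      unfolding poly_altdef using sr(3) q
      by (intro sum.mono_neutral_left) (auto simp: coeff_eq_0)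
    also have "\<dots> \<in> fin_span S M'"
    proof (rule fin_span_sum)
      fix i assume i: "i \<in> {..<q}"
      have "coeff r i \<in> fin_span S M" using sr MN(5) by (auto simp: coeffs_in_def)
      then show "coeff r i * c ^ i \<in> fin_span S M'"
        by (rule fin_span_mult_right) (use i in \<open>force simp: M'_def\<close>)
    qed
    finally show "y \<in> fin_span S M'" .
  qed
  then show ?case using N' MN by (intro exI[of _ M'] exI[of _ N']) (auto simp: M'_def)
qed

text \<open>Since the q-th power is additive, \<open>c ^ q * x\<close> makes the field a vector
  space over itself. A linear functional on this space with value 1 at 1 is a left inverse of the
  q-th power map.\<close>

lemma ex_frobenius_inverse_functional:
  assumes add: "\<And>x y :: 'a::field. (x + y) ^ q = x ^ q + y ^ q"
  obtains \<mu> :: "'a::field \<Rightarrow> 'a" where "\<mu> 1 = 1" "\<And>x y. \<mu> (x + y) = \<mu> x + \<mu> y" "\<And>c x. \<mu> (c ^ q * x) = c * \<mu> x"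
proof -
  interpret vs: vector_space_pair "\<lambda>(c::'a) x. c ^ q * x" "(*) :: 'a \<Rightarrow> 'a \<Rightarrow> 'a"
    by unfold_locales (auto simp: algebra_simps add power_mult_distrib)
  have "vs.vs1.independent {1 :: 'a}" by simp
  then obtain g where g: "Vector_Spaces.linear (\<lambda>(c::'a) x. c ^ q * x) (*) g" "g 1 = 1"
    using vs.linear_independent_extend[of "{1}" "\<lambda>_. 1"] by auto
  interpret g: Vector_Spaces.linear "\<lambda>(c::'a) x. c ^ q * x" "(*)" g by (rule g)
  show ?thesis using that[of g] g(2) g.add g.scale by auto
qed

text \<open>The order of x^q is additive in x and its values form a nonzero subgroup of the
  integers, in which 1 need not occur; an element of least positive value is the new
  uniformizer.\<close>

lemma dvr_root:
  fixes R :: "'a::field set"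
  assumes R: "dvr R \<pi>" and q: "q > 0" and add: "\<And>x y :: 'a. (x - y) ^ q = x ^ q - y ^ q"
    and val: "\<And>x. x ^ q \<in> R \<or> inverse (x ^ q) \<in> R"
  shows "\<exists>\<pi>'. dvr {x. x ^ q \<in> R} \<pi>'"
proof -
  note Rr = dvr_subring[OF R]
  define R' where "R' = {x. x ^ q \<in> R}"
  define w where "w = (\<lambda>x. dvr_val R \<pi> (x ^ q))"
  have wm: "w (x * y) = w x + w y" if "x \<noteq> 0" "y \<noteq> 0" for x y
    unfolding w_def power_mult_distrib using that val by (intro dvr_val_mult[OF R]) auto
  have wi: "w (inverse x) = - w x" if "x \<noteq> 0" for x
    unfolding w_def power_inverse using that val by (intro dvr_val_inverse[OF R]) auto
  have w0: "w x \<ge> 0 \<longleftrightarrow> x \<in> R'" if "x \<noteq> 0" for x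
    unfolding w_def R'_def using that val by (simp add: dvr_val_nonneg_iff[OF R])
  have wp: "w (x ^ k) = int k * w x" if "x \<noteq> 0" for x k
  proof (induction k)
    case 0
    have "w (1 * 1) = w 1 + w 1" by (rule wm) auto
    then show ?case by simp
  next
    case (Suc k)
    then show ?case using wm[of x "x ^ k"] that by (simp add: algebra_simps)
  qed
  have "w \<pi> > 0"
  proof -
    have "\<pi> \<noteq> 0" by (rule dvr_uniformizer_nonzero[OF R])
    moreover have "inverse \<pi> \<notin> R'"
    proof
      assume "inverse \<pi> \<in> R'"
      then have "inverse \<pi> ^ q \<in> R" by (simp add: R'_def)
      then have "inverse \<pi> ^ q * \<pi> ^ (q - 1) \<in> R"
        using Rr dvr_uniformizer_in[OF R] by (simp add: subring_set_closed)
      moreover have "inverse \<pi> ^ q * \<pi> ^ (q - 1) = inverse \<pi>"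
        using q \<open>\<pi> \<noteq> 0\<close> by (cases q) (auto simp: field_simps)
      ultimately show False using dvr_uniformizer_nonunit[OF R] by simp
    qed
    ultimately have "\<not> w (inverse \<pi>) \<ge> 0" using w0[of "inverse \<pi>"] by simp
    then show ?thesis using wi[OF \<open>\<pi> \<noteq> 0\<close>] by simp
  qed
  then have "\<exists>x. (x \<noteq> 0 \<and> w x > 0) \<and> (\<forall>y. y \<noteq> 0 \<and> w y > 0 \<longrightarrow> nat (w x) \<le> nat (w y))"
    by (intro ex_has_least_nat[of "\<lambda>x. x \<noteq> 0 \<and> w x > 0" \<pi>]) (use dvr_uniformizer_nonzero[OF R] in auto)
  then obtain \<tau> where v: "\<tau> \<noteq> 0" "w \<tau> > 0" and min: "\<And>y. y \<noteq> 0 \<Longrightarrow> w y > 0 \<Longrightarrow> nat (w \<tau>) \<le> nat (w y)" by blast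
  have "dvr R' \<tau>" unfolding dvr_def
  proof (intro conjI ballI impI)
    show "subring_set R'"
      using Rr by (intro subring_setI) (auto simp: R'_def subring_set_closed add power_mult_distrib)
    show "\<tau> \<in> R'" using w0[OF v(1)] v(2) by simp
    show "inverse \<tau> \<notin> R'" using w0[of "inverse \<tau>"] wi[OF v(1)] v by simp
    fix x assume x: "x \<in> R'" "x \<noteq> 0"
    \<comment> \<open>Division with remainder: removing \<tau>^k leaves a value below that of
      \<tau>, which must then be 0.\<close>
    define k where "k = nat (w x div w \<tau>)"
    define u where "u = x * inverse (\<tau> ^ k)"
    have u0: "u \<noteq> 0" using x v by (simp add: u_def)
    have "w u = w x - int k * w \<tau>" unfolding u_def using x v by (simp add: wm wi wp)
    also have "int k = w x div w \<tau>" using w0[of x] x v by (simp add: k_def pos_imp_zdiv_nonneg_iff)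
    finally have wu: "w u = w x mod w \<tau>" by (simp add: minus_div_mult_eq_mod)
    then have "w u < w \<tau>" "w u \<ge> 0" using v by simp_all
    then have "w u = 0" using min[OF u0] by linarith
    then have "u \<in> R'" "inverse u \<in> R'" using w0[OF u0] w0[of "inverse u"] wi[OF u0] u0 by auto
    moreover have "x = u * \<tau> ^ k" using v by (simp add: u_def)
    ultimately show "\<exists>k u. x = u * \<tau> ^ k \<and> u \<in> R' \<and> inverse u \<in> R'" by blast
  qed
  then show ?thesis unfolding R'_def by blast
qed

text \<open>
  With a functional \<open>\<mu>\<close> such that \<open>\<mu> (c ^ q * x) = c * \<mu> x\<close> and \<open>\<mu> 1 = 1\<close>, an integral element \<open>x\<close> is
  recovered as \<open>\<mu> (x ^ q)\<close>; since the old ring is spanned over its \<open>q\<close>-th powers by finitely many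
  monomials, their \<open>\<mu>\<close>-values generate the new one.
\<close>

lemma dvr_family_root:
  fixes L :: "'a::field set"
  assumes W: "dvr_family F L W C" and q: "q > 0" and add: "\<And>x y :: 'a. (x + y) ^ q = x ^ q + y ^ q"
    and root: "\<And>x. x ^ q \<in> L"
  shows "\<exists>W' C'. dvr_family F (UNIV :: 'a set) W' C'"
proof -
  have diff: "(x - y) ^ q = x ^ q - y ^ q" for x y :: 'a
    using add[of "x - y" y] by (simp add: algebra_simps)
  obtain \<mu> :: "'a \<Rightarrow> 'a" where \<mu>: "\<mu> 1 = 1" "\<And>x y. \<mu> (x + y) = \<mu> x + \<mu> y" "\<And>c x. \<mu> (c ^ q * x) = c * \<mu> x"
    using ex_frobenius_inverse_functional[OF add] by blast
  have \<mu>0: "\<mu> 0 = 0" using \<mu>(2)[of 0 0] by (metis add_cancel_right_right)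
  define S where "S = (\<lambda>r. r ^ q) ` rgen C"
  have S: "subring_set S"
  proof (rule subring_setI)
    note cl = subring_set_closed[OF subring_set_rgen]
    show "1 \<in> S" unfolding S_def by (rule image_eqI[of _ _ 1]) (auto simp: cl)
    fix x y assume "x \<in> S" "y \<in> S"
    then obtain a b where ab: "x = a ^ q" "a \<in> rgen C" "y = b ^ q" "b \<in> rgen C" by (auto simp: S_def)
    show "x - y \<in> S" unfolding S_def by (rule image_eqI[of _ _ "a - b"]) (auto simp: ab diff cl)
    show "x * y \<in> S" unfolding S_def by (rule image_eqI[of _ _ "a * b"]) (auto simp: ab power_mult_distrib cl)
  qed
  have "\<exists>M N. finite M \<and> subring_set N \<and> C \<subseteq> N \<and> S \<subseteq> N \<and> N \<subseteq> fin_span S M"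
    by (rule finite_span_over_powers[OF S dvr_family_finite_gen[OF W] _ q]) (auto simp: S_def rgen_incl)
  then obtain M N where MN: "finite M" "subring_set N" "C \<subseteq> N" "N \<subseteq> fin_span S M" by blast
  have rs: "rgen C \<subseteq> fin_span S M" using rgen_minimal[OF MN(2,3)] MN(4) by blast
  define C' where "C' = C \<union> \<mu> ` M"
  have \<mu>C': "\<mu> y \<in> rgen C'" if "y \<in> fin_span S M" for y
    using that
  proof induction
    case fin_span_zero
    then show ?case using subring_set_zero[OF subring_set_rgen] by (simp add: \<mu>0)
  next
    case (fin_span_add y s m)
    then obtain r where r: "s = r ^ q" "r \<in> rgen C" by (auto simp: S_def)
    have "r \<in> rgen C'" using r rgen_mono[of C C'] by (auto simp: C'_def)
    moreover have "\<mu> m \<in> rgen C'" using fin_span_add by (auto simp: C'_def intro: rgen_incl)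
    ultimately show ?case using fin_span_add r
      by (simp add: \<mu> subring_set_closed[OF subring_set_rgen])
  qed
  \<comment> \<open>Since every \<open>x ^ q\<close> lies in L, the extension of R can be written
    down as the set of all q-th roots of its elements, without choosing a maximal ideal.\<close>
  define E where "E = (\<lambda>R :: 'a set. {x. x ^ q \<in> R})"
  define W0 where "W0 = {R\<in>W. \<forall>m\<in>M. \<mu> m ^ q \<in> R}"
  have "finite (W - W0)"
  proof (rule finite_subset)
    show "W - W0 \<subseteq> (\<Union>m\<in>M. {R\<in>W. \<mu> m ^ q \<notin> R})" by (auto simp: W0_def)
    show "finite \<dots>" using MN(1) dvr_family_cofinite[OF W root] by blast
  qed
  then have infW0: "infinite W0" using dvr_family_infinite[OF W] by (metis finite_Diff2)
  have val: "x ^ q \<in> R \<or> inverse (x ^ q) \<in> R" if "R \<in> W" for x R using dvr_familyD(6)[OF W that root] .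
  have subR: "R \<subseteq> E R" if "R \<in> W" for R
    using dvr_family_subring[OF W that] by (auto simp: E_def subring_set_power)
  have dvrE: "\<exists>\<pi>. dvr (E R) \<pi>" if RW: "R \<in> W" for R
  proof -
    obtain \<pi> where "dvr R \<pi>" using dvr_familyD(2)[OF W RW] by blast
    then show ?thesis unfolding E_def using dvr_root[OF _ q diff val[OF RW]] by blast
  qed
  then have subE: "subring_set (E R)" if "R \<in> W" for R using dvr_subring that by blast
  have trace: "E R \<inter> L = R" if R: "R \<in> W" for R
  proof -
    obtain \<pi> where \<pi>: "dvr R \<pi>" using dvr_familyD(2)[OF W R] by blast
    have "inverse \<pi> \<notin> E R"
    proof
      assume "inverse \<pi> \<in> E R"
      then have "inverse \<pi> ^ q * \<pi> ^ (q - 1) \<in> R"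
        using dvr_subring[OF \<pi>] dvr_uniformizer_in[OF \<pi>] by (simp add: subring_set_closed E_def)
      moreover have "inverse \<pi> ^ q * \<pi> ^ (q - 1) = inverse \<pi>"
        using q dvr_uniformizer_nonzero[OF \<pi>] by (cases q) (auto simp: field_simps)
      ultimately show False using dvr_uniformizer_nonunit[OF \<pi>] by simp
    qed
    then have "y \<in> R" if "y \<in> E R" "y \<in> L" for y
      using dvr_trace[OF \<pi> subE[OF R] subR[OF R] _ that(1)] dvr_familyD(6)[OF W R that(2)] by blast
    then show ?thesis using subR[OF R] dvr_familyD(1)[OF W R] by auto
  qed
  have "inj_on E W0"
  proof (rule inj_onI)
    fix R R' assume *: "R \<in> W0" "R' \<in> W0" "E R = E R'"
    then have "R \<in> W" "R' \<in> W" by (auto simp: W0_def)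
    then show "R = R'" using trace *(3) by metis
  qed
  then have infW': "infinite (E ` W0)" using infW0 finite_imageD by blast
  have "dvr_family F UNIV (E ` W0) C'"
    unfolding dvr_family_def
  proof (intro conjI ballI infW' subset_UNIV)
    show "subfield_set (UNIV :: 'a set)" by (simp add: subfield_set_def subring_set_def)
    show "finite C'" using dvr_family_finite_gen[OF W] MN by (simp add: C'_def)
    fix R' assume "R' \<in> E ` W0"
    then obtain R where R: "R' = E R" "R \<in> W0" by auto
    have RW: "R \<in> W" using R by (auto simp: W0_def)
    show "\<exists>\<pi>. dvr R' \<pi>" using dvrE[OF RW] R by simp
    show "F \<subseteq> R'" "C' \<subseteq> R'" using dvr_familyD(3,4)[OF W RW] subR[OF RW] R by (auto simp: C'_def W0_def E_def)
    fix x :: 'a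
    show "x \<in> R' \<or> inverse x \<in> R'" using val[OF RW, of x] R by (simp add: E_def power_inverse)
  next
    fix R' assume "R' \<in> E ` W0"
    then obtain R where R: "R' = E R" "R \<in> W0" by auto
    have RW: "R \<in> W" using R by (auto simp: W0_def)
    note cl = subring_set_closed[OF subring_set_rgen]
    show "R' \<subseteq> loc C' R'"
    proof
      fix x assume "x \<in> R'"
      then have "x ^ q \<in> loc C R" using dvr_familyD(5)[OF W RW] R by (auto simp: E_def)
      then obtain a g where ag: "x ^ q = a / g" "a \<in> rgen C" "g \<in> rgen C" "g \<noteq> 0" "inverse g \<in> R"
        unfolding loc_def by blast
      \<comment> \<open>Multiplying by g^q instead of g makes the left side a q-th power while the
        right side stays in \<open>rgen C\<close>, where \<mu> can be applied.\<close>
      have "(x * g) ^ q = (a / g) * (g * g ^ (q - 1))"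
        unfolding ag(1)[symmetric] using q by (cases q) (auto simp: power_mult_distrib)
      then have "(x * g) ^ q = a * g ^ (q - 1)" using ag(4) by simp
      then have "(x * g) ^ q \<in> rgen C" using ag by (simp add: cl)
      then have "\<mu> ((x * g) ^ q) \<in> rgen C'" using rs \<mu>C' by blast
      moreover have "\<mu> ((x * g) ^ q) = x * g" using \<mu>(3)[of "x * g" 1] \<mu>(1) by simp
      ultimately have "x * g \<in> rgen C'" by simp
      moreover have "g \<in> rgen C'" using ag rgen_mono[of C C'] by (auto simp: C'_def)
      moreover have "inverse g \<in> R'" using ag subR[OF RW] R by auto
      ultimately show "x \<in> loc C' R'" unfolding loc_def using ag(4)
        by (intro CollectI exI[of _ "x * g"] exI[of _ g]) auto
    qed
  next
    fix x :: 'a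
    have "{R' \<in> E ` W0. x \<notin> R'} \<subseteq> E ` {R\<in>W. x ^ q \<notin> R}" by (auto simp: W0_def E_def)
    then show "finite {R' \<in> E ` W0. x \<notin> R'}"
      using dvr_family_cofinite[OF W root] finite_subset by blast
  qed
  then show ?thesis by blast
qed

section \<open>The family on a rational function field\<close>

text \<open>The rings are the localizations of k[b] at b - c for c in the infinite set F; they
  differ because b - c is a unit at every other point. An element h(b) / g(b) can fail to lie in one
  only if g(c) = 0. Elements of k are fractions over \<open>rgen C\<close> whose denominators are
  units, so b and C generate.\<close>

lemma dvr_family_rational:
  fixes k :: "'a::field set"
  assumes k: "k = fgen C" "finite C" and F: "infinite F" "F \<subseteq> k"
    and b: "\<And>h. coeffs_in k h \<Longrightarrow> poly h b = 0 \<Longrightarrow> h = 0"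
  shows "\<exists>W. dvr_family F (fgen (insert b k)) W (insert b C)"
proof -
  have kf: "subfield_set k" using k subfield_set_fgen by simp
  note kr = subfield_set_subring[OF kf]
  note cl = coeffs_in_closed[OF kr]
  define L where "L = fgen (insert b k)"
  have bL: "b \<in> L" "k \<subseteq> L" unfolding L_def using subset_fgen[of "insert b k"] by auto
  have L: "subfield_set L" unfolding L_def by (rule subfield_set_fgen)
  note Lr = subfield_set_subring[OF L]
  have Lpoly: "\<exists>h g. coeffs_in k h \<and> coeffs_in k g \<and> g \<noteq> 0 \<and> x = poly h b / poly g b" if xL: "x \<in> L" for x
  proof -
    obtain y z where yz: "x = y / z" "y \<in> rgen (insert b k)" "z \<in> rgen (insert b k)"
      using xL by (auto simp: L_def fgen_def)
    have "rgen (insert b k) \<subseteq> {poly h b | h. coeffs_in k h}"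
      using rgen_insert_adjoin[OF kr] by blast
    then obtain h g where hg: "coeffs_in k h" "y = poly h b" "coeffs_in k g" "z = poly g b" using yz by blast
    show ?thesis
    proof (cases "g = 0")
      case True
      then show ?thesis using yz hg by (intro exI[of _ 0] exI[of _ 1]) (auto simp: cl)
    next
      case False
      then show ?thesis using yz hg by blast
    qed
  qed
  define Rc where "Rc = (\<lambda>c. {poly h b / poly g b | h g. coeffs_in k h \<and> coeffs_in k g \<and> poly g c \<noteq> 0})"
  have RcI: "poly h b / poly g b \<in> Rc c" if "coeffs_in k h" "coeffs_in k g" "poly g c \<noteq> 0" for h g c
    using that by (auto simp: Rc_def)
  have nz: "poly g b \<noteq> 0" if "coeffs_in k g" "g \<noteq> 0" for g using b that by blast
  have polyR: "poly h b \<in> Rc c" if "coeffs_in k h" for h c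
    using RcI[OF that, of 1 c] by (simp add: cl)
  have kRc: "k \<subseteq> Rc c" for c
  proof
    fix x assume "x \<in> k"
    then show "x \<in> Rc c" using polyR[of "[:x:]" c] by (simp add: cl)
  qed
  have bRc: "b \<in> Rc c" for c using polyR[of "[:0, 1:]"] by (simp add: cl)
  have sub: "subring_set (Rc c)" for c
  proof (rule subring_setI)
    show "1 \<in> Rc c" using kRc[of c] subring_set_one[OF kr] by blast
    fix x y assume "x \<in> Rc c" "y \<in> Rc c"
    then obtain h g h' g' where *: "x = poly h b / poly g b" "coeffs_in k h" "coeffs_in k g" "poly g c \<noteq> 0"
      "y = poly h' b / poly g' b" "coeffs_in k h'" "coeffs_in k g'" "poly g' c \<noteq> 0" unfolding Rc_def by blast
    have "g \<noteq> 0" "g' \<noteq> 0" using * by auto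
    then have n: "poly g b \<noteq> 0" "poly g' b \<noteq> 0" using * nz by blast+
    have "x - y = poly (h * g' - h' * g) b / poly (g * g') b" "x * y = poly (h * h') b / poly (g * g') b"
      unfolding *(1,5) using n by (simp_all add: diff_frac_eq)
    moreover have "poly (g * g') c \<noteq> 0" using * by simp
    ultimately show "x - y \<in> Rc c" "x * y \<in> Rc c"
      using RcI[of "h * g' - h' * g" "g * g'" c] RcI[of "h * h'" "g * g'" c] * by (simp_all add: cl del: poly_mult poly_diff)
  qed
  have kF: "c \<in> k" if "c \<in> F" for c using F that by auto
  have unit: "inverse (poly g b) \<in> Rc c" if "coeffs_in k g" "poly g c \<noteq> 0" for g c
    using RcI[of 1 g c] that by (simp add: cl field_simps)
  have ip: "inverse (b - c) \<notin> Rc c" if c: "c \<in> F" for c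
  proof
    assume "inverse (b - c) \<in> Rc c"
    then obtain h g where *: "inverse (b - c) = poly h b / poly g b" "coeffs_in k h" "coeffs_in k g" "poly g c \<noteq> 0"
      unfolding Rc_def by blast
    have "b - c \<noteq> 0" using nz[of "[:-c, 1:]"] kF[OF c] kr by (auto simp: coeffs_in_def coeff_pCons subring_set_closed split: nat.splits)
    moreover have "g \<noteq> 0" using * by auto
    then have "poly g b \<noteq> 0" using * nz by blast
    ultimately have "poly ([:-c, 1:] * h - g) b = 0" using *(1) by (auto simp: field_simps)
    moreover have "coeffs_in k ([:-c, 1:] * h - g)"
    proof -
      have "coeffs_in k [:-c, 1:]" using kF[OF c] kr by (auto simp: coeffs_in_def coeff_pCons subring_set_closed split: nat.splits)
      then show ?thesis using * by (intro cl)
    qed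
    ultimately have "[:-c, 1:] * h - g = 0" using b by blast
    then have "g = [:-c, 1:] * h" by simp
    then show False using *(4) by simp
  qed
  have dv: "dvr (Rc c) (b - c)" if c: "c \<in> F" for c
    unfolding dvr_def
  proof (intro conjI sub ip[OF c] ballI impI)
    have lin: "coeffs_in k [:-c, 1:]" using kF[OF c] kr by (auto simp: coeffs_in_def coeff_pCons subring_set_closed split: nat.splits)
    show "b - c \<in> Rc c" using polyR[OF lin, of c] by simp
    fix x assume x: "x \<in> Rc c" "x \<noteq> 0"
    then obtain h g where *: "x = poly h b / poly g b" "coeffs_in k h" "coeffs_in k g" "poly g c \<noteq> 0"
      unfolding Rc_def by blast
    \<comment> \<open>The linear factor is split off as often as c is a root of h.\<close>
    have ex: "\<exists>e m. coeffs_in k e \<and> poly e c \<noteq> 0 \<and> h = [:-c, 1:] ^ m * e" if "coeffs_in k h" "h \<noteq> 0" for h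
      using that
    proof (induction "degree h" arbitrary: h rule: less_induct)
      case less
      show ?case
      proof (cases "poly h c = 0")
        case False
        then show ?thesis using less.prems by (intro exI[of _ h] exI[of _ 0]) auto
      next
        case True
        obtain s r where sr: "coeffs_in k s" "coeffs_in k r" "h = [:-c, 1:] * s + r" "r = 0 \<or> degree r < degree [:-c, 1:]"
          using monic_division[OF kr _ lin less.prems(1)] by auto
        have "degree r = 0" using sr(4) by auto
        then obtain r0 where "r = [:r0:]" by (metis degree_eq_zeroE)
        then have "r = 0" using True sr(3) by auto
        then have h: "h = [:-c, 1:] * s" using sr by simp
        then have "s \<noteq> 0" using less.prems by auto
        then have "degree s < degree h" unfolding h by (subst degree_mult_eq) auto
        then obtain e m where "coeffs_in k e" "poly e c \<noteq> 0" "s = [:-c, 1:] ^ m * e"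
          using less.hyps[OF _ sr(1) \<open>s \<noteq> 0\<close>] by blast
        moreover from this have "h = [:-c, 1:] ^ Suc m * e" unfolding h by (simp only: power_Suc mult.assoc)
        ultimately show ?thesis by blast
      qed
    qed
    have "h \<noteq> 0" using x * by auto
    then obtain e m where e: "coeffs_in k e" "poly e c \<noteq> 0" "h = [:-c, 1:] ^ m * e" using ex[OF *(2)] by blast
    have "x = (poly e b / poly g b) * (b - c) ^ m" using * e by (simp add: poly_power)
    moreover have "poly e b / poly g b \<in> Rc c" "inverse (poly e b / poly g b) \<in> Rc c"
      using RcI[of e g c] RcI[of g e c] e * by auto
    ultimately show "\<exists>m u. x = u * (b - c) ^ m \<and> u \<in> Rc c \<and> inverse u \<in> Rc c" by blast
  qed
  have inj: "inj_on Rc F"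
  proof (rule inj_onI, rule ccontr)
    fix c c' assume c: "c \<in> F" "c' \<in> F" "Rc c = Rc c'" "c \<noteq> c'"
    have lin: "coeffs_in k [:-c, 1:]" using kF[OF c(1)] kr by (auto simp: coeffs_in_def coeff_pCons subring_set_closed split: nat.splits)
    have "inverse (b - c) \<in> Rc c'" using unit[OF lin, of c'] c by simp
    then show False using ip[OF c(1)] c by simp
  qed
  have "dvr_family F L (Rc ` F) (insert b C)"
    unfolding dvr_family_def
  proof (intro conjI ballI L)
    show "finite (insert b C)" using k by simp
    show "infinite (Rc ` F)" using inj F(1) finite_imageD by blast
    fix R assume "R \<in> Rc ` F"
    then obtain c where c: "c \<in> F" "R = Rc c" by auto
    show "R \<subseteq> L"
    proof
      fix x assume "x \<in> R"
      then obtain h g where "x = poly h b / poly g b" "coeffs_in k h" "coeffs_in k g" unfolding c Rc_def by blast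
      then show "x \<in> L" using coeffs_in_mono[OF bL(2)] by (auto intro!: subfield_set_divide[OF L] poly_in_subring[OF Lr] bL)
    qed
    show "\<exists>\<pi>. dvr R \<pi>" using dv c by blast
    show "F \<subseteq> R" using F kRc c by blast
    show "insert b C \<subseteq> R" using bRc kRc[of c] subset_fgen[of C] c k(1) by auto
    show "R \<subseteq> loc (insert b C) R"
    proof
      note lsub = subring_set_loc[OF sub, of "insert b C" c]
      have gen: "rgen (insert b C) \<subseteq> loc (insert b C) R" unfolding c by (rule rgen_subset_loc[OF sub])
      have kl: "k \<subseteq> loc (insert b C) R"
      proof
        fix x assume "x \<in> k"
        then obtain y z where yz: "x = y / z" "y \<in> rgen C" "z \<in> rgen C" using k by (auto simp: fgen_def)
        have "z \<in> k" using yz rgen_subset_fgen[of C] k by auto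
        then have "inverse z \<in> R" using kRc[of c] c subfield_set_inverse[OF kf] by blast
        moreover have "y \<in> loc (insert b C) R" "z \<in> loc (insert b C) R" using yz gen rgen_mono[of C "insert b C"] by auto
        ultimately show "x \<in> loc (insert b C) R" using yz loc_quotient[OF sub] c by simp
      qed
      have pl: "poly h b \<in> loc (insert b C) R" if "coeffs_in k h" for h
        using poly_in_subring[OF lsub] coeffs_in_mono[OF kl that] gen rgen_incl[of b "insert b C"] c by auto
      fix x assume "x \<in> R"
      then obtain h g where *: "x = poly h b / poly g b" "coeffs_in k h" "coeffs_in k g" "poly g c \<noteq> 0" unfolding c Rc_def by blast
      then show "x \<in> loc (insert b C) R" using pl unit[OF *(3,4)] loc_quotient[OF sub] c by simp
    qed
    fix x assume "x \<in> L"
    then obtain h g where hg: "coeffs_in k h" "coeffs_in k g" "g \<noteq> 0" "x = poly h b / poly g b" using Lpoly by blast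
    show "x \<in> R \<or> inverse x \<in> R"
    proof (cases "x = 0")
      case True
      then show ?thesis using subring_set_zero[OF sub] c by simp
    next
      case False
      note p0 = dvr_uniformizer_nonzero[OF dv[OF c(1)]]
      obtain m u where mu: "poly h b = u * (b - c) ^ m" "u \<in> R" "inverse u \<in> R"
        using dvr_decomp[OF dv[OF c(1)] polyR[OF hg(1)]] False hg(4) c by auto
      obtain n w where nw: "poly g b = w * (b - c) ^ n" "w \<in> R" "inverse w \<in> R"
        using dvr_decomp[OF dv[OF c(1)] polyR[OF hg(2)] nz[OF hg(2,3)]] c by auto
      have bR: "(b - c) ^ i \<in> R" for i
        using c dv[OF c(1)] by (simp add: subring_set_power dvr_subring dvr_uniformizer_in)
      have uw: "u \<noteq> 0" "w \<noteq> 0" using mu nw False hg nz by auto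
      have Rs: "subring_set R" using sub c by simp
      show ?thesis
      proof (cases "n \<le> m")
        case True
        have "x = u * inverse w * (b - c) ^ (m - n)"
          using True p0 uw unfolding hg mu nw by (simp add: power_diff field_simps)
        then show ?thesis using mu nw bR Rs by (simp add: subring_set_mult)
      next
        case False
        have "inverse x = w * inverse u * (b - c) ^ (n - m)"
          using False p0 uw unfolding hg mu nw by (simp add: power_diff field_simps)
        then show ?thesis using mu nw bR Rs by (simp add: subring_set_mult)
      qed
    qed
  next
    fix x assume "x \<in> L"
    then obtain h g where hg: "coeffs_in k h" "coeffs_in k g" "g \<noteq> 0" "x = poly h b / poly g b" using Lpoly by blast
    have "{R \<in> Rc ` F. x \<notin> R} \<subseteq> Rc ` {c. poly g c = 0}" using RcI[OF hg(1,2)] hg(4) by auto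
    moreover have "finite {c. poly g c = 0}" using poly_roots_finite[OF hg(3)] .
    ultimately show "finite {R \<in> Rc ` F. x \<notin> R}" using finite_subset by blast
  qed
  then show ?thesis unfolding L_def by blast
qed

section \<open>Noetherian subrings\<close>

definition ideal_in :: "'a::comm_ring_1 set \<Rightarrow> 'a set \<Rightarrow> bool" where
  "ideal_in A J \<longleftrightarrow> J \<subseteq> A \<and> 0 \<in> J \<and> (\<forall>x\<in>J. \<forall>y\<in>J. x - y \<in> J) \<and> (\<forall>a\<in>A. \<forall>x\<in>J. a * x \<in> J)"

definition noetherian_set :: "'a::comm_ring_1 set \<Rightarrow> bool" where
  "noetherian_set A \<longleftrightarrow> (\<forall>J :: nat \<Rightarrow> 'a set. (\<forall>i. ideal_in A (J i)) \<and> (\<forall>i. J i \<subseteq> J (Suc i)) \<longrightarrow>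
     (\<exists>N. \<forall>i\<ge>N. J i = J N))"

lemma ideal_inD:
  assumes "ideal_in A J"
  shows "J \<subseteq> A" "0 \<in> J" "\<And>x y. x \<in> J \<Longrightarrow> y \<in> J \<Longrightarrow> x - y \<in> J" "\<And>a x. a \<in> A \<Longrightarrow> x \<in> J \<Longrightarrow> a * x \<in> J"
    "\<And>x y. x \<in> J \<Longrightarrow> y \<in> J \<Longrightarrow> x + y \<in> J"
proof -
  show "J \<subseteq> A" "0 \<in> J" and d: "\<And>x y. x \<in> J \<Longrightarrow> y \<in> J \<Longrightarrow> x - y \<in> J" and "\<And>a x. a \<in> A \<Longrightarrow> x \<in> J \<Longrightarrow> a * x \<in> J"
    using assms by (auto simp: ideal_in_def)
  show "x + y \<in> J" if "x \<in> J" "y \<in> J" for x y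
    using d[OF that(1) d[OF \<open>0 \<in> J\<close> that(2)]] by simp
qed

lemma noetherian_set_field:
  fixes A :: "'a::comm_ring_1 set"
  assumes inv: "\<And>a. a \<in> A \<Longrightarrow> a \<noteq> 0 \<Longrightarrow> \<exists>b\<in>A. b * a = 1"
  shows "noetherian_set A"
  unfolding noetherian_set_def
proof (intro allI impI)
  fix J :: "nat \<Rightarrow> 'a set" assume J: "(\<forall>i. ideal_in A (J i)) \<and> (\<forall>i. J i \<subseteq> J (Suc i))"
  have full: "J i = A" if x: "x \<in> J i" "x \<noteq> 0" for i x
  proof -
    have Ji: "ideal_in A (J i)" using J by simp
    obtain b where "b \<in> A" "b * x = 1" using inv x ideal_inD(1)[OF Ji] by blast
    then have "1 \<in> J i" using ideal_inD(4)[OF Ji, of b x] x by simp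
    then have "A \<subseteq> J i" using ideal_inD(4)[OF Ji, of _ 1] by auto
    then show ?thesis using ideal_inD(1)[OF Ji] by auto
  qed
  have mono: "J i \<subseteq> J j" if "i \<le> j" for i j using J that by (meson lift_Suc_mono_le)
  show "\<exists>N. \<forall>i\<ge>N. J i = J N"
  proof (cases "\<exists>N x. x \<in> J N \<and> x \<noteq> 0")
    case True
    then obtain N x where "x \<in> J N" "x \<noteq> 0" by blast
    then show ?thesis using full mono by (intro exI[of _ N]) blast
  next
    case False
    then have "J i = {0}" for i using J ideal_inD(2)[of A "J i"] by auto
    then show ?thesis by auto
  qed
qed

text \<open>Hilbert's basis argument; \<open>x\<close> is an arbitrary ring element, not an indeterminate over \<open>A\<close>.\<close>

definition lead_ideal :: "'a::comm_ring_1 set \<Rightarrow> 'a \<Rightarrow> 'a set \<Rightarrow> nat \<Rightarrow> 'a set" where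
  "lead_ideal A x J k = {a\<in>A. \<exists>h. coeffs_in A h \<and> (\<forall>i\<ge>k. coeff h i = 0) \<and> a * x ^ k + poly h x \<in> J}"

context
  fixes A :: "'a::comm_ring_1 set" and x :: 'a
  assumes A: "subring_set A"
begin

lemma ideal_in_lead_ideal:
  assumes J: "ideal_in {poly h x | h. coeffs_in A h} J"
  shows "ideal_in A (lead_ideal A x J k)"
  unfolding ideal_in_def
proof (intro conjI ballI)
  note cl = coeffs_in_closed[OF A] and acl = subring_set_closed[OF A]
  show "lead_ideal A x J k \<subseteq> A" by (auto simp: lead_ideal_def)
  show "0 \<in> lead_ideal A x J k"
    using ideal_inD(2)[OF J] by (auto simp: lead_ideal_def acl cl intro!: exI[of _ 0])
  fix a b
  { assume "a \<in> lead_ideal A x J k" "b \<in> lead_ideal A x J k"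
    then obtain h g where *: "a \<in> A" "coeffs_in A h" "\<forall>i\<ge>k. coeff h i = 0" "a * x ^ k + poly h x \<in> J"
      "b \<in> A" "coeffs_in A g" "\<forall>i\<ge>k. coeff g i = 0" "b * x ^ k + poly g x \<in> J"
      by (auto simp: lead_ideal_def)
    have "(a * x ^ k + poly h x) - (b * x ^ k + poly g x) \<in> J" by (rule ideal_inD(3)[OF J *(4) *(8)])
    then have "(a - b) * x ^ k + poly (h - g) x \<in> J" by (simp add: algebra_simps)
    then show "a - b \<in> lead_ideal A x J k" using * unfolding lead_ideal_def
      by (intro CollectI conjI exI[of _ "h - g"]) (auto simp: acl cl simp del: poly_diff) }
  { assume "a \<in> A" "b \<in> lead_ideal A x J k"
    then obtain h where *: "b \<in> A" "coeffs_in A h" "\<forall>i\<ge>k. coeff h i = 0" "b * x ^ k + poly h x \<in> J"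
      by (auto simp: lead_ideal_def)
    have "a * (b * x ^ k + poly h x) \<in> J"
      using ideal_inD(4)[OF J _ *(4)] adjoin_superset[OF A] \<open>a \<in> A\<close> by blast
    then have "(a * b) * x ^ k + poly (smult a h) x \<in> J" by (simp add: algebra_simps)
    then show "a * b \<in> lead_ideal A x J k" using * \<open>a \<in> A\<close> unfolding lead_ideal_def
      by (intro CollectI conjI exI[of _ "smult a h"]) (auto simp: acl cl simp del: poly_smult) }
qed

lemma lead_ideal_mono: "J \<subseteq> J' \<Longrightarrow> lead_ideal A x J k \<subseteq> lead_ideal A x J' k"
  by (auto simp: lead_ideal_def)

lemma lead_ideal_Suc:
  assumes J: "ideal_in {poly h x | h. coeffs_in A h} J"
  shows "lead_ideal A x J k \<subseteq> lead_ideal A x J (Suc k)"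
proof
  fix a assume "a \<in> lead_ideal A x J k"
  then obtain h where *: "a \<in> A" "coeffs_in A h" "\<forall>i\<ge>k. coeff h i = 0" "a * x ^ k + poly h x \<in> J"
    by (auto simp: lead_ideal_def)
  have "x * (a * x ^ k + poly h x) \<in> J" using ideal_inD(4)[OF J adjoin_elem[OF A] *(4)] .
  then have "a * x ^ Suc k + poly (pCons 0 h) x \<in> J" by (simp add: algebra_simps)
  then show "a \<in> lead_ideal A x J (Suc k)" using * subring_set_zero[OF A] unfolding lead_ideal_def
    by (intro CollectI conjI exI[of _ "pCons 0 h"])
      (auto simp: coeffs_in_def coeff_pCons split: nat.splits simp del: poly_pCons)
qed

text \<open>Because the leading coefficients agree, an element of J' can be reduced by one of J to a
  shorter representing polynomial. The induction is on the length of the representation, since an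
  element of A[x] has no degree of its own.\<close>

lemma lead_ideal_determines:
  assumes J: "ideal_in {poly h x | h. coeffs_in A h} J" "ideal_in {poly h x | h. coeffs_in A h} J'"
    and sub: "J \<subseteq> J'" and eq: "\<And>k. lead_ideal A x J k = lead_ideal A x J' k"
  shows "J = J'"
proof
  note cl = coeffs_in_closed[OF A]
  have "poly h x \<in> J" if "coeffs_in A h" "\<forall>i\<ge>k. coeff h i = 0" "poly h x \<in> J'" for h k
    using that
  proof (induction k arbitrary: h)
    case 0
    then have "h = 0" by (simp add: poly_eq_iff)
    then show ?case using ideal_inD(2)[OF J(1)] by simp
  next
    case (Suc k)
    define a where "a = coeff h k"
    define h0 where "h0 = h - monom a k"
    have aA: "a \<in> A" using Suc.prems by (simp add: a_def coeffs_in_def)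
    have h0: "coeffs_in A h0" "\<forall>i\<ge>k. coeff h0 i = 0"
      using Suc.prems aA by (auto simp: h0_def a_def cl not_less_eq_eq le_Suc_eq)
    have h: "poly h x = a * x ^ k + poly h0 x" by (simp add: h0_def poly_monom)
    then have "a \<in> lead_ideal A x J' k" using aA h0 Suc.prems(3) unfolding lead_ideal_def by auto
    then have "a \<in> lead_ideal A x J k" using eq by simp
    then obtain h1 where h1: "coeffs_in A h1" "\<forall>i\<ge>k. coeff h1 i = 0" "a * x ^ k + poly h1 x \<in> J"
      by (auto simp: lead_ideal_def)
    have "poly h x - (a * x ^ k + poly h1 x) \<in> J'"
      using h1 sub Suc.prems(3) by (intro ideal_inD(3)[OF J(2)]) auto
    then have "poly (h0 - h1) x \<in> J'" by (simp add: h)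
    then have "poly (h0 - h1) x \<in> J" using h0 h1 by (intro Suc.IH) (auto simp: cl)
    then have "poly (h0 - h1) x + (a * x ^ k + poly h1 x) \<in> J" by (rule ideal_inD(5)[OF J(1) _ h1(3)])
    then show ?case by (simp add: h algebra_simps)
  qed
  then show "J' \<subseteq> J"
  proof (intro subsetI)
    fix y assume *: "\<And>h k. coeffs_in A h \<Longrightarrow> \<forall>i\<ge>k. coeff h i = 0 \<Longrightarrow> poly h x \<in> J' \<Longrightarrow> poly h x \<in> J" and y: "y \<in> J'"
    obtain h where "coeffs_in A h" "y = poly h x" using y ideal_inD(1)[OF J(2)] by auto
    then show "y \<in> J" using *[of h "Suc (degree h)"] y by (auto simp: coeff_eq_0)
  qed
qed (rule sub)

lemma noetherian_set_adjoin:
  assumes N: "noetherian_set A"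
  shows "noetherian_set {poly h x | h. coeffs_in A h}"
  unfolding noetherian_set_def
proof (intro allI impI)
  let ?B = "{poly h x | h. coeffs_in A h}"
  fix J :: "nat \<Rightarrow> 'a set" assume JJ: "(\<forall>i. ideal_in ?B (J i)) \<and> (\<forall>i. J i \<subseteq> J (Suc i))"
  then have J: "ideal_in ?B (J i)" for i by blast
  have mono: "J i \<subseteq> J j" if "i \<le> j" for i j using JJ that by (meson lift_Suc_mono_le)
  define l where "l = (\<lambda>i k. lead_ideal A x (J i) k)"
  have l: "ideal_in A (l i k)" for i k unfolding l_def by (rule ideal_in_lead_ideal[OF J])
  have lm: "l i k \<subseteq> l i' k'" if "i \<le> i'" "k \<le> k'" for i i' k k'
  proof -
    have "l i k \<subseteq> l i k'" using that(2) lead_ideal_Suc[OF J] unfolding l_def by (meson lift_Suc_mono_le)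
    also have "\<dots> \<subseteq> l i' k'" unfolding l_def by (rule lead_ideal_mono[OF mono[OF that(1)]])
    finally show ?thesis .
  qed
  have stab: "\<exists>N. \<forall>i\<ge>N. f i = f N" if "\<And>i. ideal_in A (f i)" "\<And>i. f i \<subseteq> f (Suc i)" for f
    using N that unfolding noetherian_set_def by blast
  \<comment> \<open>The ideals \<open>l i k\<close> grow in both indices. The diagonal chain settles
    all k > n at once, and only the finitely many k \<le> n need their own bound
    \<open>s k\<close>.\<close>
  obtain n where n: "\<And>i. i \<ge> n \<Longrightarrow> l i i = l n n" using stab[of "\<lambda>i. l i i"] l lm by (metis le_Suc_eq le_refl)
  have "\<exists>N. \<forall>i\<ge>N. l i k = l N k" for k using stab[of "\<lambda>i. l i k"] l lm by simp
  then obtain s where s: "\<And>k i. i \<ge> s k \<Longrightarrow> l i k = l (s k) k" by metis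
  define m where "m = Max (insert n (s ` {..n}))"
  have mn: "n \<le> m" "\<And>k. k \<le> n \<Longrightarrow> s k \<le> m" unfolding m_def by (auto intro!: Max_ge simp del: Max_insert)
  have "J i = J m" if i: "i \<ge> m" for i
  proof (rule lead_ideal_determines[OF J J mono[OF i], symmetric])
    fix k
    show "lead_ideal A x (J m) k = lead_ideal A x (J i) k"
    proof (cases "k \<le> n")
      case True
      then have "l m k = l (s k) k" "l i k = l (s k) k" using s[of k m] s[of k i] mn(2)[of k] i by auto
      then show ?thesis by (simp add: l_def)
    next
      case False
      have "l j k = l n n" if "j \<ge> m" for j
      proof
        have "l j k \<subseteq> l (max j k) (max j k)" by (rule lm) auto
        also have "\<dots> = l n n" using n[of "max j k"] mn that by auto
        finally show "l j k \<subseteq> l n n" .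
        show "l n n \<subseteq> l j k" using lm[of n j n k] that mn False by auto
      qed
      then show ?thesis using i by (simp add: l_def)
    qed
  qed
  then show "\<exists>N. \<forall>i\<ge>N. J i = J N" by blast
qed

end

lemma noetherian_set_maximal:
  assumes A: "noetherian_set A" and S: "\<And>J. J \<in> S \<Longrightarrow> ideal_in A J" "J0 \<in> S"
  shows "\<exists>J\<in>S. \<forall>J'\<in>S. J \<subseteq> J' \<longrightarrow> J' = J"
proof (rule ccontr)
  assume "\<not> ?thesis"
  then have "\<forall>J\<in>S. \<exists>J'. J' \<in> S \<and> J \<subset> J'" by blast
  then obtain F where F: "\<And>J. J \<in> S \<Longrightarrow> F J \<in> S \<and> J \<subset> F J" by metis
  define C where "C = (\<lambda>n. (F ^^ n) J0)"
  have C: "C n \<in> S" for n unfolding C_def by (induction n) (use S F in auto)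
  have "C n \<subset> C (Suc n)" for n using F[OF C[of n]] by (simp add: C_def)
  moreover from this have "\<exists>N. \<forall>i\<ge>N. C i = C N"
    using A C S(1) unfolding noetherian_set_def by (meson less_imp_le)
  ultimately show False by (metis le_Suc_eq order_refl psubsetE)
qed

section \<open>Multivariate polynomials\<close>

lemma poly_mapping_sum_single:
  fixes f :: "'a \<Rightarrow>\<^sub>0 'b::comm_monoid_add"
  shows "f = (\<Sum>m\<in>Poly_Mapping.keys f. Poly_Mapping.single m (Poly_Mapping.lookup f m))"
  by (rule poly_mapping_eqI)
    (auto simp: lookup_sum lookup_single when_def in_keys_iff sum.delta' if_distrib cong: if_cong)

definition monom_val :: "(nat \<Rightarrow> 'b::comm_ring_1) \<Rightarrow> (nat \<Rightarrow>\<^sub>0 nat) \<Rightarrow> 'b" where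
  "monom_val x m = (\<Prod>k\<in>Poly_Mapping.keys m. x k ^ Poly_Mapping.lookup m k)"

definition monom_deg :: "(nat \<Rightarrow>\<^sub>0 nat) \<Rightarrow> nat" where
  "monom_deg m = (\<Sum>k\<in>Poly_Mapping.keys m. Poly_Mapping.lookup m k)"

lemma monom_val_superset:
  assumes "finite S" "Poly_Mapping.keys m \<subseteq> S"
  shows "monom_val x m = (\<Prod>k\<in>S. x k ^ Poly_Mapping.lookup m k)"
  unfolding monom_val_def using assms by (intro prod.mono_neutral_left) (auto simp: in_keys_iff)

lemma monom_deg_superset:
  assumes "finite S" "Poly_Mapping.keys m \<subseteq> S"
  shows "monom_deg m = (\<Sum>k\<in>S. Poly_Mapping.lookup m k)"
  unfolding monom_deg_def using assms by (intro sum.mono_neutral_left) (auto simp: in_keys_iff)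

lemma monom_val_add: "monom_val x (m + n) = monom_val x m * monom_val x n"
proof -
  let ?S = "Poly_Mapping.keys m \<union> Poly_Mapping.keys n"
  have "Poly_Mapping.keys (m + n) \<subseteq> ?S" by (rule keys_add)
  then show ?thesis
    by (subst (1 2 3) monom_val_superset[of ?S]) (auto simp: lookup_add power_add prod.distrib)
qed

lemma monom_deg_add: "monom_deg (m + n) = monom_deg m + monom_deg n"
proof -
  let ?S = "Poly_Mapping.keys m \<union> Poly_Mapping.keys n"
  have "Poly_Mapping.keys (m + n) \<subseteq> ?S" by (rule keys_add)
  then show ?thesis
    by (subst (1 2 3) monom_deg_superset[of ?S]) (auto simp: lookup_add sum.distrib)
qed

lemma monom_val_0 [simp]: "monom_val x 0 = 1"
  by (simp add: monom_val_def)

lemma monom_deg_0 [simp]: "monom_deg 0 = 0"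
  by (simp add: monom_deg_def)

lemma monom_val_single [simp]: "monom_val x (Poly_Mapping.single k i) = x k ^ i"
  by (cases "i = 0") (auto simp: monom_val_def)

lemma monom_deg_single [simp]: "monom_deg (Poly_Mapping.single k i) = i"
  by (cases "i = 0") (auto simp: monom_deg_def)

lemma monom_val_cmult: "monom_val (\<lambda>k. c * x k) m = c ^ monom_deg m * monom_val x m"
  by (simp add: monom_val_def monom_deg_def power_mult_distrib prod.distrib power_sum)

lemma monom_val_mpol_var: "monom_val mpol_var m = Poly_Mapping.single m (1::'a::comm_ring_1)"
proof -
  have "monom_val mpol_var (\<Sum>k\<in>S. Poly_Mapping.single k (f k)) = Poly_Mapping.single (\<Sum>k\<in>S. Poly_Mapping.single k (f k)) (1::'a)"
    if "finite S" for S and f :: "nat \<Rightarrow> nat"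
    using that
  proof (induction S rule: finite_induct)
    case (insert k S)
    have "mpol_var k ^ i = Poly_Mapping.single (Poly_Mapping.single k i) (1::'a)" for i
      by (induction i) (auto simp: mpol_var_def mult_single simp flip: single_add)
    then show ?case using insert by (simp add: monom_val_add mult_single)
  qed auto
  then show ?thesis using poly_mapping_sum_single[of m] by (metis finite_keys)
qed

lemma mpol_eval_superset:
  assumes "\<phi> 0 = 0" "finite S" "Poly_Mapping.keys f \<subseteq> S"
  shows "mpol_eval \<phi> x f = (\<Sum>m\<in>S. \<phi> (Poly_Mapping.lookup f m) * monom_val x m)"
  unfolding mpol_eval_def monom_val_def using assms by (intro sum.mono_neutral_left) (auto simp: in_keys_iff)

context comm_ring_hom
begin

lemma mpol_eval_zero [simp]: "mpol_eval hom x 0 = 0"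
  by (simp add: mpol_eval_def)

lemma mpol_eval_add: "mpol_eval hom x (f + g) = mpol_eval hom x f + mpol_eval hom x g"
proof -
  let ?S = "Poly_Mapping.keys f \<union> Poly_Mapping.keys g"
  have "Poly_Mapping.keys (f + g) \<subseteq> ?S" by (rule keys_add)
  then show ?thesis
    by (subst (1 2 3) mpol_eval_superset[of _ ?S]) (auto simp: lookup_add hom_add distrib_right sum.distrib)
qed

lemma mpol_eval_sum: "mpol_eval hom x (\<Sum>i\<in>I. f i) = (\<Sum>i\<in>I. mpol_eval hom x (f i))"
  by (induction I rule: infinite_finite_induct) (auto simp: mpol_eval_add)

lemma mpol_eval_single: "mpol_eval hom x (Poly_Mapping.single m a) = hom a * monom_val x m"
  by (subst mpol_eval_superset[of _ "{m}"]) auto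

lemma mpol_eval_mult: "mpol_eval hom x (f * g) = mpol_eval hom x f * mpol_eval hom x g"
proof -
  let ?F = "\<lambda>f m. Poly_Mapping.single m (Poly_Mapping.lookup f m)"
  have "f * g = (\<Sum>m\<in>Poly_Mapping.keys f. ?F f m) * (\<Sum>n\<in>Poly_Mapping.keys g. ?F g n)"
    using poly_mapping_sum_single[of f] poly_mapping_sum_single[of g] by simp
  also have "\<dots> = (\<Sum>m\<in>Poly_Mapping.keys f. \<Sum>n\<in>Poly_Mapping.keys g.
      Poly_Mapping.single (m + n) (Poly_Mapping.lookup f m * Poly_Mapping.lookup g n))"
    by (simp add: sum_product mult_single)
  finally have "mpol_eval hom x (f * g) = (\<Sum>m\<in>Poly_Mapping.keys f. \<Sum>n\<in>Poly_Mapping.keys g.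
      (hom (Poly_Mapping.lookup f m) * monom_val x m) * (hom (Poly_Mapping.lookup g n) * monom_val x n))"
    by (simp add: mpol_eval_sum mpol_eval_single monom_val_add hom_mult mult_ac)
  also have "\<dots> = mpol_eval hom x f * mpol_eval hom x g"
    by (simp add: sum_product mpol_eval_def monom_val_def)
  finally show ?thesis .
qed

lemma mpol_eval_one [simp]: "mpol_eval hom x 1 = 1"
  using mpol_eval_single[of x 0 1] by simp

lemma mpol_eval_uminus: "mpol_eval hom x (- f) = - mpol_eval hom x f"
  using mpol_eval_add[of x f "- f"] by (simp add: eq_neg_iff_add_eq_0 add.commute)

lemma mpol_eval_diff: "mpol_eval hom x (f - g) = mpol_eval hom x f - mpol_eval hom x g"
  using mpol_eval_add[of x f "- g"] by (simp add: mpol_eval_uminus)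

lemma mpol_eval_power: "mpol_eval hom x (f ^ i) = mpol_eval hom x f ^ i"
  by (induction i) (auto simp: mpol_eval_mult)

lemma mpol_eval_var [simp]: "mpol_eval hom x (mpol_var k) = x k"
  by (simp add: mpol_var_def mpol_eval_single)

lemma mpol_eval_const [simp]: "mpol_eval hom x (Poly_Mapping.single 0 a) = hom a"
  by (simp add: mpol_eval_single)

end

lemma mpol_carrier_iff: "f \<in> carrier (mpol_ring A) \<longleftrightarrow> (\<forall>m\<in>Poly_Mapping.keys f. Poly_Mapping.keys m \<subseteq> A)"
  by (simp add: mpol_ring_def)

lemma subring_set_mpol: "subring_set (carrier (mpol_ring A) :: 'a::comm_ring_1 mpol set)"
proof (rule subring_setI)
  show "1 \<in> carrier (mpol_ring A)" by (simp add: mpol_carrier_iff)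
  fix f g :: "'a mpol" assume fg: "f \<in> carrier (mpol_ring A)" "g \<in> carrier (mpol_ring A)"
  show "f - g \<in> carrier (mpol_ring A)"
    using fg keys_add[of f "- g"] by (auto simp: mpol_carrier_iff in_keys_iff lookup_minus)
  show "f * g \<in> carrier (mpol_ring A)" unfolding mpol_carrier_iff
  proof
    fix m assume "m \<in> Poly_Mapping.keys (f * g)"
    then obtain a b where "m = a + b" "a \<in> Poly_Mapping.keys f" "b \<in> Poly_Mapping.keys g"
      using keys_mult[of f g] by blast
    then show "Poly_Mapping.keys m \<subseteq> A" using fg keys_add[of a b] unfolding mpol_carrier_iff by blast
  qed
qed

lemma mpol_var_in_carrier: "k \<in> A \<Longrightarrow> mpol_var k \<in> carrier (mpol_ring A)"
  and mpol_const_in_carrier: "Poly_Mapping.single 0 c \<in> carrier (mpol_ring A)"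
  by (auto simp: mpol_carrier_iff mpol_var_def)

lemma mpol_carrier_minimal:
  fixes N :: "'a::comm_ring_1 mpol set"
  assumes N: "subring_set N" "\<And>c. Poly_Mapping.single 0 c \<in> N" "\<And>k. k \<in> A \<Longrightarrow> mpol_var k \<in> N"
  shows "carrier (mpol_ring A) \<subseteq> N"
proof
  fix f :: "'a mpol" assume f: "f \<in> carrier (mpol_ring A)"
  have "Poly_Mapping.single m (Poly_Mapping.lookup f m) \<in> N" if m: "m \<in> Poly_Mapping.keys f" for m
  proof -
    have "Poly_Mapping.single m (Poly_Mapping.lookup f m) = Poly_Mapping.single 0 (Poly_Mapping.lookup f m) * monom_val mpol_var m"
      by (simp add: monom_val_mpol_var mult_single)
    moreover have "monom_val mpol_var m \<in> N" unfolding monom_val_def using f m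
      by (intro subring_set_prod[OF N(1)] subring_set_power[OF N(1)] N(3)) (auto simp: mpol_carrier_iff)
    ultimately show ?thesis using N by (auto intro: subring_set_mult)
  qed
  then have "(\<Sum>m\<in>Poly_Mapping.keys f. Poly_Mapping.single m (Poly_Mapping.lookup f m)) \<in> N"
    by (intro subring_set_sum[OF N(1)])
  then show "f \<in> N" using poly_mapping_sum_single[of f] by simp
qed

text \<open>Hilbert's basis theorem, one variable at a time; in the base case only the constants are
  left, and they form a field.\<close>

lemma noetherian_mpol: "noetherian_set (carrier (mpol_ring {..<n}) :: 'a::field mpol set)"
proof (induction n)
  case 0
  have c: "a \<in> range (Poly_Mapping.single 0)" if "a \<in> carrier (mpol_ring {..<0::nat})" for a :: "'a mpol"
  proof -
    have "Poly_Mapping.keys a \<subseteq> {0}" using that by (auto simp: mpol_carrier_iff)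
    then have "a = Poly_Mapping.single 0 (Poly_Mapping.lookup a 0)"
      by (intro poly_mapping_eqI) (auto simp: lookup_single when_def in_keys_iff)
    then show ?thesis by blast
  qed
  show ?case
  proof (rule noetherian_set_field)
    fix a :: "'a mpol" assume a: "a \<in> carrier (mpol_ring {..<0})" "a \<noteq> 0"
    obtain r where "a = Poly_Mapping.single 0 r" using c[OF a(1)] by blast
    moreover from this have "r \<noteq> 0" using a(2) by auto
    ultimately show "\<exists>b\<in>carrier (mpol_ring {..<0}). b * a = 1"
      by (intro bexI[of _ "Poly_Mapping.single 0 (inverse r)"]) (auto simp: mult_single mpol_const_in_carrier)
  qed
next
  case (Suc n)
  let ?A = "carrier (mpol_ring {..<n}) :: 'a mpol set"
  have mono: "?A \<subseteq> carrier (mpol_ring {..<Suc n})" by (force simp: mpol_carrier_iff)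
  have "carrier (mpol_ring {..<Suc n}) = {poly h (mpol_var n) | h. coeffs_in ?A h}"
  proof
    show "carrier (mpol_ring {..<Suc n}) \<subseteq> {poly h (mpol_var n) | h. coeffs_in ?A h}"
    proof (rule mpol_carrier_minimal[OF subring_set_adjoin[OF subring_set_mpol]])
      show "Poly_Mapping.single 0 c \<in> {poly h (mpol_var n) | h. coeffs_in ?A h}" for c :: 'a
        by (intro subsetD[OF adjoin_superset[OF subring_set_mpol]] mpol_const_in_carrier)
      fix k assume "k \<in> {..<Suc n}"
      then have "k = n \<or> k \<in> {..<n}" by auto
      then show "mpol_var k \<in> {poly h (mpol_var n) | h. coeffs_in ?A h}"
      proof
        assume "k = n"
        then show ?thesis using adjoin_elem[OF subring_set_mpol, of "mpol_var n"] by (simp only:)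
      next
        assume "k \<in> {..<n}"
        then show ?thesis by (intro subsetD[OF adjoin_superset[OF subring_set_mpol]] mpol_var_in_carrier)
      qed
    qed
    show "{poly h (mpol_var n) | h. coeffs_in ?A h} \<subseteq> carrier (mpol_ring {..<Suc n})"
      using poly_in_subring[OF subring_set_mpol] coeffs_in_mono[OF mono] mpol_var_in_carrier[of n "{..<Suc n}"] by blast
  qed
  then show ?case using noetherian_set_adjoin[OF subring_set_mpol Suc.IH] by simp
qed

section \<open>Homogeneous components\<close>

definition hcomp :: "nat \<Rightarrow> 'a::comm_ring_1 mpol \<Rightarrow> 'a mpol" where
  "hcomp e f = (\<Sum>m\<in>{m\<in>Poly_Mapping.keys f. monom_deg m = e}. Poly_Mapping.single m (Poly_Mapping.lookup f m))"

lemma homog_iff: "homog d f \<longleftrightarrow> (\<forall>m\<in>Poly_Mapping.keys f. monom_deg m = d)"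
  by (simp add: homog_def monom_deg_def)

lemma lookup_hcomp: "Poly_Mapping.lookup (hcomp e f) m = (if monom_deg m = e then Poly_Mapping.lookup f m else 0)"
  by (auto simp: hcomp_def lookup_sum lookup_single when_def sum.delta' in_keys_iff if_distrib cong: if_cong)

lemma keys_hcomp: "Poly_Mapping.keys (hcomp e f) = {m\<in>Poly_Mapping.keys f. monom_deg m = e}"
  by (auto simp: in_keys_iff lookup_hcomp split: if_splits)

lemma homog_hcomp: "homog e (hcomp e f)"
  by (simp add: homog_iff keys_hcomp)

lemma hcomp_in_carrier: "f \<in> carrier (mpol_ring A) \<Longrightarrow> hcomp e f \<in> carrier (mpol_ring A)"
  by (simp add: mpol_carrier_iff keys_hcomp)

lemma sum_hcomp:
  obtains D where "f = (\<Sum>e\<le>D. hcomp e f)"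
proof -
  define D where "D = Max (insert 0 (monom_deg ` Poly_Mapping.keys f))"
  have D: "monom_deg m \<le> D" if "m \<in> Poly_Mapping.keys f" for m
    unfolding D_def using that by (intro Max_ge) auto
  have "f = (\<Sum>e\<le>D. hcomp e f)"
    by (rule poly_mapping_eqI) (use D in \<open>auto simp: lookup_sum lookup_hcomp sum.delta in_keys_iff\<close>)
  then show ?thesis using that by blast
qed

lemma homog_mult:
  assumes "homog d f" "homog e g"
  shows "homog (d + e) (f * g)"
  unfolding homog_iff
proof
  fix m assume "m \<in> Poly_Mapping.keys (f * g)"
  then obtain a b where "m = a + b" "a \<in> Poly_Mapping.keys f" "b \<in> Poly_Mapping.keys g"
    using keys_mult[of f g] by blast
  then show "monom_deg m = d + e" using assms by (auto simp: homog_iff monom_deg_add)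
qed

lemma homog_diff: "homog d f \<Longrightarrow> homog d g \<Longrightarrow> homog d (f - g)"
  by (auto simp: homog_iff in_keys_iff lookup_minus)

lemma homog_one: "homog 0 1"
  by (simp add: homog_iff)

lemma homog_const: "homog 0 (Poly_Mapping.single 0 c)"
  by (simp add: homog_iff)

lemma homog_var: "homog 1 (mpol_var k)"
  by (simp add: homog_iff mpol_var_def)

lemma homog_power: "homog d f \<Longrightarrow> homog (i * d) (f ^ i)"
  by (induction i) (auto simp: homog_one homog_mult)

lemma (in comm_ring_hom) mpol_eval_cmult_homog:
  assumes "homog d f"
  shows "mpol_eval hom (\<lambda>k. c * x k) f = c ^ d * mpol_eval hom x f"
  using assms unfolding mpol_eval_def monom_val_def[symmetric] monom_val_cmult
  by (auto simp: sum_distrib_left homog_iff mult_ac intro!: sum.cong)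

section \<open>A family of discrete valuation rings on a function field\<close>

lemma field_hom_eq_0_iff:
  assumes "field_hom h"
  shows "h x = 0 \<longleftrightarrow> x = 0"
proof -
  interpret field_hom h by fact
  have "h x * h (inverse x) = 1" if "x \<noteq> 0" using that by (simp flip: hom_mult)
  then show ?thesis by force
qed

lemma field_hom_inj:
  assumes "field_hom h"
  shows "inj h"
proof (rule injI)
  interpret field_hom h by fact
  fix x y assume "h x = h y"
  then have "h (x - y) = 0" by (simp add: hom_minus)
  then show "x = y" using field_hom_eq_0_iff[OF assms] by simp
qed

lemma subfield_set_range:
  assumes "field_hom h"
  shows "subfield_set (range h)"
proof -
  interpret field_hom h by fact
  show ?thesis unfolding subfield_set_def subring_set_def
    by (auto simp flip: hom_minus hom_mult hom_inverse hom_one)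
qed

text \<open>Elements of the prime field are multiples of 1, so the image of t alone generates the
  image of the polynomial ring.\<close>

lemma fract_hom_poly_in_rgen:
  fixes e :: "'p::prime_card mod_ring poly fract \<Rightarrow> 'k::field"
  assumes "field_hom e"
  shows "e (Fract a 1) \<in> rgen {e (Fract [:0, 1:] 1)}"
proof (induction a)
  case 0
  interpret field_hom e by fact
  show ?case using subring_set_zero[OF subring_set_rgen] by (simp flip: Zero_fract_def)
next
  case (pCons c a)
  interpret field_hom e by fact
  obtain i where i: "c = of_nat i" using surj_of_nat_mod_ring[of c] by blast
  have "pCons c a = of_nat i + [:0, 1:] * a" by (simp add: i of_nat_poly)
  then have "Fract (pCons c a) 1 = of_nat i + Fract [:0, 1:] 1 * Fract a 1"
    by (simp add: of_nat_fract)
  then have "e (Fract (pCons c a) 1) = of_nat i + e (Fract [:0, 1:] 1) * e (Fract a 1)"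
    by (simp only: hom_add hom_mult hom_of_nat)
  moreover have "of_nat i + e (Fract [:0, 1:] 1) * e (Fract a 1) \<in> rgen {e (Fract [:0, 1:] 1)}"
    by (intro subring_set_add subring_set_mult subring_set_of_nat subring_set_rgen pCons rgen_incl) simp
  ultimately show ?case by simp
qed

lemma infinite_range_fract_hom:
  fixes e :: "'p::prime_card mod_ring poly fract \<Rightarrow> 'k::field"
  assumes "field_hom e"
  shows "infinite (range e)"
proof -
  have "inj (\<lambda>i::nat. Fract (monom 1 i :: 'p mod_ring poly) 1)"
    by (rule injI) (auto simp: eq_fract dest: arg_cong[of _ _ degree] simp: degree_monom_eq)
  then have "infinite (UNIV :: 'p mod_ring poly fract set)"
    using range_inj_infinite finite_subset[OF subset_UNIV] by metis
  then show ?thesis using field_hom_inj[OF assms] by (simp add: finite_image_iff)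
qed

lemma field_hom_comp: "field_hom f \<Longrightarrow> field_hom g \<Longrightarrow> field_hom (\<lambda>x. g (f x))"
proof -
  assume "field_hom f" "field_hom g"
  then interpret f: field_hom f + g: field_hom g .
  show ?thesis by unfold_locales (auto simp: hom_distribs)
qed

text \<open>The generating sets of a family are finite and come without a base field. Therefore the
  constants themselves must be the fraction field of a finitely generated ring; t and a finite
  spanning set of the extension suffice.\<close>

lemma range_finite_extension_eq_fgen:
  fixes j :: "'p::prime_card mod_ring poly fract \<Rightarrow> 'f::field" and \<iota> :: "'f \<Rightarrow> 'k::field"
  assumes j: "field_hom j" "finite_field_extension j" and \<iota>: "field_hom \<iota>"
  obtains C where "finite C" "range \<iota> = fgen C"
proof -
  interpret j: field_hom j by (rule j)
  interpret i: field_hom \<iota> by (rule \<iota>)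
  have m: "Modules.module (\<lambda>c x. j c * x)" by unfold_locales (auto simp: hom_distribs algebra_simps)
  interpret m: Modules.module "\<lambda>c x. j c * x" by (rule m)
  obtain B where B: "finite B" "m.span B = UNIV" using j(2) by (auto simp: finite_field_extension_def)
  let ?e = "\<lambda>x. \<iota> (j x)"
  have e: "field_hom ?e" by (rule field_hom_comp[OF j(1) \<iota>])
  define C where "C = insert (?e (Fract [:0, 1:] 1)) (\<iota> ` B)"
  note fs = subfield_set_fgen[of C]
  have eC: "?e x \<in> fgen C" for x
  proof (cases x)
    case (Fract a b)
    interpret e: field_hom ?e by (rule e)
    have "x = Fract a 1 / Fract b 1" using Fract by simp
    then have "?e x = ?e (Fract a 1) / ?e (Fract b 1)" by (simp only: e.hom_div)
    moreover have "?e (Fract c 1) \<in> fgen C" for c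
      using fract_hom_poly_in_rgen[OF e, of c] rgen_mono[of "{?e (Fract [:0, 1:] 1)}" C] rgen_subset_fgen[of C]
      by (auto simp: C_def)
    ultimately show ?thesis using subfield_set_divide[OF fs] by simp
  qed
  have "range \<iota> \<subseteq> fgen C"
  proof
    fix y assume "y \<in> range \<iota>"
    then obtain x where x: "y = \<iota> x" by auto
    have "x \<in> m.span B" using B by simp
    then obtain t r where t: "x = (\<Sum>a\<in>t. j (r a) * a)" "finite t" "t \<subseteq> B" unfolding m.span_explicit by blast
    have "y = (\<Sum>a\<in>t. \<iota> (j (r a)) * \<iota> a)" unfolding x t by (simp add: hom_distribs)
    also have "\<dots> \<in> fgen C"
    proof (intro subring_set_sum subring_set_mult subfield_set_subring fs eC)
      fix a assume "a \<in> t"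
      then show "\<iota> a \<in> fgen C" using t subset_fgen[of C] by (auto simp: C_def)
    qed
    finally show "y \<in> fgen C" .
  qed
  moreover have "fgen C \<subseteq> range \<iota>"
    by (rule fgen_minimal[OF subfield_set_range[OF \<iota>]]) (auto simp: C_def)
  ultimately show ?thesis using that[of C] B by (auto simp: C_def)
qed

lemma CHAR_fract_hom:
  fixes e :: "'p::prime_card mod_ring poly fract \<Rightarrow> 'k::field"
  assumes "field_hom e"
  shows "CHAR('k) = CARD('p)"
proof -
  interpret field_hom e by fact
  have "of_nat CARD('p) = (0 :: 'p mod_ring poly)" by (simp add: of_nat_poly)
  then have "of_nat CARD('p) = (0 :: 'p mod_ring poly fract)" by (simp add: of_nat_fract Zero_fract_def)
  then have "of_nat CARD('p) = (0 :: 'k)" using hom_of_nat[of "CARD('p)"] by simp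
  then have "CHAR('k) dvd CARD('p)" using of_nat_eq_0_iff_char_dvd by blast
  then show ?thesis using prime_card[where 'a = 'p] CHAR_not_1'[where 'a = 'k]
    by (metis One_nat_def prime_nat_iff)
qed

lemma clear_denominators_fgen:
  assumes "coeffs_in (fgen S) h"
  shows "\<exists>s\<in>rgen S. s \<noteq> 0 \<and> coeffs_in (rgen S) (smult s h)"
  using assms
proof (induction h)
  case 0
  then show ?case using coeffs_in_0[OF subring_set_rgen] rgen_one[of S] by (intro bexI[of _ 1]) auto
next
  case (pCons c h)
  note cl = subring_set_closed[OF subring_set_rgen[of S]]
  have "coeffs_in (fgen S) h" "c \<in> fgen S"
    using pCons.prems by (auto simp: coeffs_in_def coeff_pCons split: nat.splits)
  then obtain s a b where s: "s \<in> rgen S" "s \<noteq> 0" "coeffs_in (rgen S) (smult s h)"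
    and ab: "c = a / b" "a \<in> rgen S" "b \<in> rgen S" using pCons.IH by (auto simp: fgen_def)
  define b' where "b' = (if b = 0 then 1 else b)"
  have b': "b' \<in> rgen S" "b' \<noteq> 0" "b' * c \<in> rgen S" using ab by (auto simp: b'_def cl)
  have "coeffs_in (rgen S) (smult (s * b') (pCons c h))"
    unfolding coeffs_in_def
  proof
    fix i
    show "coeff (smult (s * b') (pCons c h)) i \<in> rgen S"
    proof (cases i)
      case 0
      have "s * (b' * c) \<in> rgen S" by (rule cl(3)[OF s(1) b'(3)])
      then show ?thesis using 0 by (simp add: mult.assoc)
    next
      case (Suc k)
      have "b' * coeff (smult s h) k \<in> rgen S" using s(3) by (intro cl(3)[OF b'(1)]) (simp only: coeffs_in_def)
      then show ?thesis using Suc by (simp add: mult_ac)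
    qed
  qed
  then show ?case using s b' by (intro bexI[of _ "s * b'"]) (auto simp: cl)
qed

lemma rgen_subset_mpol_eval:
  assumes "comm_ring_hom \<phi>"
  shows "rgen (range \<phi> \<union> x ` A) \<subseteq> mpol_eval \<phi> x ` carrier (mpol_ring A)"
proof (rule rgen_minimal)
  interpret comm_ring_hom \<phi> by fact
  note cl = subring_set_closed[OF subring_set_mpol]
  show "subring_set (mpol_eval \<phi> x ` carrier (mpol_ring A))"
  proof (rule subring_setI)
    show "1 \<in> mpol_eval \<phi> x ` carrier (mpol_ring A)"
      by (rule image_eqI[of _ _ 1]) (auto simp: cl)
    fix u v assume "u \<in> mpol_eval \<phi> x ` carrier (mpol_ring A)" "v \<in> mpol_eval \<phi> x ` carrier (mpol_ring A)"
    then obtain f g where fg: "u = mpol_eval \<phi> x f" "v = mpol_eval \<phi> x g" "f \<in> carrier (mpol_ring A)" "g \<in> carrier (mpol_ring A)"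
      by blast
    show "u - v \<in> mpol_eval \<phi> x ` carrier (mpol_ring A)"
      by (rule image_eqI[of _ _ "f - g"]) (auto simp: fg cl mpol_eval_diff)
    show "u * v \<in> mpol_eval \<phi> x ` carrier (mpol_ring A)"
      by (rule image_eqI[of _ _ "f * g"]) (auto simp: fg cl mpol_eval_mult)
  qed
  show "range \<phi> \<union> x ` A \<subseteq> mpol_eval \<phi> x ` carrier (mpol_ring A)"
  proof (intro Un_least image_subsetI)
    fix c show "\<phi> c \<in> mpol_eval \<phi> x ` carrier (mpol_ring A)"
      by (rule image_eqI[of _ _ "Poly_Mapping.single 0 c"]) (auto simp: mpol_const_in_carrier)
    fix k assume "k \<in> A"
    then show "x k \<in> mpol_eval \<phi> x ` carrier (mpol_ring A)"
      by (intro image_eqI[of _ _ "mpol_var k"]) (auto simp: mpol_var_in_carrier)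
  qed
qed

lemma lookup_mult_single:
  fixes f :: "'a::comm_ring_1 mpol"
  shows "Poly_Mapping.lookup (f * Poly_Mapping.single t 1) n =
    (\<Sum>m\<in>Poly_Mapping.keys f. if m + t = n then Poly_Mapping.lookup f m else 0)"
proof -
  have "f * Poly_Mapping.single t 1 = (\<Sum>m\<in>Poly_Mapping.keys f. Poly_Mapping.single (m + t) (Poly_Mapping.lookup f m))"
    by (subst poly_mapping_sum_single[of f]) (simp add: sum_distrib_right mult_single)
  then show ?thesis by (simp add: lookup_sum lookup_single when_def)
qed

text \<open>A relation for b_0 over the field of the others is cleared of denominators and lifted to
  a polynomial in X_0 whose coefficients involve only the other variables. Independence kills the
  lift, and as the exponent of X_0 keeps the coefficients apart, each of them is 0.\<close>

lemma transcendental_over_others: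
  fixes \<iota> :: "'f::field \<Rightarrow> 'k::field"
  assumes \<iota>: "field_hom \<iota>" and d: "d \<ge> 1"
    and ind: "\<And>f. f \<in> carrier (mpol_ring {..<d}) \<Longrightarrow> mpol_eval \<iota> b f = 0 \<Longrightarrow> f = 0"
    and h: "coeffs_in (fgen (range \<iota> \<union> b ` {1..<d})) h" "poly h (b 0) = 0"
  shows "h = 0"
proof -
  interpret i: field_hom \<iota> by (rule \<iota>)
  let ?S = "range \<iota> \<union> b ` {1..<d}"
  obtain s where s: "s \<noteq> 0" "coeffs_in (rgen ?S) (smult s h)"
    using clear_denominators_fgen[OF h(1)] by blast
  define H where "H = smult s h"
  have "\<forall>i. \<exists>f. f \<in> carrier (mpol_ring {1..<d}) \<and> coeff H i = mpol_eval \<iota> b f"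
    using s(2) rgen_subset_mpol_eval[OF i.comm_ring_hom_axioms, of b "{1..<d}"] unfolding H_def coeffs_in_def by blast
  then obtain F where F: "\<And>i. F i \<in> carrier (mpol_ring {1..<d})" "\<And>i. coeff H i = mpol_eval \<iota> b (F i)"
    by metis
  define G where "G = (\<Sum>i\<le>degree H. F i * Poly_Mapping.single (Poly_Mapping.single 0 i) 1)"
  have Fc: "F i \<in> carrier (mpol_ring {..<d})" for i
    using F(1)[of i] by (force simp: mpol_carrier_iff)
  have "Poly_Mapping.single (Poly_Mapping.single 0 i) 1 \<in> carrier (mpol_ring {..<d})" for i
    using d by (auto simp: mpol_carrier_iff)
  then have "G \<in> carrier (mpol_ring {..<d})" unfolding G_def
    by (intro subring_set_sum[OF subring_set_mpol] subring_set_mult[OF subring_set_mpol] Fc)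
  moreover have "mpol_eval \<iota> b G = 0"
  proof -
    have "mpol_eval \<iota> b G = (\<Sum>i\<le>degree H. coeff H i * b 0 ^ i)"
      unfolding G_def by (simp add: i.mpol_eval_sum i.mpol_eval_mult i.mpol_eval_single F(2))
    also have "\<dots> = poly H (b 0)" by (simp add: poly_altdef)
    finally show ?thesis using h by (simp add: H_def)
  qed
  ultimately have G0: "G = 0" by (rule ind)
  have "F j = 0" if j: "j \<le> degree H" for j
  proof (rule ccontr)
    assume "F j \<noteq> 0"
    then obtain n where n: "n \<in> Poly_Mapping.keys (F j)" by fastforce
    have z: "Poly_Mapping.lookup m 0 = 0" if "m \<in> Poly_Mapping.keys (F i)" for m i
      using F(1)[of i] that by (force simp: mpol_carrier_iff in_keys_iff)
    have eq: "m + Poly_Mapping.single 0 i = n + Poly_Mapping.single 0 j \<longleftrightarrow> i = j \<and> m = n"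
      if m: "m \<in> Poly_Mapping.keys (F i)" for m i
    proof
      assume a: "m + Poly_Mapping.single 0 i = n + Poly_Mapping.single 0 j"
      from arg_cong[OF a, of "\<lambda>p. Poly_Mapping.lookup p 0"] have "i = j" using z[OF m] z[OF n] by (simp add: lookup_add)
      then show "i = j \<and> m = n" using a by simp
    qed auto
    have "Poly_Mapping.lookup G (n + Poly_Mapping.single 0 j) =
      (\<Sum>i\<le>degree H. \<Sum>m\<in>Poly_Mapping.keys (F i). if i = j \<and> m = n then Poly_Mapping.lookup (F i) m else 0)"
      unfolding G_def lookup_sum lookup_mult_single using eq by (intro sum.cong refl) auto
    also have "\<dots> = (\<Sum>i\<le>degree H. if i = j then Poly_Mapping.lookup (F j) n else 0)"
      using n by (intro sum.cong refl) (auto simp: sum.delta)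
    also have "\<dots> = Poly_Mapping.lookup (F j) n" using j by simp
    finally show False using G0 n by (simp add: in_keys_iff)
  qed
  then have "coeff H i = 0" for i using F(2)[of i] by (cases "i \<le> degree H") (auto simp: coeff_eq_0)
  then have "H = 0" by (simp add: poly_eq_iff)
  then show ?thesis using s by (simp add: H_def)
qed

text \<open>The transcendence basis b need not be separating, so one can only rely on p-powers of
  the generators of K being separable over the field L0 of b and the constants. Adjoining these
  powers gives L1, and as there are finitely many generators, one exponent q = p^n brings all of K
  into L1.\<close>

theorem ex_dvr_family_function_field:
  fixes j :: "'p::prime_card mod_ring poly fract \<Rightarrow> 'f::field" and \<iota> :: "'f \<Rightarrow> 'k::field"
  assumes j: "field_hom j" "finite_field_extension j" and \<iota>: "field_hom \<iota>" "finitely_generated_extension \<iota>"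
    and d: "has_transcendence_degree \<iota> d" "d \<ge> 1"
  shows "\<exists>W C. dvr_family (range \<iota>) (UNIV :: 'k set) W C"
proof -
  interpret i: field_hom \<iota> by (rule \<iota>)
  obtain C0 where C0: "finite C0" "range \<iota> = fgen C0" by (rule range_finite_extension_eq_fgen[OF j \<iota>(1)])
  have e: "field_hom (\<lambda>x. \<iota> (j x))" by (rule field_hom_comp[OF j(1) \<iota>(1)])
  have inf: "infinite (range \<iota>)"
    using infinite_range_fract_hom[OF e] by (rule infinite_super[rotated]) auto
  obtain b where b: "\<And>f. f \<in> carrier (mpol_ring {..<d}) \<Longrightarrow> mpol_eval \<iota> b f = 0 \<Longrightarrow> f = 0"
    and alg: "\<And>x. algebraic_over (generate_field ring_of_type_algebra (range \<iota> \<union> b ` {..<d})) x"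
    using d(1) unfolding has_transcendence_degree_def by blast
  define k where "k = fgen (range \<iota> \<union> b ` {1..<d})"
  have k: "k = fgen (C0 \<union> b ` {1..<d})" unfolding k_def C0(2) by (rule fgen_union_fgen)
  have "range \<iota> \<subseteq> k" unfolding k_def using subset_fgen[of "range \<iota> \<union> b ` {1..<d}"] by auto
  then have "\<exists>W. dvr_family (range \<iota>) (fgen (insert (b 0) k)) W (insert (b 0) (C0 \<union> b ` {1..<d}))"
    using transcendental_over_others[OF \<iota>(1) d(2) b] C0(1)
    by (intro dvr_family_rational[OF k _ inf]) (auto simp: k_def)
  then obtain W0 D0 where W0: "dvr_family (range \<iota>) (fgen (insert (b 0) k)) W0 D0" by blast
  define L0 where "L0 = fgen (insert (b 0) k)"
  have L0: "subfield_set L0" unfolding L0_def by (rule subfield_set_fgen)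
  have bL0: "range \<iota> \<union> b ` {..<d} \<subseteq> L0"
  proof -
    have "{..<d} = insert 0 {1..<d}" using d(2) by auto
    moreover have "range \<iota> \<union> b ` {1..<d} \<subseteq> k" unfolding k_def by (rule subset_fgen)
    ultimately show ?thesis unfolding L0_def using subset_fgen[of "insert (b 0) k"] by auto
  qed
  have gL0: "generate_field ring_of_type_algebra (range \<iota> \<union> b ` {..<d}) \<subseteq> L0"
    by (rule generate_field_subset[OF L0 bL0])
  define p where "p = CARD('p)"
  have p: "CHAR('k) = p" "prime p" using CHAR_fract_hom[OF e] prime_card[where 'a = 'p] by (auto simp: p_def)
  have "\<exists>e. separable_over L0 (x ^ (p ^ e))" for x
  proof -
    obtain q where q: "q \<noteq> 0" "\<forall>k. coeff q k \<in> generate_field ring_of_type_algebra (range \<iota> \<union> b ` {..<d})" "poly q x = 0"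
      using alg[of x] unfolding algebraic_over_def by blast
    have "coeffs_in L0 q" using q(2) gL0 by (auto simp: coeffs_in_def)
    then show ?thesis using ex_separable_power[OF L0 p _ q(1) q(3)] by blast
  qed
  then obtain e where e: "\<And>x. separable_over L0 (x ^ (p ^ e x))" by metis
  obtain B where B: "finite B" "generate_field ring_of_type_algebra (range \<iota> \<union> B) = UNIV"
    using \<iota>(2) unfolding finitely_generated_extension_def by blast
  define D where "D = (\<lambda>x. x ^ (p ^ e x)) ` B"
  have "\<exists>W' C'. dvr_family (range \<iota>) (fgen (L0 \<union> D)) W' C'"
    using B(1) e by (intro dvr_family_adjoin_separable_finite[OF W0[folded L0_def]]) (auto simp: D_def)
  then obtain W1 C1 where W1: "dvr_family (range \<iota>) (fgen (L0 \<union> D)) W1 C1" by blast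
  define L1 where "L1 = fgen (L0 \<union> D)"
  have L1: "subfield_set L1" unfolding L1_def by (rule subfield_set_fgen)
  note L1r = subfield_set_subring[OF L1]
  have sub: "L0 \<subseteq> L1" "D \<subseteq> L1" unfolding L1_def using subset_fgen[of "L0 \<union> D"] by auto
  \<comment> \<open>\<open>insert 0\<close> keeps the maximum defined when there are no
    generators.\<close>
  define n where "n = Max (insert 0 (e ` B))"
  define q where "q = p ^ n"
  have en: "e x \<le> n" if "x \<in> B" for x unfolding n_def using B(1) that by (intro Max_ge) auto
  have add: "(x + y) ^ q = x ^ q + y ^ q" for x y :: 'k
    using p by (intro freshmans_dream'[of _ n]) (auto simp: q_def)
  have q0: "q > 0" using p prime_gt_0_nat by (simp add: q_def)
  have diff: "(x - y) ^ q = x ^ q - y ^ q" for x y :: 'k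
    using add[of "x - y" y] by (simp add: algebra_simps)
  have "subfield_set {x. x ^ q \<in> L1}" unfolding subfield_set_def
    using L1 L1r by (auto intro!: subring_setI simp: diff power_mult_distrib subring_set_closed power_inverse subfield_set_inverse)
  moreover have "range \<iota> \<union> B \<subseteq> {x. x ^ q \<in> L1}"
  proof (intro Un_least subsetI CollectI)
    fix x assume "x \<in> range \<iota>"
    then show "x ^ q \<in> L1" using bL0 sub L1r by (intro subring_set_power) auto
  next
    fix x assume x: "x \<in> B"
    have "q = p ^ e x * p ^ (n - e x)" unfolding q_def using en[OF x] by (simp flip: power_add)
    then have "x ^ q = (x ^ (p ^ e x)) ^ (p ^ (n - e x))" by (simp add: power_mult)
    moreover have "x ^ (p ^ e x) \<in> L1" using x sub by (auto simp: D_def)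
    ultimately show "x ^ q \<in> L1" using L1r by (simp add: subring_set_power)
  qed
  ultimately have "generate_field ring_of_type_algebra (range \<iota> \<union> B) \<subseteq> {x. x ^ q \<in> L1}"
    by (rule generate_field_subset)
  then have root: "x ^ q \<in> L1" for x using B(2) by auto
  show ?thesis by (rule dvr_family_root[OF W1[folded L1_def] q0 add root])
qed

section \<open>Homogeneous prime ideals\<close>

lemma cring_mpol: "cring (mpol_ring A :: 'a::comm_ring_1 mpol ring)"
proof -
  note cl = subring_set_closed[OF subring_set_mpol[of A]]
  have r [simp]: "x \<oplus>\<^bsub>mpol_ring A\<^esub> y = x + y" "x \<otimes>\<^bsub>mpol_ring A\<^esub> y = x * y"
    "\<zero>\<^bsub>mpol_ring A\<^esub> = 0" "\<one>\<^bsub>mpol_ring A\<^esub> = 1" for x y :: "'a mpol"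
    by (auto simp: mpol_ring_def)
  show ?thesis
  proof (rule cringI)
    show "abelian_group (mpol_ring A :: 'a mpol ring)"
    proof (rule abelian_groupI)
      fix x :: "'a mpol" assume "x \<in> carrier (mpol_ring A)"
      then show "\<exists>y\<in>carrier (mpol_ring A). y \<oplus>\<^bsub>mpol_ring A\<^esub> x = \<zero>\<^bsub>mpol_ring A\<^esub>"
        by (intro bexI[of _ "- x"]) (auto simp: cl)
    qed (auto simp: cl add_ac)
    show "Group.comm_monoid (mpol_ring A :: 'a mpol ring)"
      by (rule comm_monoidI) (auto simp: cl mult_ac)
  qed (auto simp: distrib_right)
qed

lemma ideal_mpol_iff: "ideal J (mpol_ring A) \<longleftrightarrow> ideal_in (carrier (mpol_ring A)) J"
  for J :: "'a::comm_ring_1 mpol set"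
proof
  interpret R: cring "mpol_ring A :: 'a mpol ring" by (rule cring_mpol)
  have r [simp]: "x \<oplus>\<^bsub>mpol_ring A\<^esub> y = x + y" "x \<otimes>\<^bsub>mpol_ring A\<^esub> y = x * y"
    "\<zero>\<^bsub>mpol_ring A\<^esub> = 0" "\<one>\<^bsub>mpol_ring A\<^esub> = 1" for x y :: "'a mpol"
    by (auto simp: mpol_ring_def)
  note cl = subring_set_closed[OF subring_set_mpol[of A]]
  have um: "\<ominus>\<^bsub>mpol_ring A\<^esub> x = - x" if "x \<in> carrier (mpol_ring A)" for x :: "'a mpol"
    using R.minus_equality[of "- x" x] that by (simp add: cl)
  show "ideal_in (carrier (mpol_ring A)) J" if "ideal J (mpol_ring A)"
  proof -
    interpret ideal J "mpol_ring A" by fact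
    show ?thesis unfolding ideal_in_def
    proof (intro conjI ballI)
      show "J \<subseteq> carrier (mpol_ring A)" using a_subset .
      show "0 \<in> J" using zero_closed by simp
      fix x y assume "x \<in> J" "y \<in> J"
      then have "- y \<in> J" using a_inv_closed[of y] um[of y] a_subset by auto
      then show "x - y \<in> J" using a_closed[of x "- y"] \<open>x \<in> J\<close> by simp
    next
      fix a x :: "'a mpol" assume "a \<in> carrier (mpol_ring A)" "x \<in> J"
      then show "a * x \<in> J" using I_l_closed[of x a] by simp
    qed
  qed
  show "ideal J (mpol_ring A)" if J: "ideal_in (carrier (mpol_ring A)) J"
  proof (rule idealI)
    show "ring (mpol_ring A :: 'a mpol ring)" by (rule R.ring_axioms)
    show "subgroup J (add_monoid (mpol_ring A))"
    proof (rule group.subgroupI)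
      show "group (add_monoid (mpol_ring A :: 'a mpol ring))" by (rule R.add.group_axioms)
      show "J \<subseteq> carrier (add_monoid (mpol_ring A))" using ideal_inD(1)[OF J] by simp
      show "J \<noteq> {}" using ideal_inD(2)[OF J] by auto
      fix a assume a: "a \<in> J"
      have "inv\<^bsub>add_monoid (mpol_ring A)\<^esub> a = \<ominus>\<^bsub>mpol_ring A\<^esub> a" by (simp add: a_inv_def)
      also have "\<dots> = 0 - a" using um[of a] a ideal_inD(1)[OF J] by auto
      finally show "inv\<^bsub>add_monoid (mpol_ring A)\<^esub> a \<in> J" using ideal_inD(3)[OF J ideal_inD(2)[OF J] a] by simp
      fix b assume "b \<in> J"
      then show "a \<otimes>\<^bsub>add_monoid (mpol_ring A)\<^esub> b \<in> J" using ideal_inD(5)[OF J a] by simp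
    qed
    fix a x :: "'a mpol" assume "a \<in> J" "x \<in> carrier (mpol_ring A)"
    then show "x \<otimes>\<^bsub>mpol_ring A\<^esub> a \<in> J" "a \<otimes>\<^bsub>mpol_ring A\<^esub> x \<in> J"
      using ideal_inD(4)[OF J] by (auto simp: mult.commute[of a x])
  qed
qed

lemma primeideal_mpol_iff:
  "primeideal J (mpol_ring A) \<longleftrightarrow> ideal_in (carrier (mpol_ring A)) J \<and> 1 \<notin> J \<and>
    (\<forall>a\<in>carrier (mpol_ring A). \<forall>b\<in>carrier (mpol_ring A). a * b \<in> J \<longrightarrow> a \<in> J \<or> b \<in> J)"
  for J :: "'a::comm_ring_1 mpol set"
proof
  have r [simp]: "x \<otimes>\<^bsub>mpol_ring A\<^esub> y = x * y" "\<one>\<^bsub>mpol_ring A\<^esub> = 1" for x y :: "'a mpol"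
    by (auto simp: mpol_ring_def)
  show "ideal_in (carrier (mpol_ring A)) J \<and> 1 \<notin> J \<and>
    (\<forall>a\<in>carrier (mpol_ring A). \<forall>b\<in>carrier (mpol_ring A). a * b \<in> J \<longrightarrow> a \<in> J \<or> b \<in> J)"
    if "primeideal J (mpol_ring A)"
  proof -
    interpret primeideal J "mpol_ring A" by fact
    have "1 \<notin> J" using I_notcarr one_imp_carrier by auto
    then show ?thesis using I_prime ideal_axioms by (auto simp: ideal_mpol_iff)
  qed
  assume *: "ideal_in (carrier (mpol_ring A)) J \<and> 1 \<notin> J \<and>
    (\<forall>a\<in>carrier (mpol_ring A). \<forall>b\<in>carrier (mpol_ring A). a * b \<in> J \<longrightarrow> a \<in> J \<or> b \<in> J)"
  show "primeideal J (mpol_ring A)"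
  proof (rule primeidealI)
    show "ideal J (mpol_ring A)" using * by (simp add: ideal_mpol_iff)
    show "cring (mpol_ring A :: 'a mpol ring)" by (rule cring_mpol)
    show "carrier (mpol_ring A) \<noteq> J" using * subring_set_one[OF subring_set_mpol, of A] by auto
  qed (use * in auto)
qed

section \<open>Homogeneous components as coefficients of a polynomial in T\<close>

lemma comm_ring_hom_const_poly: "comm_ring_hom \<phi> \<Longrightarrow> comm_ring_hom (\<lambda>a. [:\<phi> a:])"
proof -
  assume "comm_ring_hom \<phi>"
  then interpret comm_ring_hom \<phi> .
  show ?thesis by unfold_locales (auto simp: hom_distribs one_pCons)
qed

lemma comm_ring_hom_const_mpol: "comm_ring_hom (Poly_Mapping.single 0 :: 'a::comm_ring_1 \<Rightarrow> 'a mpol)"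
  by unfold_locales (auto simp: single_add mult_single)

lemma mpol_eval_const_var: "mpol_eval (Poly_Mapping.single 0) mpol_var f = f"
proof -
  have "mpol_eval (Poly_Mapping.single 0) mpol_var f = (\<Sum>m\<in>Poly_Mapping.keys f. Poly_Mapping.single m (Poly_Mapping.lookup f m))"
    unfolding mpol_eval_def monom_val_def[symmetric] by (simp add: monom_val_mpol_var mult_single)
  then show ?thesis using poly_mapping_sum_single[of f] by simp
qed

text \<open>\<open>X\<^sub>k\<close> is sent to \<open>y k * T\<close>, so that the coefficients in \<open>T\<close> separate the homogeneous components.\<close>

definition graded_eval :: "('a::comm_ring_1 \<Rightarrow> 'b::comm_ring_1) \<Rightarrow> (nat \<Rightarrow> 'b) \<Rightarrow> 'a mpol \<Rightarrow> 'b poly" where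
  "graded_eval \<phi> y f = mpol_eval (\<lambda>a. [:\<phi> a:]) (\<lambda>k. [:0, y k:]) f"

lemma coeff_graded_eval:
  assumes "comm_ring_hom \<phi>"
  shows "coeff (graded_eval \<phi> y f) e = mpol_eval \<phi> y (hcomp e f)"
proof -
  interpret comm_ring_hom \<phi> by fact
  have mv: "monom_val (\<lambda>k. [:0, y k:]) m = monom (monom_val y m) (monom_deg m)" for m
  proof -
    have "monom_val (\<lambda>k. [:0, y k:]) m = monom_val (\<lambda>k. [:0, 1:] * [:y k:]) m" by simp
    also have "\<dots> = [:0, 1:] ^ monom_deg m * monom_val (\<lambda>k. [:y k:]) m" by (rule monom_val_cmult)
    also have "monom_val (\<lambda>k. [:y k:]) m = [:monom_val y m:]"
    proof -
      interpret c: comm_ring_hom "\<lambda>a::'b. [:a:]"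
        by unfold_locales (auto simp: one_pCons)
      show ?thesis unfolding monom_val_def by (simp only: c.hom_prod c.hom_power)
    qed
    finally show ?thesis by (simp add: monom_altdef)
  qed
  have "coeff (graded_eval \<phi> y f) e =
      (\<Sum>m\<in>Poly_Mapping.keys f. if monom_deg m = e then \<phi> (Poly_Mapping.lookup f m) * monom_val y m else 0)"
    unfolding graded_eval_def mpol_eval_def monom_val_def[symmetric] mv
    by (simp add: coeff_sum smult_monom)
  also have "\<dots> = (\<Sum>m\<in>{m\<in>Poly_Mapping.keys f. monom_deg m = e}. \<phi> (Poly_Mapping.lookup f m) * monom_val y m)"
    by (simp add: sum.inter_filter)
  also have "\<dots> = mpol_eval \<phi> y (hcomp e f)"
    unfolding hcomp_def by (simp add: mpol_eval_sum mpol_eval_single)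
  finally show ?thesis .
qed

lemma hcomp_of_homog:
  "homog d f \<Longrightarrow> hcomp e f = (if e = d then f else 0)"
  by (rule poly_mapping_eqI) (auto simp: lookup_hcomp homog_iff in_keys_iff)

context
  fixes \<phi> :: "'a::comm_ring_1 \<Rightarrow> 'b::comm_ring_1"
  assumes \<phi>: "comm_ring_hom \<phi>"
begin

lemma graded_eval_mult: "graded_eval \<phi> y (f * g) = graded_eval \<phi> y f * graded_eval \<phi> y g"
  and graded_eval_diff: "graded_eval \<phi> y (f - g) = graded_eval \<phi> y f - graded_eval \<phi> y g"
  and graded_eval_one: "graded_eval \<phi> y 1 = 1"
  and graded_eval_zero: "graded_eval \<phi> y 0 = 0"
proof -
  interpret c: comm_ring_hom "\<lambda>a. [:\<phi> a:]" by (rule comm_ring_hom_const_poly[OF \<phi>])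
  show "graded_eval \<phi> y (f * g) = graded_eval \<phi> y f * graded_eval \<phi> y g"
    "graded_eval \<phi> y (f - g) = graded_eval \<phi> y f - graded_eval \<phi> y g"
    "graded_eval \<phi> y 1 = 1" "graded_eval \<phi> y 0 = 0"
    unfolding graded_eval_def by (simp_all add: c.mpol_eval_mult c.mpol_eval_diff)
qed

lemma graded_eval_homog:
  assumes "homog d f"
  shows "graded_eval \<phi> y f = monom (mpol_eval \<phi> y f) d"
proof -
  interpret comm_ring_hom \<phi> by (rule \<phi>)
  show ?thesis by (rule poly_eqI) (auto simp: coeff_graded_eval[OF \<phi>] hcomp_of_homog[OF assms])
qed

end

text \<open>Graded evaluation at the variables themselves turns f into the polynomial whose
  coefficients are its homogeneous components; the claim is then the multiplication rule for
  coefficients.\<close>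

lemma hcomp_mult: "hcomp e (f * g) = (\<Sum>i\<le>e. hcomp i f * hcomp (e - i) g)"
proof -
  have h: "hcomp e f = coeff (graded_eval (Poly_Mapping.single 0) mpol_var f) e" for e and f :: "'a mpol"
    by (simp add: coeff_graded_eval[OF comm_ring_hom_const_mpol] mpol_eval_const_var)
  show ?thesis unfolding h graded_eval_mult[OF comm_ring_hom_const_mpol] coeff_mult ..
qed

lemma hcomp_diff: "hcomp e (f - g) = hcomp e f - hcomp e g"
  by (rule poly_mapping_eqI) (auto simp: lookup_hcomp lookup_minus)

lemma ideal_in_sum: "ideal_in A J \<Longrightarrow> (\<And>i. i \<in> S \<Longrightarrow> f i \<in> J) \<Longrightarrow> sum f S \<in> J"
  by (induction S rule: infinite_finite_induct) (auto intro: ideal_inD(2,5))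

text \<open>The condition on components passes to intersections and is easy to check for ideals
  defined by vanishing, unlike generation by homogeneous elements. It follows from generation
  because the elements of J with all components in J form an ideal that contains the
  generators.\<close>

lemma homogeneous_generation_iff:
  fixes J :: "'a::comm_ring_1 mpol set"
  assumes J: "ideal_in (carrier (mpol_ring A)) J"
  shows "J = genideal (mpol_ring A) {f \<in> J. \<exists>d. homog d f} \<longleftrightarrow> (\<forall>f\<in>J. \<forall>e. hcomp e f \<in> J)"
proof
  interpret R: cring "mpol_ring A :: 'a mpol ring" by (rule cring_mpol)
  let ?S = "{f \<in> J. \<exists>d. homog d f}"
  have S: "?S \<subseteq> carrier (mpol_ring A)" using ideal_inD(1)[OF J] by auto
  show "\<forall>f\<in>J. \<forall>e. hcomp e f \<in> J" if eq: "J = genideal (mpol_ring A) ?S"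
  proof -
    define T where "T = {f\<in>J. \<forall>e. hcomp e f \<in> J}"
    have "ideal_in (carrier (mpol_ring A)) T" unfolding ideal_in_def
    proof (intro conjI ballI)
      show "T \<subseteq> carrier (mpol_ring A)" using ideal_inD(1)[OF J] by (auto simp: T_def)
      have "hcomp e 0 = (0 :: 'a mpol)" for e by (simp add: hcomp_def)
      then show "0 \<in> T" using ideal_inD(2)[OF J] by (simp add: T_def)
      fix x y assume "x \<in> T" "y \<in> T"
      then show "x - y \<in> T" using ideal_inD(3)[OF J] by (auto simp: T_def hcomp_diff)
    next
      fix a x :: "'a mpol" assume "a \<in> carrier (mpol_ring A)" "x \<in> T"
      then show "a * x \<in> T" using ideal_inD(4)[OF J]
        by (auto simp: T_def hcomp_mult intro!: ideal_in_sum[OF J] hcomp_in_carrier)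
    qed
    then have "ideal T (mpol_ring A)" by (simp add: ideal_mpol_iff)
    moreover have "?S \<subseteq> T" using ideal_inD(2)[OF J] by (auto simp: T_def hcomp_of_homog)
    ultimately have "genideal (mpol_ring A) ?S \<subseteq> T" by (rule R.genideal_minimal)
    then show ?thesis using eq by (auto simp: T_def)
  qed
  assume h: "\<forall>f\<in>J. \<forall>e. hcomp e f \<in> J"
  show "J = genideal (mpol_ring A) ?S"
  proof
    show "genideal (mpol_ring A) ?S \<subseteq> J"
      by (rule R.genideal_minimal) (use J in \<open>auto simp: ideal_mpol_iff\<close>)
    have G: "ideal_in (carrier (mpol_ring A)) (genideal (mpol_ring A) ?S)"
      using R.genideal_ideal[OF S] by (simp add: ideal_mpol_iff)
    show "J \<subseteq> genideal (mpol_ring A) ?S"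
    proof
      fix f assume f: "f \<in> J"
      obtain D where D: "f = (\<Sum>e\<le>D. hcomp e f)" by (rule sum_hcomp)
      have "hcomp e f \<in> genideal (mpol_ring A) ?S" for e
        using R.genideal_self[OF S] h f homog_hcomp[of e f] by blast
      then have "(\<Sum>e\<le>D. hcomp e f) \<in> genideal (mpol_ring A) ?S" by (intro ideal_in_sum[OF G])
      then show "f \<in> genideal (mpol_ring A) ?S" using D by simp
    qed
  qed
qed

lemma projective_variety_iff:
  "projective_variety n P \<longleftrightarrow> ideal_in (carrier (mpol_ring {..n})) P \<and> 1 \<notin> P \<and>
    (\<forall>a\<in>carrier (mpol_ring {..n}). \<forall>b\<in>carrier (mpol_ring {..n}). a * b \<in> P \<longrightarrow> a \<in> P \<or> b \<in> P) \<and>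
    (\<forall>f\<in>P. \<forall>e. hcomp e f \<in> P) \<and> (\<exists>k\<le>n. mpol_var k \<notin> P)"
  unfolding projective_variety_def primeideal_mpol_iff
  using homogeneous_generation_iff[of "{..n}" P] by blast

section \<open>Finiteness of the set of divisors through a hypersurface\<close>

text \<open>
  An ideal \<open>J\<close> maximal among those lying in infinitely many divisors is the intersection of these
  divisors, hence homogeneous. If \<open>J\<close> is prime, it is itself the only divisor containing it;
  otherwise \<open>a * b \<in> J\<close> with \<open>a, b \<notin> J\<close>, and adjoining \<open>a\<close> or \<open>b\<close> contradicts maximality.
\<close>

lemma finite_irreducible_divisors:
  fixes I :: "'f::field mpol set"
  assumes g: "g \<in> carrier (mpol_ring {..n})" "g \<notin> I" and I: "ideal_in (carrier (mpol_ring {..n})) I"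
  shows "finite {P. irreducible_divisor n I P \<and> g \<in> P}"
proof (rule ccontr)
  assume inf: "infinite {P. irreducible_divisor n I P \<and> g \<in> P}"
  let ?A = "carrier (mpol_ring {..n}) :: 'f mpol set"
  define S where "S = {J. ideal_in ?A J \<and> I \<subset> J \<and> infinite {P. irreducible_divisor n I P \<and> J \<subseteq> P}}"
  have pv: "projective_variety n P" "I \<subset> P" "ideal_in ?A P" if "irreducible_divisor n I P" for P
    using that unfolding irreducible_divisor_def projective_variety_iff by auto
  \<comment> \<open>The intersection of infinitely many divisors through x is an ideal above I,
    strictly because of x, and all these divisors contain it.\<close>
  have inter: "\<Inter>T \<in> S" if T: "T \<subseteq> {P. irreducible_divisor n I P}" "infinite T" "x \<in> \<Inter>T" "x \<notin> I" for T x
  proof -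
    obtain P0 where P0: "P0 \<in> T" using T(2) by (metis ex_in_conv finite.emptyI)
    have id: "ideal_in ?A P" if "P \<in> T" for P using T(1) pv that by blast
    have "ideal_in ?A (\<Inter>T)" unfolding ideal_in_def
    proof (intro conjI ballI InterI)
      show "\<Inter>T \<subseteq> ?A" using P0 ideal_inD(1)[OF id[OF P0]] by blast
      show "0 \<in> P" if "P \<in> T" for P using ideal_inD(2)[OF id[OF that]] .
      show "x - y \<in> P" if "x \<in> \<Inter>T" "y \<in> \<Inter>T" "P \<in> T" for x y P
        using that by (intro ideal_inD(3)[OF id[OF that(3)]]) simp_all
      show "a * x \<in> P" if "a \<in> ?A" "x \<in> \<Inter>T" "P \<in> T" for a x P
        using that by (intro ideal_inD(4)[OF id[OF that(3)]]) simp_all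
    qed
    moreover have "I \<subset> \<Inter>T" using T pv(2) by blast
    moreover have "T \<subseteq> {P. irreducible_divisor n I P \<and> \<Inter>T \<subseteq> P}" using T(1) by blast
    ultimately show ?thesis using T(2) finite_subset unfolding S_def by blast
  qed
  have N: "noetherian_set ?A" using noetherian_mpol[of "Suc n"] by (simp add: lessThan_Suc_atMost)
  have "\<Inter>{P. irreducible_divisor n I P \<and> g \<in> P} \<in> S" by (rule inter[of _ g]) (use inf g in auto)
  then have "\<exists>J\<in>S. \<forall>J'\<in>S. J \<subseteq> J' \<longrightarrow> J' = J"
    by (rule noetherian_set_maximal[OF N, rotated]) (simp add: S_def)
  then obtain J where J: "J \<in> S" and max: "\<And>J'. J' \<in> S \<Longrightarrow> J \<subseteq> J' \<Longrightarrow> J' = J" by metis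
  have JI: "ideal_in ?A J" "I \<subset> J" "infinite {P. irreducible_divisor n I P \<and> J \<subseteq> P}" using J by (auto simp: S_def)
  obtain x where x: "x \<in> J" "x \<notin> I" using JI(2) by blast
  \<comment> \<open>By maximality of J, every infinite subfamily of the divisors through J still
    meets exactly in J. With \<open>a \<in> P\<close> or \<open>b \<in> P\<close> for Q, this puts a
    or b into J.\<close>
  have split: "\<Inter>{P. irreducible_divisor n I P \<and> J \<subseteq> P \<and> Q P} = J" if "infinite {P. irreducible_divisor n I P \<and> J \<subseteq> P \<and> Q P}" for Q
    by (rule max, rule inter[OF _ that, of x]) (use x in auto)
  have eqJ: "J = \<Inter>{P. irreducible_divisor n I P \<and> J \<subseteq> P}" using split[of "\<lambda>_. True"] JI by simp
  have hom: "hcomp e f \<in> J" if f: "f \<in> J" for f e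
  proof -
    have "hcomp e f \<in> P" if "irreducible_divisor n I P" "J \<subseteq> P" for P
      using pv(1)[OF that(1)] that(2) f unfolding projective_variety_iff by blast
    then show ?thesis by (subst eqJ) blast
  qed
  show False
  proof (cases "\<forall>a\<in>?A. \<forall>b\<in>?A. a * b \<in> J \<longrightarrow> a \<in> J \<or> b \<in> J")
    case True
    have ne: "{P. irreducible_divisor n I P \<and> J \<subseteq> P} \<noteq> {}" using JI(3) by (metis finite.emptyI)
    then obtain P where P: "irreducible_divisor n I P" "J \<subseteq> P" by blast
    have J1: "1 \<notin> J" "\<exists>k\<le>n. mpol_var k \<notin> J" using pv(1)[OF P(1)] P(2) unfolding projective_variety_iff by blast+
    have "projective_variety n J" unfolding projective_variety_iff
      by (intro conjI JI(1) J1 True ballI allI hom)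
    \<comment> \<open>J is now a projective variety strictly above I, so no divisor can lie strictly
      above J.\<close>
    then have "P' = J" if "irreducible_divisor n I P'" "J \<subseteq> P'" for P'
      using that JI(2) unfolding irreducible_divisor_def by blast
    then have "{P. irreducible_divisor n I P \<and> J \<subseteq> P} \<subseteq> {J}" by blast
    then show False using JI(3) finite_subset by blast
  next
    case False
    then obtain a b where ab: "a \<in> ?A" "b \<in> ?A" "a * b \<in> J" "a \<notin> J" "b \<notin> J" by blast
    have "{P. irreducible_divisor n I P \<and> J \<subseteq> P} \<subseteq> {P. irreducible_divisor n I P \<and> J \<subseteq> P \<and> a \<in> P} \<union> {P. irreducible_divisor n I P \<and> J \<subseteq> P \<and> b \<in> P}"
    proof
      fix P assume P: "P \<in> {P. irreducible_divisor n I P \<and> J \<subseteq> P}"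
      then have "a \<in> P \<or> b \<in> P" using pv(1)[of P] ab unfolding projective_variety_iff by blast
      then show "P \<in> {P. irreducible_divisor n I P \<and> J \<subseteq> P \<and> a \<in> P} \<union> {P. irreducible_divisor n I P \<and> J \<subseteq> P \<and> b \<in> P}"
        using P by blast
    qed
    from infinite_super[OF this JI(3)]
    consider "infinite {P. irreducible_divisor n I P \<and> J \<subseteq> P \<and> a \<in> P}" | "infinite {P. irreducible_divisor n I P \<and> J \<subseteq> P \<and> b \<in> P}"
      unfolding finite_Un by argo
    then show False
    proof cases
      case 1
      have "a \<in> \<Inter>{P. irreducible_divisor n I P \<and> J \<subseteq> P \<and> a \<in> P}" by blast
      then show False using split[OF 1] ab by simp
    next
      case 2
      have "b \<in> \<Inter>{P. irreducible_divisor n I P \<and> J \<subseteq> P \<and> b \<in> P}" by blast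
      then show False using split[OF 2] ab by simp
    qed
  qed
qed

section \<open>Discrete valuations, their rings, and the poles of a function\<close>

lemma discrete_valuation_inverse:
  assumes v: "discrete_valuation v" and x: "x \<noteq> 0"
  shows "v (inverse x) = - v x"
proof -
  have m: "v (a * b) = v a + v b" if "a \<noteq> 0" "b \<noteq> 0" for a b using v that by (auto simp: discrete_valuation_def)
  have "v 1 = 0" using m[of 1 1] by simp
  then show ?thesis using m[of x "inverse x"] x by simp
qed

lemma discrete_valuation_power:
  assumes v: "discrete_valuation v" and x: "x \<noteq> 0"
  shows "v (x ^ i) = int i * v x"
proof (induction i)
  case 0
  have "v (1 * 1) = v 1 + v 1" using v unfolding discrete_valuation_def by (metis one_neq_zero)
  then show ?case by simp
next
  case (Suc i)
  have "v (x * x ^ i) = v x + v (x ^ i)" using v x unfolding discrete_valuation_def by auto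
  then show ?case using Suc by (simp add: algebra_simps)
qed

lemma discrete_valuation_powi:
  assumes v: "discrete_valuation v" and x: "x \<noteq> 0"
  shows "v (x powi i) = i * v x"
proof (cases "i \<ge> 0")
  case True
  then show ?thesis using discrete_valuation_power[OF v x, of "nat i"] by (simp add: power_int_def)
next
  case False
  then show ?thesis using discrete_valuation_power[OF v, of "inverse x" "nat (- i)"] discrete_valuation_inverse[OF v x] x
    by (simp add: power_int_def)
qed

text \<open>The ring determines the units, so w vanishes wherever v does and equals w(a) v for an
  element a with v(a) = 1. Since w is normalized too, w(a) divides 1, and it is not
  negative.\<close>

lemma valuation_ring_determines:
  fixes v w :: "'k::field place"
  assumes v: "discrete_valuation v" and w: "discrete_valuation w" and eq: "valuation_ring v = valuation_ring w"
  shows "v = w"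
proof
  have sgn: "v x \<ge> 0 \<longleftrightarrow> w x \<ge> 0" if "x \<noteq> 0" for x
    using eq that by (auto simp: valuation_ring_def set_eq_iff)
  have zero: "v x = 0 \<longleftrightarrow> w x = 0" if "x \<noteq> 0" for x
    using sgn[OF that] sgn[of "inverse x"] that discrete_valuation_inverse[OF v that] discrete_valuation_inverse[OF w that]
    by auto
  obtain a where a: "a \<noteq> 0" "v a = 1" using v by (auto simp: discrete_valuation_def)
  have m: "w (x * y) = w x + w y" "v (x * y) = v x + v y" if "x \<noteq> 0" "y \<noteq> 0" for x y
    using v w that by (auto simp: discrete_valuation_def)
  have wv: "w x = v x * w a" if x: "x \<noteq> 0" for x
  proof -
    have "v (x * a powi (- v x)) = 0" using a x m(2)[of x "a powi (- v x)"] discrete_valuation_powi[OF v a(1), of "- v x"] by simp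
    then have "w (x * a powi (- v x)) = 0" using zero a x by simp
    then show ?thesis using a x m(1)[of x "a powi (- v x)"] discrete_valuation_powi[OF w a(1), of "- v x"] by simp
  qed
  obtain b where b: "b \<noteq> 0" "w b = 1" using w by (auto simp: discrete_valuation_def)
  have "v b * w a = 1" using wv[OF b(1)] b by simp
  moreover have "w a \<ge> 0" using sgn[OF a(1)] a by simp
  ultimately have "w a = 1" by (auto simp: zmult_eq_1_iff)
  fix x show "v x = w x"
    using wv[of x] \<open>w a = 1\<close> v w by (cases "x = 0") (auto simp: discrete_valuation_def)
qed

lemma is_function_field_generic_ratio:
  assumes "is_function_field \<iota> n I z"
  obtains d f g where "f \<in> carrier (mpol_ring {..n})" "g \<in> carrier (mpol_ring {..n})" "homog d f" "homog d g"
    "g \<notin> I" "x = mpol_eval \<iota> z f / mpol_eval \<iota> z g"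
  using assms unfolding is_function_field_def by metis

text \<open>For a fixed representation x = f / g with g outside I, a place can be a pole only if its
  divisor P contains g, and a place is determined by its divisor.\<close>

theorem finite_poles:
  fixes \<iota> :: "'f::field \<Rightarrow> 'k::field"
  assumes I: "projective_variety n I" and ff: "is_function_field \<iota> n I z"
  shows "finite {v \<in> divisor_places \<iota> n I z. x \<notin> valuation_ring v}"
proof -
  obtain d f g where fg: "f \<in> carrier (mpol_ring {..n})" "g \<in> carrier (mpol_ring {..n})" "homog d f" "homog d g"
    "g \<notin> I" "x = mpol_eval \<iota> z f / mpol_eval \<iota> z g" by (rule is_function_field_generic_ratio[OF ff])
  define D where "D = {P. irreducible_divisor n I P \<and> g \<in> P}"
  have "finite D" unfolding D_def using I fg by (intro finite_irreducible_divisors) (auto simp: projective_variety_iff)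
  define V where "V = {v \<in> divisor_places \<iota> n I z. x \<notin> valuation_ring v}"
  have "\<exists>P. P \<in> D \<and> valuation_ring v = local_ring_at \<iota> n z P" if v: "v \<in> V" for v
  proof -
    obtain P where P: "irreducible_divisor n I P" "valuation_ring v = local_ring_at \<iota> n z P"
      using v unfolding V_def divisor_places_def by blast
    have "g \<in> P"
    proof (rule ccontr)
      assume "g \<notin> P"
      then have "x \<in> local_ring_at \<iota> n z P" unfolding local_ring_at_def using fg by blast
      then show False using v P by (simp add: V_def)
    qed
    then show ?thesis using P by (auto simp: D_def)
  qed
  then obtain c where c: "\<And>v. v \<in> V \<Longrightarrow> c v \<in> D \<and> valuation_ring v = local_ring_at \<iota> n z (c v)" by metis
  have "inj_on c V"
  proof (rule inj_onI)
    fix v w assume vw: "v \<in> V" "w \<in> V" "c v = c w"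
    then have "valuation_ring v = valuation_ring w" using c by metis
    moreover have "discrete_valuation v" "discrete_valuation w" using vw by (auto simp: V_def divisor_places_def)
    ultimately show "v = w" using valuation_ring_determines by blast
  qed
  moreover have "c ` V \<subseteq> D" using c by blast
  ultimately have "finite V" using \<open>finite D\<close> by (meson inj_on_finite)
  then show ?thesis by (simp add: V_def)
qed

section \<open>The center of a discrete valuation ring on a projective variety\<close>

text \<open>The case \<open>x = 0\<close> is separate because \<open>inverse 0 = 0\<close>.\<close>

definition max_ideal :: "'a::field set \<Rightarrow> 'a set" where
  "max_ideal R = {x\<in>R. x = 0 \<or> inverse x \<notin> R}"

lemma max_ideal_eq:
  assumes R: "dvr R \<pi>"
  shows "max_ideal R = (\<lambda>y. \<pi> * y) ` R"
proof
  note Rr = dvr_subring[OF R]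
  show "max_ideal R \<subseteq> (\<lambda>y. \<pi> * y) ` R"
  proof
    fix x assume "x \<in> max_ideal R"
    then have "x \<in> R" "x = 0 \<or> inverse x \<notin> R" by (auto simp: max_ideal_def)
    then obtain y where "y \<in> R" "x = \<pi> * y" by (rule dvr_nonunit_factor[OF R])
    then show "x \<in> (\<lambda>y. \<pi> * y) ` R" by blast
  qed
  show "(\<lambda>y. \<pi> * y) ` R \<subseteq> max_ideal R"
  proof
    fix x assume "x \<in> (\<lambda>y. \<pi> * y) ` R"
    then obtain y where y: "y \<in> R" "x = \<pi> * y" by blast
    have "x \<in> R" using y R by (simp add: subring_set_mult dvr_subring dvr_uniformizer_in)
    moreover have "inverse x \<notin> R" if "x \<noteq> 0"
    proof
      assume "inverse x \<in> R"
      then have "inverse x * y \<in> R" using y Rr by (simp add: subring_set_mult)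
      moreover have "inverse x * y = inverse \<pi>" using that y by (simp add: field_simps)
      ultimately show False using dvr_uniformizer_nonunit[OF R] by simp
    qed
    ultimately show "x \<in> max_ideal R" by (auto simp: max_ideal_def)
  qed
qed

lemma max_ideal_ideal:
  assumes R: "dvr R \<pi>"
  shows "ideal_in R (max_ideal R)"
proof -
  note Rr = dvr_subring[OF R]
  note cl = subring_set_closed[OF Rr]
  show ?thesis unfolding ideal_in_def
  proof (intro conjI ballI)
    show "max_ideal R \<subseteq> R" "0 \<in> max_ideal R" by (auto simp: max_ideal_def cl)
    fix a b
    { assume "a \<in> max_ideal R" "b \<in> max_ideal R"
      then obtain x y where "a = \<pi> * x" "x \<in> R" "b = \<pi> * y" "y \<in> R" unfolding max_ideal_eq[OF R] by blast
      then show "a - b \<in> max_ideal R" unfolding max_ideal_eq[OF R]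
        by (intro image_eqI[of _ _ "x - y"]) (auto simp: cl algebra_simps) }
    { assume "a \<in> R" "b \<in> max_ideal R"
      then obtain y where "b = \<pi> * y" "y \<in> R" unfolding max_ideal_eq[OF R] by blast
      then show "a * b \<in> max_ideal R" unfolding max_ideal_eq[OF R] using \<open>a \<in> R\<close>
        by (intro image_eqI[of _ _ "a * y"]) (auto simp: cl algebra_simps) }
  qed
qed

lemma max_ideal_prime:
  assumes R: "dvr R \<pi>" and xy: "x \<in> R" "y \<in> R" "x * y \<in> max_ideal R"
  shows "x \<in> max_ideal R \<or> y \<in> max_ideal R"
proof (rule ccontr)
  assume "\<not> ?thesis"
  then have "x \<noteq> 0" "y \<noteq> 0" "inverse x \<in> R" "inverse y \<in> R" using xy by (auto simp: max_ideal_def)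
  then have "inverse (x * y) \<in> R" "x * y \<noteq> 0" using dvr_subring[OF R] by (auto simp: subring_set_mult)
  then show False using xy by (simp add: max_ideal_def)
qed

text \<open>Gauss's argument: multiply the lowest coefficients outside the maximal ideal; all other
  contributions to that coefficient of the product lie in the ideal.\<close>

lemma coeffs_in_max_ideal_prime:
  assumes R: "dvr R \<pi>" and fg: "coeffs_in R f" "coeffs_in R g" "coeffs_in (max_ideal R) (f * g)"
  shows "coeffs_in (max_ideal R) f \<or> coeffs_in (max_ideal R) g"
proof (rule ccontr)
  let ?M = "max_ideal R"
  note M = max_ideal_ideal[OF R]
  assume "\<not> ?thesis"
  then have e: "\<exists>i. coeff f i \<notin> ?M" "\<exists>j. coeff g j \<notin> ?M" by (auto simp: coeffs_in_def)
  define i where "i = (LEAST i. coeff f i \<notin> ?M)"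
  define j where "j = (LEAST j. coeff g j \<notin> ?M)"
  have i: "coeff f i \<notin> ?M" "\<And>k. k < i \<Longrightarrow> coeff f k \<in> ?M"
    unfolding i_def using LeastI_ex[OF e(1)] not_less_Least by blast+
  have j: "coeff g j \<notin> ?M" "\<And>k. k < j \<Longrightarrow> coeff g k \<in> ?M"
    unfolding j_def using LeastI_ex[OF e(2)] not_less_Least by blast+
  have fR: "coeff f k \<in> R" and gR: "coeff g k \<in> R" for k using fg by (auto simp: coeffs_in_def)
  have "(\<Sum>k\<in>{..i + j} - {i}. coeff f k * coeff g (i + j - k)) \<in> ?M"
  proof (rule ideal_in_sum[OF M])
    fix k assume k: "k \<in> {..i + j} - {i}"
    show "coeff f k * coeff g (i + j - k) \<in> ?M"
    proof (cases "k < i")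
      case True
      then show ?thesis using ideal_inD(4)[OF M gR i(2)] by (simp add: mult.commute)
    next
      case False
      then have "i + j - k < j" using k by auto
      then show ?thesis using ideal_inD(4)[OF M fR j(2)] by simp
    qed
  qed
  moreover have "coeff (f * g) (i + j) \<in> ?M" using fg by (simp add: coeffs_in_def)
  moreover have "coeff (f * g) (i + j) = coeff f i * coeff g j +
      (\<Sum>k\<in>{..i + j} - {i}. coeff f k * coeff g (i + j - k))"
    unfolding coeff_mult by (subst sum.remove[of _ i]) auto
  ultimately have "coeff f i * coeff g j \<in> ?M"
    using ideal_inD(3)[OF M] by (metis add_diff_cancel_right')
  then show False using max_ideal_prime[OF R fR gR] i j by blast
qed

text \<open>The coefficients of the graded evaluation are the values at y of the homogeneous
  components of f. Testing each of them, instead of the single value f(y), makes the ideal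
  homogeneous; for homogeneous f it amounts to the vanishing of f(y) modulo the maximal
  ideal.\<close>

definition center :: "('f::field \<Rightarrow> 'k::field) \<Rightarrow> nat \<Rightarrow> (nat \<Rightarrow> 'k) \<Rightarrow> 'k set \<Rightarrow> 'f mpol set" where
  "center \<iota> n y R = {f\<in>carrier (mpol_ring {..n}). coeffs_in (max_ideal R) (graded_eval \<iota> y f)}"

context
  fixes \<iota> :: "'f::field \<Rightarrow> 'k::field" and n k0 :: nat and I :: "'f mpol set" and z y :: "nat \<Rightarrow> 'k"
  assumes \<iota>: "field_hom \<iota>" and I: "projective_variety n I" and ff: "is_function_field \<iota> n I z"
    and k0: "k0 \<le> n" "z k0 \<noteq> 0" and y: "y = (\<lambda>k. inverse (z k0) * z k)"
begin

interpretation i: field_hom \<iota> by (rule \<iota>)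

lemma constants_hom: "comm_ring_hom \<iota>" ..

text \<open>In the chart where coordinate k0 is 1, multiplying by \<open>mpol_var k0\<close> raises
  the degree of a homogeneous polynomial without changing its value at y. This is how degrees are
  matched below.\<close>

lemma y_at_k0: "y k0 = 1"
  using k0 by (simp add: y)

lemma eval_y_homog: "homog d f \<Longrightarrow> mpol_eval \<iota> y f = inverse (z k0) ^ d * mpol_eval \<iota> z f"
  unfolding y by (rule i.mpol_eval_cmult_homog)

lemma eval_y_ratio:
  assumes "homog d f" "homog d g"
  shows "mpol_eval \<iota> z f / mpol_eval \<iota> z g = mpol_eval \<iota> y f / mpol_eval \<iota> y g"
  using k0 by (simp add: eval_y_homog[OF assms(1)] eval_y_homog[OF assms(2)])

lemma homog_in_I_iff:
  assumes "f \<in> carrier (mpol_ring {..n})" "homog d f"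
  shows "f \<in> I \<longleftrightarrow> mpol_eval \<iota> y f = 0"
  using ff assms k0 eval_y_homog[OF assms(2)] unfolding is_function_field_def by auto

text \<open>Two homogeneous polynomials can be padded to a common degree by powers of
  \<open>mpol_var k0\<close>, so their values at y are closed under differences and already exhaust
  the ring generated by the constants and y.\<close>

lemma homogeneous_values:
  assumes "a \<in> rgen (range \<iota> \<union> y ` {..n})"
  shows "\<exists>f\<in>carrier (mpol_ring {..n}). \<exists>d. homog d f \<and> a = mpol_eval \<iota> y f"
proof -
  define T where "T = {mpol_eval \<iota> y f | f d. f \<in> carrier (mpol_ring {..n}) \<and> homog d f}"
  note cl = subring_set_closed[OF subring_set_mpol]
  have pad: "mpol_eval \<iota> y (f * mpol_var k0 ^ e) = mpol_eval \<iota> y f" "homog (d + e) (f * mpol_var k0 ^ e)"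
    "f * mpol_var k0 ^ e \<in> carrier (mpol_ring {..n})" if "f \<in> carrier (mpol_ring {..n})" "homog d f" for f d e
    using that homog_mult[OF that(2) homog_power[OF homog_var, of e k0]] k0
    by (auto simp: i.mpol_eval_mult i.mpol_eval_power y_at_k0 intro!: cl mpol_var_in_carrier)
  have "rgen (range \<iota> \<union> y ` {..n}) \<subseteq> T"
  proof (rule rgen_minimal)
    show "subring_set T"
    proof (rule subring_setI)
      show "1 \<in> T" unfolding T_def using homog_one by (intro CollectI exI[of _ 1] exI[of _ 0]) (auto simp: cl)
      fix a b assume "a \<in> T" "b \<in> T"
      then obtain f d g e where fg: "a = mpol_eval \<iota> y f" "f \<in> carrier (mpol_ring {..n})" "homog d f"
        "b = mpol_eval \<iota> y g" "g \<in> carrier (mpol_ring {..n})" "homog e g" unfolding T_def by blast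
      show "a * b \<in> T" unfolding T_def using fg homog_mult[OF fg(3,6)]
        by (intro CollectI exI[of _ "f * g"] exI[of _ "d + e"]) (auto simp: cl i.mpol_eval_mult)
      have "homog (d + e) (f * mpol_var k0 ^ e - g * mpol_var k0 ^ d)"
        using pad(2)[OF fg(2,3), of e] pad(2)[OF fg(5,6), of d] by (intro homog_diff) (auto simp: add.commute)
      then show "a - b \<in> T" unfolding T_def using fg pad[OF fg(2,3), of e] pad[OF fg(5,6), of d]
        by (intro CollectI exI[of _ "f * mpol_var k0 ^ e - g * mpol_var k0 ^ d"] exI[of _ "d + e"])
          (auto simp: cl i.mpol_eval_diff)
    qed
    show "range \<iota> \<union> y ` {..n} \<subseteq> T"
    proof (intro Un_least image_subsetI)
      fix c show "\<iota> c \<in> T" unfolding T_def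
        by (intro CollectI exI[of _ "Poly_Mapping.single 0 c"] exI[of _ 0]) (auto simp: mpol_const_in_carrier homog_const)
      fix k assume "k \<in> {..n}"
      then show "y k \<in> T" unfolding T_def
        by (intro CollectI exI[of _ "mpol_var k"] exI[of _ 1]) (auto simp: mpol_var_in_carrier homog_var[simplified])
    qed
  qed
  then show ?thesis using assms unfolding T_def by blast
qed

lemma homogeneous_value_degree:
  assumes "f \<in> carrier (mpol_ring {..n})" "homog d f"
  shows "\<exists>f'\<in>carrier (mpol_ring {..n}). homog (d + e) f' \<and> mpol_eval \<iota> y f' = mpol_eval \<iota> y f"
  using assms homog_mult[OF assms(2) homog_power[OF homog_var, of e k0]] k0
  by (intro bexI[of _ "f * mpol_var k0 ^ e"])
    (auto simp: i.mpol_eval_mult i.mpol_eval_power y_at_k0 intro!: subring_set_closed[OF subring_set_mpol] mpol_var_in_carrier)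

context
  fixes R :: "'k set" and \<pi> :: 'k
  assumes R: "dvr R \<pi>" and val: "\<And>x. x \<in> R \<or> inverse x \<in> R"
    and FR: "range \<iota> \<subseteq> R" and yR: "y ` {..n} \<subseteq> R" and loc: "R \<subseteq> loc (range \<iota> \<union> y ` {..n}) R"
begin

lemma subring_R: "subring_set R"
  by (rule dvr_subring[OF R])

lemma eval_y_in_R: "f \<in> carrier (mpol_ring {..n}) \<Longrightarrow> mpol_eval \<iota> y f \<in> R"
  unfolding mpol_eval_def using FR yR by (intro subring_set_closed[OF subring_R]) (auto simp: mpol_carrier_iff subset_iff image_subset_iff)

lemma graded_eval_in_R: "f \<in> carrier (mpol_ring {..n}) \<Longrightarrow> coeffs_in R (graded_eval \<iota> y f)"
  unfolding coeffs_in_def coeff_graded_eval[OF constants_hom] by (auto intro!: eval_y_in_R hcomp_in_carrier)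

lemma one_notin_max_ideal: "1 \<notin> max_ideal R"
  using subring_R by (simp add: max_ideal_def subring_set_one)

lemma homog_in_center_iff:
  assumes "f \<in> carrier (mpol_ring {..n})" "homog d f"
  shows "f \<in> center \<iota> n y R \<longleftrightarrow> mpol_eval \<iota> y f \<in> max_ideal R"
  using assms ideal_inD(2)[OF max_ideal_ideal[OF R]]
  by (auto simp: center_def graded_eval_homog[OF constants_hom assms(2)] coeffs_in_def)

lemma center_variety: "projective_variety n (center \<iota> n y R)"
  unfolding projective_variety_iff
proof (intro conjI ballI impI allI)
  note M = ideal_inD[OF max_ideal_ideal[OF R]]
  note cl = subring_set_closed[OF subring_set_mpol]
  let ?P = "center \<iota> n y R"
  show "ideal_in (carrier (mpol_ring {..n})) ?P" unfolding ideal_in_def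
  proof (intro conjI ballI)
    show "?P \<subseteq> carrier (mpol_ring {..n})" by (auto simp: center_def)
    show "0 \<in> ?P" using M(2) by (simp add: center_def cl graded_eval_zero[OF constants_hom] coeffs_in_def)
    fix f g :: "'f mpol"
    { assume "f \<in> ?P" "g \<in> ?P"
      then show "f - g \<in> ?P" using M(3) by (simp add: center_def cl graded_eval_diff[OF constants_hom] coeffs_in_def) }
    { assume f: "f \<in> carrier (mpol_ring {..n})" and g: "g \<in> ?P"
      have "coeffs_in (max_ideal R) (graded_eval \<iota> y f * graded_eval \<iota> y g)"
        unfolding coeffs_in_def coeff_mult
        using graded_eval_in_R[OF f] g by (intro allI ideal_in_sum[OF max_ideal_ideal[OF R]] M(4)) (auto simp: center_def coeffs_in_def)
      then show "f * g \<in> ?P" using f g by (simp add: center_def cl graded_eval_mult[OF constants_hom]) }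
  qed
  have "\<not> coeffs_in (max_ideal R) 1"
  proof
    assume "coeffs_in (max_ideal R) 1"
    then have "coeff (1 :: 'k poly) 0 \<in> max_ideal R" unfolding coeffs_in_def ..
    then show False using one_notin_max_ideal by simp
  qed
  then show "1 \<notin> ?P" by (simp add: center_def graded_eval_one[OF constants_hom])
  fix f g :: "'f mpol" assume f: "f \<in> carrier (mpol_ring {..n})" and g: "g \<in> carrier (mpol_ring {..n})" and "f * g \<in> ?P"
  then show "f \<in> ?P \<or> g \<in> ?P"
    using coeffs_in_max_ideal_prime[OF R graded_eval_in_R[OF f] graded_eval_in_R[OF g]]
    by (auto simp: center_def graded_eval_mult[OF constants_hom])
next
  fix f e assume f: "f \<in> center \<iota> n y R"
  then have fc: "f \<in> carrier (mpol_ring {..n})" by (simp add: center_def)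
  have "mpol_eval \<iota> y (hcomp e f) \<in> max_ideal R"
    using f by (simp add: center_def coeffs_in_def coeff_graded_eval[OF constants_hom])
  then show "hcomp e f \<in> center \<iota> n y R"
    using homog_in_center_iff[OF hcomp_in_carrier[OF fc] homog_hcomp] by simp
next
  show "\<exists>k\<le>n. mpol_var k \<notin> center \<iota> n y R"
    using k0 homog_in_center_iff[OF mpol_var_in_carrier homog_var, of k0] y_at_k0 one_notin_max_ideal
    by (intro exI[of _ k0]) simp
qed

text \<open>Numerator and denominator over the coordinate ring are values of homogeneous
  polynomials, and padding gives them the equal degrees that \<open>local_ring_at\<close> demands. A
  homogeneous denominator avoids the center exactly when its value is a unit of R.\<close>

lemma local_ring_at_center: "local_ring_at \<iota> n z (center \<iota> n y R) = R"
proof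
  show "local_ring_at \<iota> n z (center \<iota> n y R) \<subseteq> R"
  proof
    fix x assume "x \<in> local_ring_at \<iota> n z (center \<iota> n y R)"
    then obtain d f g where fg: "f \<in> carrier (mpol_ring {..n})" "g \<in> carrier (mpol_ring {..n})" "homog d f" "homog d g"
      "g \<notin> center \<iota> n y R" "x = mpol_eval \<iota> z f / mpol_eval \<iota> z g" unfolding local_ring_at_def by blast
    have "mpol_eval \<iota> y g \<notin> max_ideal R" using fg homog_in_center_iff by blast
    then have "inverse (mpol_eval \<iota> y g) \<in> R" using eval_y_in_R[OF fg(2)] by (simp add: max_ideal_def)
    then show "x \<in> R" using eval_y_in_R[OF fg(1)] eval_y_ratio[OF fg(3,4)] fg(6) subring_R
      by (simp add: divide_inverse subring_set_mult)
  qed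
  show "R \<subseteq> local_ring_at \<iota> n z (center \<iota> n y R)"
  proof
    fix x assume "x \<in> R"
    then obtain a h where ah: "x = a / h" "a \<in> rgen (range \<iota> \<union> y ` {..n})" "h \<in> rgen (range \<iota> \<union> y ` {..n})" "h \<noteq> 0" "inverse h \<in> R"
      using loc unfolding loc_def by blast
    obtain f d where f: "f \<in> carrier (mpol_ring {..n})" "homog d f" "a = mpol_eval \<iota> y f"
      using homogeneous_values[OF ah(2)] by blast
    obtain g e where g: "g \<in> carrier (mpol_ring {..n})" "homog e g" "h = mpol_eval \<iota> y g"
      using homogeneous_values[OF ah(3)] by blast
    obtain f' where f': "f' \<in> carrier (mpol_ring {..n})" "homog (d + e) f'" "a = mpol_eval \<iota> y f'"
      using homogeneous_value_degree[OF f(1,2), of e] f(3) by auto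
    obtain g' where g': "g' \<in> carrier (mpol_ring {..n})" "homog (d + e) g'" "h = mpol_eval \<iota> y g'"
      using homogeneous_value_degree[OF g(1,2), of d] g(3) by (auto simp: add.commute)
    have "g' \<notin> center \<iota> n y R" using homog_in_center_iff[OF g'(1,2)] g'(3) ah(4,5) by (simp add: max_ideal_def)
    moreover have "x = mpol_eval \<iota> z f' / mpol_eval \<iota> z g'"
      using eval_y_ratio[OF f'(2) g'(2)] f'(3) g'(3) ah(1) by simp
    ultimately show "x \<in> local_ring_at \<iota> n z (center \<iota> n y R)"
      unfolding local_ring_at_def using f' g' by blast
  qed
qed

lemma I_subset_center: "I \<subset> center \<iota> n y R"
proof
  have Iid: "ideal_in (carrier (mpol_ring {..n})) I" and Ih: "\<And>f e. f \<in> I \<Longrightarrow> hcomp e f \<in> I"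
    using I by (auto simp: projective_variety_iff)
  show "I \<subseteq> center \<iota> n y R"
  proof
    fix f assume f: "f \<in> I"
    then have fc: "f \<in> carrier (mpol_ring {..n})" using ideal_inD(1)[OF Iid] by blast
    have "mpol_eval \<iota> y (hcomp e f) = 0" for e
      using homog_in_I_iff[OF hcomp_in_carrier[OF fc] homog_hcomp] Ih[OF f] by blast
    then show "f \<in> center \<iota> n y R" using fc ideal_inD(2)[OF max_ideal_ideal[OF R]]
      by (simp add: center_def coeffs_in_def coeff_graded_eval[OF constants_hom])
  qed
  \<comment> \<open>Strictness: the numerator of \<pi> is a nonzero value in the maximal
    ideal.\<close>
  obtain a h where ah: "\<pi> = a / h" "a \<in> rgen (range \<iota> \<union> y ` {..n})" "h \<in> rgen (range \<iota> \<union> y ` {..n})" "h \<noteq> 0" "inverse h \<in> R"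
    using loc dvr_uniformizer_in[OF R] unfolding loc_def by blast
  obtain f d where f: "f \<in> carrier (mpol_ring {..n})" "homog d f" "a = mpol_eval \<iota> y f"
    using homogeneous_values[OF ah(2)] by blast
  have hR: "h \<in> R" using ah(3) rgen_minimal[OF subring_R, of "range \<iota> \<union> y ` {..n}"] FR yR by auto
  have "a = \<pi> * h" using ah by simp
  then have "a \<in> max_ideal R" "a \<noteq> 0" using hR ah(4) dvr_uniformizer_nonzero[OF R] by (auto simp: max_ideal_eq[OF R])
  then show "I \<noteq> center \<iota> n y R" using homog_in_I_iff[OF f(1,2)] homog_in_center_iff[OF f(1,2)] f(3) by auto
qed

text \<open>Codimension one without dimension theory. Take f in Q outside I and g in the center
  outside Q. As g(y) is divisible by \<pi>, some power of it is a multiple of f(y) in R. Written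
  with a denominator H whose value is a unit, this says that g^m H - f F, after padding, lies in I.
  Hence g^m H is in Q although neither g nor H is.\<close>

lemma center_minimal:
  assumes Q: "projective_variety n Q" "I \<subset> Q" "Q \<subset> center \<iota> n y R"
  shows False
proof -
  let ?A = "carrier (mpol_ring {..n}) :: 'f mpol set"
  have Qid: "ideal_in ?A Q" and Qh: "\<And>f e. f \<in> Q \<Longrightarrow> hcomp e f \<in> Q"
    and Qp: "\<And>a b. a \<in> ?A \<Longrightarrow> b \<in> ?A \<Longrightarrow> a * b \<in> Q \<Longrightarrow> a \<in> Q \<or> b \<in> Q" and Q1: "1 \<notin> Q"
    using Q(1) by (auto simp: projective_variety_iff)
  have Iid: "ideal_in ?A I" using I by (simp add: projective_variety_iff)
  have Pid: "ideal_in ?A (center \<iota> n y R)" and Ph: "\<And>f e. f \<in> center \<iota> n y R \<Longrightarrow> hcomp e f \<in> center \<iota> n y R"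
    using center_variety by (auto simp: projective_variety_iff)
  \<comment> \<open>Both inclusions are witnessed by homogeneous elements, as otherwise all
    components, and with them their sum, would lie in the smaller ideal.\<close>
  have hsep: "\<exists>f\<in>J'. f \<notin> J \<and> (\<exists>d. homog d f)"
    if J: "ideal_in ?A J" "J \<subset> J'" "\<And>f e. f \<in> J' \<Longrightarrow> hcomp e f \<in> J'" for J J'
  proof (rule ccontr)
    assume con: "\<not> ?thesis"
    obtain f where f: "f \<in> J'" "f \<notin> J" using J by blast
    obtain D where D: "f = (\<Sum>e\<le>D. hcomp e f)" by (rule sum_hcomp)
    have "hcomp e f \<in> J" for e using con J(3)[OF f(1)] homog_hcomp by blast
    then have "(\<Sum>e\<le>D. hcomp e f) \<in> J" by (intro ideal_in_sum[OF J(1)])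
    then show False using D f(2) by simp
  qed
  obtain f d where f: "f \<in> Q" "f \<notin> I" "homog d f" using hsep[OF Iid Q(2) Qh] by blast
  obtain g e where g: "g \<in> center \<iota> n y R" "g \<notin> Q" "homog e g" using hsep[OF Qid Q(3) Ph] by blast
  have fA: "f \<in> ?A" and gA: "g \<in> ?A" using f g ideal_inD(1)[OF Qid] ideal_inD(1)[OF Pid] by auto
  define a where "a = mpol_eval \<iota> y f"
  define b where "b = mpol_eval \<iota> y g"
  have a0: "a \<noteq> 0" using homog_in_I_iff[OF fA f(3)] f(2) by (simp add: a_def)
  have aR: "a \<in> R" unfolding a_def by (rule eval_y_in_R[OF fA])
  have bM: "b \<in> max_ideal R" using homog_in_center_iff[OF gA g(3)] g(1) by (simp add: b_def)
  \<comment> \<open>m is the order of f(y), the exponent that makes g(y)^m divisible by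
    f(y).\<close>
  obtain m u where mu: "a = u * \<pi> ^ m" "u \<in> R" "inverse u \<in> R" using dvr_decomp[OF R aR a0] by blast
  obtain b' where b': "b' \<in> R" "b = \<pi> * b'" using bM unfolding max_ideal_eq[OF R] by blast
  define w where "w = inverse u * b' ^ m"
  have wR: "w \<in> R" using mu b' subring_R by (simp add: w_def subring_set_closed)
  have ba: "b ^ m = a * w" using mu a0 by (auto simp: w_def b' power_mult_distrib)
  obtain c h where ch: "w = c / h" "c \<in> rgen (range \<iota> \<union> y ` {..n})" "h \<in> rgen (range \<iota> \<union> y ` {..n})" "h \<noteq> 0" "inverse h \<in> R"
    using loc wR unfolding loc_def by blast
  obtain F d1 where F: "F \<in> ?A" "homog d1 F" "c = mpol_eval \<iota> y F" using homogeneous_values[OF ch(2)] by blast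
  obtain H d2 where H: "H \<in> ?A" "homog d2 H" "h = mpol_eval \<iota> y H" using homogeneous_values[OF ch(3)] by blast
  note cl = subring_set_closed[OF subring_set_mpol]
  let ?X = "mpol_var k0 :: 'f mpol"
  have xA: "?X \<in> ?A" using k0 by (simp add: mpol_var_in_carrier)
  \<comment> \<open>Both products are padded to the common degree m e + d2 + d + d1, so that their
    difference is homogeneous.\<close>
  define U where "U = (g ^ m * H) * ?X ^ (d + d1)"
  define U' where "U' = (f * F) * ?X ^ (m * e + d2)"
  have hU: "homog (m * e + d2 + (d + d1)) U"
    using homog_mult[OF homog_mult[OF homog_power[OF g(3), of m] H(2)] homog_power[OF homog_var, of "d + d1" k0]]
    by (simp add: U_def)
  have hU': "homog (m * e + d2 + (d + d1)) U'"
    using homog_mult[OF homog_mult[OF f(3) F(2)] homog_power[OF homog_var, of "m * e + d2" k0]]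
    by (simp add: U'_def add_ac)
  have UA: "U \<in> ?A" "U' \<in> ?A" unfolding U_def U'_def using fA gA F(1) H(1) xA by (auto intro!: cl)
  have "mpol_eval \<iota> y (U - U') = b ^ m * h - a * c"
    by (simp add: U_def U'_def i.mpol_eval_diff i.mpol_eval_mult i.mpol_eval_power y_at_k0 F(3) H(3) a_def b_def)
  also have "\<dots> = 0" using ba ch(1,4) by simp
  finally have "U - U' \<in> I" using homog_in_I_iff[OF _ homog_diff[OF hU hU']] UA cl by blast
  then have "U - U' \<in> Q" using Q(2) by blast
  moreover have "U' \<in> Q"
  proof -
    have "(F * ?X ^ (m * e + d2)) * f \<in> Q" using f(1) F(1) xA by (intro ideal_inD(4)[OF Qid]) (auto intro!: cl)
    then show ?thesis by (simp add: U'_def mult_ac)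
  qed
  ultimately have "(U - U') + U' \<in> Q" by (rule ideal_inD(5)[OF Qid])
  then have "U \<in> Q" by simp
  have pw: "p ^ i \<notin> Q" if p: "p \<in> ?A" "p \<notin> Q" for p i
  proof (induction i)
    case (Suc i)
    then show ?case using Qp[OF p(1) cl(7)[OF p(1)], of i] p(2) by auto
  qed (use Q1 in simp)
  have "H \<notin> Q"
  proof
    assume "H \<in> Q"
    then have "h \<in> max_ideal R" using Q(3) homog_in_center_iff[OF H(1,2)] H(3) by auto
    then show False using ch by (simp add: max_ideal_def)
  qed
  moreover have "?X \<notin> Q"
  proof
    assume "?X \<in> Q"
    then have "mpol_eval \<iota> y ?X \<in> max_ideal R" using Q(3) homog_in_center_iff[OF xA homog_var] by auto
    then show False using y_at_k0 one_notin_max_ideal by simp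
  qed
  ultimately have "g ^ m * H \<notin> Q" "?X ^ (d + d1) \<notin> Q"
    using Qp[OF cl(7)[OF gA] H(1), of m] pw[OF gA g(2), of m] pw[OF xA, of "d + d1"] by auto
  moreover have "g ^ m * H \<in> ?A" "?X ^ (d + d1) \<in> ?A" using gA H(1) xA by (auto intro!: cl)
  ultimately show False using \<open>U \<in> Q\<close> Qp unfolding U_def by blast
qed

lemma center_irreducible_divisor: "irreducible_divisor n I (center \<iota> n y R)"
  unfolding irreducible_divisor_def using center_variety I_subset_center center_minimal by blast

end

end

section \<open>Normalized valuations of the constructed rings, and infinitely many divisor
  places\<close>

lemma discrete_valuation_dvr_val:
  fixes R :: "'a::field set"
  assumes R: "dvr R \<pi>" and val: "\<And>x. x \<in> R \<or> inverse x \<in> R"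
  shows "discrete_valuation (dvr_val R \<pi>)" "valuation_ring (dvr_val R \<pi>) = R"
proof -
  note Rr = dvr_subring[OF R]
  let ?v = "dvr_val R \<pi>"
  have m: "?v (x * y) = ?v x + ?v y" if "x \<noteq> 0" "y \<noteq> 0" for x y using that val by (intro dvr_val_mult[OF R]) auto
  have nn: "?v x \<ge> 0 \<longleftrightarrow> x \<in> R" if "x \<noteq> 0" for x using that val by (intro dvr_val_nonneg_iff[OF R]) auto
  \<comment> \<open>x + y = x (1 + y / x), and 1 + y / x lies in R when x has the smaller
    order.\<close>
  have add: "?v x \<le> ?v (x + y)" if "x \<noteq> 0" "y \<noteq> 0" "x + y \<noteq> 0" "?v x \<le> ?v y" for x y
  proof -
    have "?v y = ?v (x * (y / x))" using that by simp
    also have "\<dots> = ?v x + ?v (y / x)" using that by (intro m) auto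
    finally have "?v (y / x) \<ge> 0" using that by simp
    then have "y / x \<in> R" using nn[of "y / x"] that by simp
    then have "1 + y / x \<in> R" using Rr by (simp add: subring_set_closed)
    moreover have xy: "1 + y / x \<noteq> 0" "x + y = x * (1 + y / x)" using that by (auto simp: field_simps)
    ultimately have "?v (1 + y / x) \<ge> 0" using nn by blast
    then show ?thesis using m[OF that(1) xy(1)] xy(2) by simp
  qed
  show "discrete_valuation ?v" unfolding discrete_valuation_def
  proof (intro conjI allI impI)
    show "?v 0 = 0" by (simp add: dvr_val_def)
    show "\<exists>x. x \<noteq> 0 \<and> ?v x = 1" using dvr_val_uniformizer[OF R] dvr_uniformizer_nonzero[OF R] by blast
    fix x y :: 'a assume xy: "x \<noteq> 0 \<and> y \<noteq> 0 \<and> x + y \<noteq> 0"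
    show "min (?v x) (?v y) \<le> ?v (x + y)"
      using add[of x y] add[of y x] xy by (cases "?v x \<le> ?v y") (auto simp: add.commute min_def)
  qed (use m in auto)
  show "valuation_ring ?v = R"
  proof (rule Set.set_eqI)
    fix x show "x \<in> valuation_ring ?v \<longleftrightarrow> x \<in> R"
      using nn[of x] subring_set_zero[OF Rr] by (auto simp: valuation_ring_def)
  qed
qed

text \<open>The family comes with its own generators C, each a fraction over the ring of the
  coordinates y. For almost all R the coordinates are integral and the finitely many denominators
  are units; R is then a localization of the coordinate ring and the local ring at its
  center.\<close>

theorem infinite_divisor_places:
  fixes j :: "'p::prime_card mod_ring poly fract \<Rightarrow> 'f::field" and \<iota> :: "'f \<Rightarrow> 'k::field"
  assumes j: "field_hom j" "finite_field_extension j" and \<iota>: "field_hom \<iota>" "finitely_generated_extension \<iota>"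
    and d: "has_transcendence_degree \<iota> d" "d \<ge> 1"
    and I: "projective_variety n I" and ff: "is_function_field \<iota> n I z"
  shows "infinite (divisor_places \<iota> n I z)"
proof -
  obtain W C where W: "dvr_family (range \<iota>) (UNIV :: 'k set) W C"
    using ex_dvr_family_function_field[OF j \<iota> d] by blast
  obtain k0 where k0: "k0 \<le> n" "mpol_var k0 \<notin> I" using I by (auto simp: projective_variety_iff)
  interpret i: field_hom \<iota> by (rule \<iota>)
  have z0: "z k0 \<noteq> 0"
  proof -
    have "mpol_var k0 \<in> carrier (mpol_ring {..n})" using k0 by (simp add: mpol_var_in_carrier)
    then have "mpol_eval \<iota> z (mpol_var k0) \<noteq> 0" using ff k0 homog_var unfolding is_function_field_def by blast
    then show ?thesis by simp
  qed
  define y where "y = (\<lambda>k. inverse (z k0) * z k)"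
  let ?S = "range \<iota> \<union> y ` {..n}"
  have frac: "\<exists>a\<in>rgen ?S. \<exists>h\<in>rgen ?S. x = a / h \<and> h \<noteq> 0" for x
  proof -
    obtain d f g where fg: "f \<in> carrier (mpol_ring {..n})" "g \<in> carrier (mpol_ring {..n})" "homog d f" "homog d g"
      "g \<notin> I" "x = mpol_eval \<iota> z f / mpol_eval \<iota> z g" by (rule is_function_field_generic_ratio[OF ff])
    note geo = \<iota>(1) I ff k0(1) z0 y_def
    have "mpol_eval \<iota> y f \<in> rgen ?S" if "f \<in> carrier (mpol_ring {..n})" for f
      unfolding mpol_eval_def using that
      by (intro subring_set_closed[OF subring_set_rgen] rgen_incl) (auto simp: mpol_carrier_iff subset_iff)
    then show ?thesis using fg eval_y_ratio[OF geo fg(3,4)] homog_in_I_iff[OF geo fg(2,4)] by metis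
  qed
  have "\<forall>x. \<exists>h. h \<in> rgen ?S \<and> x * h \<in> rgen ?S \<and> h \<noteq> 0"
  proof
    fix x
    obtain a h where "a \<in> rgen ?S" "h \<in> rgen ?S" "x = a / h" "h \<noteq> 0" using frac by blast
    then show "\<exists>h. h \<in> rgen ?S \<and> x * h \<in> rgen ?S \<and> h \<noteq> 0" by (intro exI[of _ h]) auto
  qed
  then obtain h where h: "\<And>x. h x \<in> rgen ?S" "\<And>x. x * h x \<in> rgen ?S" "\<And>x. h x \<noteq> 0" by metis
  define W0 where "W0 = {R\<in>W. y ` {..n} \<subseteq> R \<and> (\<forall>c\<in>C. inverse (h c) \<in> R)}"
  have "finite (W - W0)"
  proof (rule finite_subset)
    show "W - W0 \<subseteq> (\<Union>k\<le>n. {R\<in>W. y k \<notin> R}) \<union> (\<Union>c\<in>C. {R\<in>W. inverse (h c) \<notin> R})" by (auto simp: W0_def)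
    show "finite \<dots>" using dvr_family_finite_gen[OF W] dvr_family_cofinite[OF W] by auto
  qed
  then have infW0: "infinite W0" using dvr_family_infinite[OF W] by (metis finite_Diff2)
  have "\<exists>v. v \<in> divisor_places \<iota> n I z \<and> valuation_ring v = R" if R: "R \<in> W0" for R
  proof -
    have RW: "R \<in> W" and yR: "y ` {..n} \<subseteq> R" and hR: "\<And>c. c \<in> C \<Longrightarrow> inverse (h c) \<in> R" using R by (auto simp: W0_def)
    obtain \<pi> where \<pi>: "dvr R \<pi>" using dvr_familyD(2)[OF W RW] by blast
    note Rr = dvr_subring[OF \<pi>]
    have val: "x \<in> R \<or> inverse x \<in> R" for x using dvr_familyD(6)[OF W RW] by simp
    have "C \<subseteq> loc ?S R"
    proof
      fix c assume c: "c \<in> C"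
      show "c \<in> loc ?S R" unfolding loc_def using h[of c] hR[OF c]
        by (intro CollectI exI[of _ "c * h c"] exI[of _ "h c"]) auto
    qed
    then have "R \<subseteq> loc ?S R" using loc_trans[OF Rr Rr order_refl] dvr_familyD(5)[OF W RW] by blast
    note geo = \<iota>(1) I ff k0(1) z0 y_def \<pi> val dvr_familyD(3)[OF W RW] yR this
    have "irreducible_divisor n I (center \<iota> n y R)" "local_ring_at \<iota> n z (center \<iota> n y R) = R"
      by (rule center_irreducible_divisor[OF geo], rule local_ring_at_center[OF geo])
    then show ?thesis using discrete_valuation_dvr_val[OF \<pi> val] unfolding divisor_places_def by auto
  qed
  then have "W0 \<subseteq> valuation_ring ` divisor_places \<iota> n I z" by blast
  then show ?thesis using infW0 finite_subset by blast
qed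

section \<open>Completions\<close>

lemma vabs_0 [simp]: "vabs v 0 = 0"
  by (simp add: vabs_def)

lemma vabs_nonneg [simp]: "vabs v x \<ge> 0"
  by (simp add: vabs_def)

lemma vabs_eq_0_iff [simp]: "vabs v x = 0 \<longleftrightarrow> x = 0"
  by (simp add: vabs_def)

lemma vabs_le_iff:
  assumes "x \<noteq> 0"
  shows "vabs v x \<le> 2 powi k \<longleftrightarrow> - k \<le> v x" "vabs v x < 2 powi k \<longleftrightarrow> - k < v x"
  using assms power_int_increasing[of "- v x" k "2::real"] power_int_strict_increasing[of "- v x" k "2::real"]
    power_int_increasing[of k "- v x" "2::real"] power_int_strict_increasing[of k "- v x" "2::real"]
  by (auto simp: vabs_def linorder_not_le linorder_not_less) (smt (verit))+

lemma vabs_le_1_iff: "vabs v x \<le> 1 \<longleftrightarrow> x \<in> valuation_ring v"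
  using vabs_le_iff(1)[of x v 0] by (cases "x = 0") (auto simp: valuation_ring_def)

definition cauchy_seqs :: "'k::field place \<Rightarrow> (nat \<Rightarrow> 'k) set" where
  "cauchy_seqs v = {s. \<forall>e>0. \<exists>N. \<forall>m\<ge>N. \<forall>n\<ge>N. vabs v (s m - s n) < e}"

definition cclass :: "'k::field place \<Rightarrow> (nat \<Rightarrow> 'k) \<Rightarrow> (nat \<Rightarrow> 'k) set" where
  "cclass v s = null_sequences v +>\<^bsub>cauchy_ring v\<^esub> s"

context
  fixes v :: "'k::field place"
  assumes v: "discrete_valuation v"
begin

lemma discrete_valuation_mult: "x \<noteq> 0 \<Longrightarrow> y \<noteq> 0 \<Longrightarrow> v (x * y) = v x + v y"
  using v by (simp add: discrete_valuation_def)

lemma discrete_valuation_uminus: "v (- x) = v x"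
proof (cases "x = 0")
  case False
  have "v ((-1) * (-1)) = v (-1) + v (-1)" by (rule discrete_valuation_mult) auto
  moreover have "v (1 * 1) = v 1 + v 1" by (rule discrete_valuation_mult) auto
  ultimately have "v (-1) = 0" by simp
  then show ?thesis using discrete_valuation_mult[of "-1" x] False by simp
qed auto

lemma vabs_mult: "vabs v (x * y) = vabs v x * vabs v y"
  by (cases "x = 0 \<or> y = 0") (auto simp: vabs_def discrete_valuation_mult simp flip: power_int_add)

lemma vabs_uminus: "vabs v (- x) = vabs v x"
  by (simp add: vabs_def discrete_valuation_uminus)

lemma vabs_minus_commute: "vabs v (x - y) = vabs v (y - x)"
  using vabs_uminus[of "x - y"] by simp

lemma vabs_1: "vabs v 1 = 1"
  using vabs_mult[of 1 1] by simp

lemma vabs_add_le_max: "vabs v (x + y) \<le> max (vabs v x) (vabs v y)"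
proof (cases "x = 0 \<or> y = 0 \<or> x + y = 0")
  case False
  then have "min (v x) (v y) \<le> v (x + y)" using v by (simp add: discrete_valuation_def)
  then have "- v (x + y) \<le> - v x \<or> - v (x + y) \<le> - v y" by linarith
  then show ?thesis using False by (auto simp: vabs_def le_max_iff_disj intro: power_int_increasing)
qed (auto simp: le_max_iff_disj)

lemma vabs_add_le: "vabs v (x + y) \<le> vabs v x + vabs v y"
  using vabs_add_le_max[of x y] vabs_nonneg[of v x] vabs_nonneg[of v y] by linarith

lemma vabs_diff_abs_le: "\<bar>vabs v x - vabs v y\<bar> \<le> vabs v (x - y)"
  using vabs_add_le[of "x - y" y] vabs_add_le[of "y - x" x] vabs_minus_commute[of x y] by (simp add: abs_le_iff)

lemma cauchy_ring_simps [simp]: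
  "carrier (cauchy_ring v) = cauchy_seqs v"
  "s \<otimes>\<^bsub>cauchy_ring v\<^esub> t = (\<lambda>n. s n * t n)" "s \<oplus>\<^bsub>cauchy_ring v\<^esub> t = (\<lambda>n. s n + t n)"
  "\<one>\<^bsub>cauchy_ring v\<^esub> = (\<lambda>n. 1)" "\<zero>\<^bsub>cauchy_ring v\<^esub> = (\<lambda>n. 0)"
  by (auto simp: cauchy_ring_def cauchy_seqs_def)

lemma cauchy_seqs_const: "(\<lambda>n. x) \<in> cauchy_seqs v"
  by (simp add: cauchy_seqs_def)

lemma cauchy_seqsD:
  assumes "s \<in> cauchy_seqs v" "e > 0"
  obtains N where "\<And>m n. m \<ge> N \<Longrightarrow> n \<ge> N \<Longrightarrow> vabs v (s m - s n) < e"
  using assms unfolding cauchy_seqs_def by blast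

lemma cauchy_seqs_add:
  assumes "s \<in> cauchy_seqs v" "t \<in> cauchy_seqs v"
  shows "(\<lambda>n. s n + t n) \<in> cauchy_seqs v"
  unfolding cauchy_seqs_def
proof (intro CollectI allI impI)
  fix e :: real assume "e > 0"
  obtain N where N: "\<And>m n. m \<ge> N \<Longrightarrow> n \<ge> N \<Longrightarrow> vabs v (s m - s n) < e"
    using cauchy_seqsD[OF assms(1) \<open>e > 0\<close>] by blast
  obtain M where M: "\<And>m n. m \<ge> M \<Longrightarrow> n \<ge> M \<Longrightarrow> vabs v (t m - t n) < e"
    using cauchy_seqsD[OF assms(2) \<open>e > 0\<close>] by blast
  have "vabs v (s m + t m - (s n + t n)) < e" if "m \<ge> max N M" "n \<ge> max N M" for m n
  proof -
    have "vabs v (s m + t m - (s n + t n)) \<le> max (vabs v (s m - s n)) (vabs v (t m - t n))"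
      using vabs_add_le_max[of "s m - s n" "t m - t n"] by (simp add: algebra_simps)
    then show ?thesis using N[of m n] M[of m n] that by simp
  qed
  then show "\<exists>N. \<forall>m\<ge>N. \<forall>n\<ge>N. vabs v (s m + t m - (s n + t n)) < e" by blast
qed

lemma cauchy_seqs_uminus:
  assumes "s \<in> cauchy_seqs v"
  shows "(\<lambda>n. - s n) \<in> cauchy_seqs v"
proof -
  have "vabs v (- s m - - s n) = vabs v (s m - s n)" for m n using vabs_minus_commute[of "s n" "s m"] by simp
  then show ?thesis using assms by (simp add: cauchy_seqs_def)
qed

lemma cauchy_seqs_bounded:
  assumes "s \<in> cauchy_seqs v"
  shows "\<exists>B>0. \<forall>n. vabs v (s n) \<le> B"
proof -
  obtain N where N: "\<And>m n. m \<ge> N \<Longrightarrow> n \<ge> N \<Longrightarrow> vabs v (s m - s n) < 1"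
    using cauchy_seqsD[OF assms, of 1] by auto
  define B where "B = Max (insert 1 ((\<lambda>n. vabs v (s n)) ` {..N})) + 1"
  have B1: "vabs v (s n) \<le> B - 1" if "n \<le> N" for n unfolding B_def add_diff_cancel_right' using that by (intro Max_ge) auto
  have "B \<ge> 1 + 1" unfolding B_def by (intro add_right_mono Max_ge) auto
  moreover have "vabs v (s n) \<le> B" for n
  proof (cases "n \<le> N")
    case True then show ?thesis using B1[OF True] by simp
  next
    case False
    have "vabs v (s n) \<le> vabs v (s n - s N) + vabs v (s N)" using vabs_add_le[of "s n - s N" "s N"] by simp
    then show ?thesis using N[of n N] False B1[of N] by simp
  qed
  ultimately show ?thesis by (intro exI[of _ B]) simp
qed

lemma cauchy_seqs_mult:
  assumes "s \<in> cauchy_seqs v" "t \<in> cauchy_seqs v"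
  shows "(\<lambda>n. s n * t n) \<in> cauchy_seqs v"
  unfolding cauchy_seqs_def
proof (intro CollectI allI impI)
  fix e :: real assume e: "e > 0"
  obtain B where B: "B > 0" "\<And>n. vabs v (s n) \<le> B" using cauchy_seqs_bounded[OF assms(1)] by blast
  obtain C where C: "C > 0" "\<And>n. vabs v (t n) \<le> C" using cauchy_seqs_bounded[OF assms(2)] by blast
  obtain N where N: "\<And>m n. m \<ge> N \<Longrightarrow> n \<ge> N \<Longrightarrow> vabs v (s m - s n) < e / C"
    using cauchy_seqsD[OF assms(1), of "e / C"] e C by auto
  obtain M where M: "\<And>m n. m \<ge> M \<Longrightarrow> n \<ge> M \<Longrightarrow> vabs v (t m - t n) < e / B"
    using cauchy_seqsD[OF assms(2), of "e / B"] e B by auto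
  have "vabs v (s m * t m - s n * t n) < e" if mn: "m \<ge> max N M" "n \<ge> max N M" for m n
  proof -
    have "s m * t m - s n * t n = s m * (t m - t n) + (s m - s n) * t n" by (simp add: algebra_simps)
    then have "vabs v (s m * t m - s n * t n) \<le> max (vabs v (s m) * vabs v (t m - t n)) (vabs v (s m - s n) * vabs v (t n))"
      using vabs_add_le_max[of "s m * (t m - t n)" "(s m - s n) * t n"] by (simp add: vabs_mult)
    moreover have "vabs v (s m) * vabs v (t m - t n) \<le> B * vabs v (t m - t n)"
      using B by (intro mult_right_mono) auto
    moreover have "B * vabs v (t m - t n) < e" using M[of m n] mn B by (simp add: field_simps)
    moreover have "vabs v (s m - s n) * vabs v (t n) \<le> vabs v (s m - s n) * C"
      using C by (intro mult_left_mono) auto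
    moreover have "vabs v (s m - s n) * C < e" using N[of m n] mn C by (simp add: field_simps)
    ultimately show ?thesis by linarith
  qed
  then show "\<exists>N. \<forall>m\<ge>N. \<forall>n\<ge>N. vabs v (s m * t m - s n * t n) < e" by blast
qed

lemma cring_cauchy: "cring (cauchy_ring v)"
proof (rule cringI)
  show "abelian_group (cauchy_ring v)"
  proof (rule abelian_groupI)
    fix s assume "s \<in> carrier (cauchy_ring v)"
    then show "\<exists>t\<in>carrier (cauchy_ring v). t \<oplus>\<^bsub>cauchy_ring v\<^esub> s = \<zero>\<^bsub>cauchy_ring v\<^esub>"
      by (intro bexI[of _ "\<lambda>n. - s n"]) (auto simp: cauchy_seqs_uminus)
  qed (auto simp: cauchy_seqs_add cauchy_seqs_const add_ac)
  show "Group.comm_monoid (cauchy_ring v)"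
    by (rule comm_monoidI) (auto simp: cauchy_seqs_mult cauchy_seqs_const mult_ac)
qed (auto simp: distrib_right)

lemma cauchy_uminus: "s \<in> cauchy_seqs v \<Longrightarrow> \<ominus>\<^bsub>cauchy_ring v\<^esub> s = (\<lambda>n. - s n)"
proof -
  interpret C: cring "cauchy_ring v" by (rule cring_cauchy)
  assume "s \<in> cauchy_seqs v"
  then show ?thesis using C.minus_equality[of "\<lambda>n. - s n" s] by (simp add: cauchy_seqs_uminus)
qed

lemma cauchy_minus: "s \<in> cauchy_seqs v \<Longrightarrow> t \<in> cauchy_seqs v \<Longrightarrow> s \<ominus>\<^bsub>cauchy_ring v\<^esub> t = (\<lambda>n. s n - t n)"
  by (simp add: a_minus_def cauchy_uminus)

lemma null_subset_cauchy: "null_sequences v \<subseteq> cauchy_seqs v"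
proof
  fix s assume "s \<in> null_sequences v"
  then have s: "(\<lambda>n. vabs v (s n)) \<longlonglongrightarrow> 0" by (simp add: null_sequences_def)
  show "s \<in> cauchy_seqs v" unfolding cauchy_seqs_def
  proof (intro CollectI allI impI)
    fix e :: real assume "e > 0"
    then obtain N where N: "\<And>n. n \<ge> N \<Longrightarrow> vabs v (s n) < e" using LIMSEQ_D[OF s \<open>e > 0\<close>] by auto
    have "vabs v (s m - s n) < e" if "m \<ge> N" "n \<ge> N" for m n
      using vabs_add_le_max[of "s m" "- s n"] N[OF that(1)] N[OF that(2)] by (simp add: vabs_uminus)
    then show "\<exists>N. \<forall>m\<ge>N. \<forall>n\<ge>N. vabs v (s m - s n) < e" by blast
  qed
qed

lemma null_mult:
  assumes "s \<in> cauchy_seqs v" "t \<in> null_sequences v"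
  shows "(\<lambda>n. s n * t n) \<in> null_sequences v"
proof -
  obtain B where B: "B > 0" "\<And>n. vabs v (s n) \<le> B" using cauchy_seqs_bounded[OF assms(1)] by blast
  have "(\<lambda>n. B * vabs v (t n)) \<longlonglongrightarrow> 0" using assms(2) by (auto simp: null_sequences_def intro: tendsto_mult_right_zero)
  then have "(\<lambda>n. vabs v (s n * t n)) \<longlonglongrightarrow> 0"
    by (rule Lim_null_comparison[rotated]) (simp add: vabs_mult B mult_right_mono)
  then show ?thesis by (simp add: null_sequences_def)
qed

lemma ideal_null: "ideal (null_sequences v) (cauchy_ring v)"
proof (rule idealI)
  interpret C: cring "cauchy_ring v" by (rule cring_cauchy)
  show "ring (cauchy_ring v)" by (rule C.ring_axioms)
  show "subgroup (null_sequences v) (add_monoid (cauchy_ring v))"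
  proof (rule group.subgroupI)
    show "group (add_monoid (cauchy_ring v))" by (rule C.add.group_axioms)
    show "null_sequences v \<subseteq> carrier (add_monoid (cauchy_ring v))" using null_subset_cauchy by simp
    have "(\<lambda>n. 0) \<in> null_sequences v" by (simp add: null_sequences_def)
    then show "null_sequences v \<noteq> {}" by blast
    fix a assume a: "a \<in> null_sequences v"
    have "inv\<^bsub>add_monoid (cauchy_ring v)\<^esub> a = \<ominus>\<^bsub>cauchy_ring v\<^esub> a" by (simp add: a_inv_def)
    also have "\<dots> = (\<lambda>n. - a n)" using a null_subset_cauchy by (intro cauchy_uminus) auto
    finally show "inv\<^bsub>add_monoid (cauchy_ring v)\<^esub> a \<in> null_sequences v"
      using a by (simp add: null_sequences_def vabs_uminus)
    fix b assume b: "b \<in> null_sequences v"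
    have "(\<lambda>n. vabs v (a n) + vabs v (b n)) \<longlonglongrightarrow> 0 + 0"
      using a b by (intro tendsto_add) (auto simp: null_sequences_def)
    then have lim: "(\<lambda>n. vabs v (a n) + vabs v (b n)) \<longlonglongrightarrow> 0" by simp
    have "(\<lambda>n. vabs v (a n + b n)) \<longlonglongrightarrow> 0"
      by (rule Lim_null_comparison[OF _ lim]) (simp add: vabs_add_le)
    then show "a \<otimes>\<^bsub>add_monoid (cauchy_ring v)\<^esub> b \<in> null_sequences v" by (simp add: null_sequences_def)
  qed
  fix a x assume "a \<in> null_sequences v" "x \<in> carrier (cauchy_ring v)"
  then show "x \<otimes>\<^bsub>cauchy_ring v\<^esub> a \<in> null_sequences v" "a \<otimes>\<^bsub>cauchy_ring v\<^esub> x \<in> null_sequences v"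
    using null_mult[of x a] by (auto simp: mult.commute)
qed

lemma cring_completion: "cring (completion v)"
  unfolding completion_def by (rule ideal.quotient_is_cring[OF ideal_null cring_cauchy])

lemma cclass_hom: "ring_hom_cring (cauchy_ring v) (completion v) (cclass v)"
  unfolding completion_def cclass_def[abs_def] by (rule ideal.rcos_ring_hom_cring[OF ideal_null cring_cauchy])

lemma cclass_carrier: "s \<in> cauchy_seqs v \<Longrightarrow> cclass v s \<in> carrier (completion v)"
proof -
  interpret h: ring_hom_cring "cauchy_ring v" "completion v" "cclass v" by (rule cclass_hom)
  show "s \<in> cauchy_seqs v \<Longrightarrow> cclass v s \<in> carrier (completion v)" using h.hom_closed[of s] by simp
qed

lemma cclass_surj:
  assumes "a \<in> carrier (completion v)"
  obtains s where "s \<in> cauchy_seqs v" "a = cclass v s"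
  using assms unfolding completion_def FactRing_def A_RCOSETS_def' by (auto simp: cclass_def)

lemma cclass_add: "s \<in> cauchy_seqs v \<Longrightarrow> t \<in> cauchy_seqs v \<Longrightarrow> cclass v s \<oplus>\<^bsub>completion v\<^esub> cclass v t = cclass v (\<lambda>n. s n + t n)"
  and cclass_mult: "s \<in> cauchy_seqs v \<Longrightarrow> t \<in> cauchy_seqs v \<Longrightarrow> cclass v s \<otimes>\<^bsub>completion v\<^esub> cclass v t = cclass v (\<lambda>n. s n * t n)"
  and cclass_minus: "s \<in> cauchy_seqs v \<Longrightarrow> t \<in> cauchy_seqs v \<Longrightarrow> cclass v s \<ominus>\<^bsub>completion v\<^esub> cclass v t = cclass v (\<lambda>n. s n - t n)"
  and cclass_one: "cclass v (\<lambda>n. 1) = \<one>\<^bsub>completion v\<^esub>"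
  and cclass_zero: "cclass v (\<lambda>n. 0) = \<zero>\<^bsub>completion v\<^esub>"
proof -
  interpret h: ring_hom_cring "cauchy_ring v" "completion v" "cclass v" by (rule cclass_hom)
  show "s \<in> cauchy_seqs v \<Longrightarrow> t \<in> cauchy_seqs v \<Longrightarrow> cclass v s \<oplus>\<^bsub>completion v\<^esub> cclass v t = cclass v (\<lambda>n. s n + t n)"
    "s \<in> cauchy_seqs v \<Longrightarrow> t \<in> cauchy_seqs v \<Longrightarrow> cclass v s \<otimes>\<^bsub>completion v\<^esub> cclass v t = cclass v (\<lambda>n. s n * t n)"
    using h.hom_add[of s t] h.hom_mult[of s t] by simp_all
  show "s \<in> cauchy_seqs v \<Longrightarrow> t \<in> cauchy_seqs v \<Longrightarrow> cclass v s \<ominus>\<^bsub>completion v\<^esub> cclass v t = cclass v (\<lambda>n. s n - t n)"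
    using h.hom_sub[of s t] by (simp add: cauchy_minus)
  show "cclass v (\<lambda>n. 1) = \<one>\<^bsub>completion v\<^esub>" "cclass v (\<lambda>n. 0) = \<zero>\<^bsub>completion v\<^esub>"
    using h.hom_one h.hom_zero by simp_all
qed

lemma vabs_cauchy_convergent:
  assumes "s \<in> cauchy_seqs v"
  shows "convergent (\<lambda>n. vabs v (s n))"
proof -
  have "Cauchy (\<lambda>n. vabs v (s n))"
  proof (rule CauchyI)
    fix e :: real assume "e > 0"
    obtain N where N: "\<And>m n. m \<ge> N \<Longrightarrow> n \<ge> N \<Longrightarrow> vabs v (s m - s n) < e"
      using cauchy_seqsD[OF assms \<open>e > 0\<close>] by blast
    have "norm (vabs v (s m) - vabs v (s n)) < e" if "m \<ge> N" "n \<ge> N" for m n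
      using vabs_diff_abs_le[of "s m" "s n"] N[OF that] by simp
    then show "\<exists>M. \<forall>m\<ge>M. \<forall>n\<ge>M. norm (vabs v (s m) - vabs v (s n)) < e" by blast
  qed
  then show ?thesis by (rule Cauchy_convergent)
qed

text \<open>\<open>completion_abs\<close> evaluates an arbitrary representative; two of them differ
  by a null sequence, which does not affect the limit.\<close>

lemma completion_abs_limit:
  assumes s: "s \<in> cauchy_seqs v"
  shows "(\<lambda>n. vabs v (s n)) \<longlonglongrightarrow> completion_abs v (cclass v s)"
proof -
  define t where "t = (SOME t. t \<in> cclass v s)"
  have "(\<lambda>n. 0) \<in> null_sequences v" by (simp add: null_sequences_def)
  then have "s \<in> cclass v s"
    unfolding cclass_def a_r_coset_def r_coset_def by (force intro!: bexI[of _ "\<lambda>n. 0"])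
  then have "t \<in> cclass v s" unfolding t_def by (rule someI[where P = "\<lambda>t. t \<in> cclass v s"])
  then obtain u where u: "u \<in> null_sequences v" "t = (\<lambda>n. u n + s n)"
    by (auto simp: cclass_def a_r_coset_def r_coset_def)
  have l: "(\<lambda>n. vabs v (s n)) \<longlonglongrightarrow> lim (\<lambda>n. vabs v (s n))"
    using vabs_cauchy_convergent[OF s] by (simp add: convergent_LIMSEQ_iff)
  have "(\<lambda>n. vabs v (t n) - vabs v (s n)) \<longlonglongrightarrow> 0"
  proof (rule Lim_null_comparison)
    show "\<forall>\<^sub>F n in sequentially. norm (vabs v (t n) - vabs v (s n)) \<le> vabs v (u n)"
    proof (rule always_eventually, rule allI)
      fix n show "norm (vabs v (t n) - vabs v (s n)) \<le> vabs v (u n)"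
        using vabs_diff_abs_le[of "t n" "s n"] by (simp add: u)
    qed
    show "(\<lambda>n. vabs v (u n)) \<longlonglongrightarrow> 0" using u(1) by (simp add: null_sequences_def)
  qed
  from tendsto_add[OF this l] have "(\<lambda>n. vabs v (t n)) \<longlonglongrightarrow> lim (\<lambda>n. vabs v (s n))" by simp
  then have "completion_abs v (cclass v s) = lim (\<lambda>n. vabs v (s n))" unfolding completion_abs_def t_def by (rule limI)
  then show ?thesis using l by simp
qed

lemma completion_abs_const: "completion_abs v (cclass v (\<lambda>n. x)) = vabs v x"
  using completion_abs_limit[OF cauchy_seqs_const[of x]] by (simp add: LIMSEQ_const_iff)

lemma to_completion_eq: "to_completion v x = cclass v (\<lambda>n. x)"
  by (simp add: to_completion_def cclass_def)

lemma completion_abs_nonneg: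
  assumes a: "a \<in> carrier (completion v)"
  shows "completion_abs v a \<ge> 0"
proof -
  obtain s where s: "s \<in> cauchy_seqs v" "a = cclass v s" by (rule cclass_surj[OF a])
  show ?thesis unfolding s(2) by (rule tendsto_lowerbound[OF completion_abs_limit[OF s(1)]]) auto
qed

lemma completion_abs_add:
  assumes a: "a \<in> carrier (completion v)" and b: "b \<in> carrier (completion v)"
  shows "completion_abs v (a \<oplus>\<^bsub>completion v\<^esub> b) \<le> max (completion_abs v a) (completion_abs v b)"
proof -
  obtain s where s: "s \<in> cauchy_seqs v" "a = cclass v s" by (rule cclass_surj[OF a])
  obtain t where t: "t \<in> cauchy_seqs v" "b = cclass v t" by (rule cclass_surj[OF b])
  show ?thesis unfolding s(2) t(2) cclass_add[OF s(1) t(1)]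
    by (rule tendsto_le[OF _ tendsto_max[OF completion_abs_limit[OF s(1)] completion_abs_limit[OF t(1)]]
          completion_abs_limit[OF cauchy_seqs_add[OF s(1) t(1)]]]) (auto simp: vabs_add_le_max)
qed

lemma completion_abs_mult:
  assumes a: "a \<in> carrier (completion v)" and b: "b \<in> carrier (completion v)"
  shows "completion_abs v (a \<otimes>\<^bsub>completion v\<^esub> b) = completion_abs v a * completion_abs v b"
proof -
  obtain s where s: "s \<in> cauchy_seqs v" "a = cclass v s" by (rule cclass_surj[OF a])
  obtain t where t: "t \<in> cauchy_seqs v" "b = cclass v t" by (rule cclass_surj[OF b])
  have "(\<lambda>n. vabs v (s n * t n)) \<longlonglongrightarrow> completion_abs v a * completion_abs v b"
    using tendsto_mult[OF completion_abs_limit[OF s(1)] completion_abs_limit[OF t(1)]] by (simp add: vabs_mult s t)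
  then show ?thesis using completion_abs_limit[OF cauchy_seqs_mult[OF s(1) t(1)]] LIMSEQ_unique
    unfolding s(2) t(2) cclass_mult[OF s(1) t(1)] by blast
qed

lemma completion_abs_minus_commute:
  assumes a: "a \<in> carrier (completion v)" and b: "b \<in> carrier (completion v)"
  shows "completion_abs v (a \<ominus>\<^bsub>completion v\<^esub> b) = completion_abs v (b \<ominus>\<^bsub>completion v\<^esub> a)"
proof -
  obtain s where s: "s \<in> cauchy_seqs v" "a = cclass v s" by (rule cclass_surj[OF a])
  obtain t where t: "t \<in> cauchy_seqs v" "b = cclass v t" by (rule cclass_surj[OF b])
  have d: "(\<lambda>n. s n - t n) \<in> cauchy_seqs v" "(\<lambda>n. t n - s n) \<in> cauchy_seqs v"
    using cauchy_seqs_add[OF s(1) cauchy_seqs_uminus[OF t(1)]] cauchy_seqs_add[OF t(1) cauchy_seqs_uminus[OF s(1)]] by simp_all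
  have "(\<lambda>n. vabs v (s n - t n)) = (\<lambda>n. vabs v (t n - s n))" using vabs_minus_commute by blast
  then show ?thesis
    using completion_abs_limit[OF d(1)] completion_abs_limit[OF d(2)] LIMSEQ_unique
    unfolding s(2) t(2) cclass_minus[OF s(1) t(1)] cclass_minus[OF t(1) s(1)] by metis
qed

lemma completion_abs_eq_0_iff:
  assumes a: "a \<in> carrier (completion v)"
  shows "completion_abs v a = 0 \<longleftrightarrow> a = \<zero>\<^bsub>completion v\<^esub>"
proof
  obtain s where s: "s \<in> cauchy_seqs v" "a = cclass v s" by (rule cclass_surj[OF a])
  interpret N: ideal "null_sequences v" "cauchy_ring v" by (rule ideal_null)
  assume "completion_abs v a = 0"
  then have "s \<in> null_sequences v" using completion_abs_limit[OF s(1)] s(2) by (simp add: null_sequences_def)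
  then have "cclass v s = null_sequences v"
    unfolding cclass_def by (rule N.a_rcos_const)
  then show "a = \<zero>\<^bsub>completion v\<^esub>" by (simp add: s completion_def FactRing_def)
next
  assume "a = \<zero>\<^bsub>completion v\<^esub>"
  then show "completion_abs v a = 0" using completion_abs_const[of 0] by (simp add: cclass_zero)
qed

end

section \<open>Topology of the completion and the embedding of K\<close>

context
  fixes v :: "'k::field place"
  assumes v: "discrete_valuation v"
begin

interpretation K: cring "completion v" by (rule cring_completion[OF v])

lemma completion_minus_add:
  assumes "a \<in> carrier (completion v)" "b \<in> carrier (completion v)" "c \<in> carrier (completion v)"
  shows "a \<ominus>\<^bsub>completion v\<^esub> c = (a \<ominus>\<^bsub>completion v\<^esub> b) \<oplus>\<^bsub>completion v\<^esub> (b \<ominus>\<^bsub>completion v\<^esub> c)"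
  using assms by (simp add: a_minus_def K.a_assoc K.r_neg1)

lemma completion_ultrametric:
  assumes "a \<in> carrier (completion v)" "b \<in> carrier (completion v)" "c \<in> carrier (completion v)"
  shows "completion_abs v (a \<ominus>\<^bsub>completion v\<^esub> c) \<le>
    max (completion_abs v (a \<ominus>\<^bsub>completion v\<^esub> b)) (completion_abs v (b \<ominus>\<^bsub>completion v\<^esub> c))"
  unfolding completion_minus_add[OF assms] using assms by (intro completion_abs_add[OF v]) auto

lemma completion_dist_eq_0_iff:
  assumes "a \<in> carrier (completion v)" "b \<in> carrier (completion v)"
  shows "completion_abs v (a \<ominus>\<^bsub>completion v\<^esub> b) = 0 \<longleftrightarrow> a = b"
  using completion_abs_eq_0_iff[OF v K.minus_closed[OF assms]] K.r_right_minus_eq[OF assms] by simp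

lemma completion_metric:
  "Metric_space (carrier (completion v))
    (\<lambda>a b. if a \<in> carrier (completion v) \<and> b \<in> carrier (completion v)
           then completion_abs v (a \<ominus>\<^bsub>completion v\<^esub> b) else 0)"
proof
  fix x y z :: "(nat \<Rightarrow> 'k) set"
  let ?d = "\<lambda>a b. if a \<in> carrier (completion v) \<and> b \<in> carrier (completion v)
           then completion_abs v (a \<ominus>\<^bsub>completion v\<^esub> b) else 0"
  show nn: "0 \<le> ?d x y" for x y by (auto simp: completion_abs_nonneg[OF v])
  show "?d x y = ?d y x" using completion_abs_minus_commute[OF v] by simp
  show "(?d x y = 0) = (x = y)" if "x \<in> carrier (completion v)" "y \<in> carrier (completion v)"
    using that completion_dist_eq_0_iff by simp
  show "?d x z \<le> ?d x y + ?d y z"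
    if "x \<in> carrier (completion v)" "y \<in> carrier (completion v)" "z \<in> carrier (completion v)"
    using completion_ultrametric[OF that] nn[of x y] nn[of y z] that by simp
qed

lemma openin_completion_iff:
  "openin (completion_topology v) U \<longleftrightarrow> U \<subseteq> carrier (completion v) \<and>
    (\<forall>a\<in>U. \<exists>r>0. \<forall>b\<in>carrier (completion v). completion_abs v (b \<ominus>\<^bsub>completion v\<^esub> a) < r \<longrightarrow> b \<in> U)"
proof -
  interpret M: Metric_space "carrier (completion v)" "\<lambda>a b. if a \<in> carrier (completion v) \<and> b \<in> carrier (completion v)
           then completion_abs v (a \<ominus>\<^bsub>completion v\<^esub> b) else 0" by (rule completion_metric)
  have b: "M.mball a r = {b\<in>carrier (completion v). completion_abs v (b \<ominus>\<^bsub>completion v\<^esub> a) < r}"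
    if "a \<in> carrier (completion v)" for a r
    unfolding M.mball_def using that completion_abs_minus_commute[OF v that] by auto
  show ?thesis unfolding completion_topology_def M.openin_mtopology
  proof (intro conj_cong refl)
    assume U: "U \<subseteq> carrier (completion v)"
    show "(\<forall>x. x \<in> U \<longrightarrow> (\<exists>r>0. M.mball x r \<subseteq> U)) \<longleftrightarrow>
      (\<forall>a\<in>U. \<exists>r>0. \<forall>b\<in>carrier (completion v). completion_abs v (b \<ominus>\<^bsub>completion v\<^esub> a) < r \<longrightarrow> b \<in> U)"
      unfolding Ball_def[of U]
    proof (intro iff_allI imp_cong refl)
      fix a assume "a \<in> U"
      then have "a \<in> carrier (completion v)" using U by blast
      have "M.mball a r \<subseteq> U \<longleftrightarrow> (\<forall>b\<in>carrier (completion v). completion_abs v (b \<ominus>\<^bsub>completion v\<^esub> a) < r \<longrightarrow> b \<in> U)" for r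
        unfolding b[OF \<open>a \<in> carrier (completion v)\<close>] by blast
      then show "(\<exists>r>0. M.mball a r \<subseteq> U) \<longleftrightarrow> (\<exists>r>0. \<forall>b\<in>carrier (completion v). completion_abs v (b \<ominus>\<^bsub>completion v\<^esub> a) < r \<longrightarrow> b \<in> U)"
        by simp
    qed
  qed
qed

lemma openin_completion_carrier: "openin (completion_topology v) (carrier (completion v))"
  unfolding openin_completion_iff by (auto intro: exI[of _ 1])

text \<open>In an ultrametric every point of a ball is a center of it, so the radius r itself works
  at each point.\<close>

lemma openin_completion_ball:
  assumes a: "a \<in> carrier (completion v)"
  shows "openin (completion_topology v) {b\<in>carrier (completion v). completion_abs v (b \<ominus>\<^bsub>completion v\<^esub> a) < r}"
  unfolding openin_completion_iff
proof (intro conjI ballI)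
  fix b assume b: "b \<in> {b\<in>carrier (completion v). completion_abs v (b \<ominus>\<^bsub>completion v\<^esub> a) < r}"
  have "0 \<le> completion_abs v (b \<ominus>\<^bsub>completion v\<^esub> a)" using a b by (auto intro: completion_abs_nonneg[OF v])
  then have "r > 0" using b by auto
  moreover have "completion_abs v (c \<ominus>\<^bsub>completion v\<^esub> a) < r"
    if "c \<in> carrier (completion v)" "completion_abs v (c \<ominus>\<^bsub>completion v\<^esub> b) < r" for c
    using completion_ultrametric[of c b a] a b that by auto
  ultimately show "\<exists>r'>0. \<forall>c\<in>carrier (completion v). completion_abs v (c \<ominus>\<^bsub>completion v\<^esub> b) < r' \<longrightarrow>
      c \<in> {b\<in>carrier (completion v). completion_abs v (b \<ominus>\<^bsub>completion v\<^esub> a) < r}" by blast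
qed auto

lemma completion_integers_iff: "a \<in> completion_integers v \<longleftrightarrow> a \<in> carrier (completion v) \<and> completion_abs v a \<le> 1"
  by (simp add: completion_integers_def)

text \<open>Changing an integral element by one of absolute value below 1 keeps it integral, so the
  radius 1 works everywhere.\<close>

lemma openin_completion_integers: "openin (completion_topology v) (completion_integers v)"
  unfolding openin_completion_iff
proof (intro conjI ballI exI[of _ 1] impI)
  fix a b assume a: "a \<in> completion_integers v" and b: "b \<in> carrier (completion v)"
    and d: "completion_abs v (b \<ominus>\<^bsub>completion v\<^esub> a) < 1"
  have ac: "a \<in> carrier (completion v)" "completion_abs v a \<le> 1" using a by (auto simp: completion_integers_iff)
  have "b = (b \<ominus>\<^bsub>completion v\<^esub> a) \<oplus>\<^bsub>completion v\<^esub> a" using ac b by (simp add: a_minus_def K.a_assoc K.l_neg)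
  moreover have "completion_abs v ((b \<ominus>\<^bsub>completion v\<^esub> a) \<oplus>\<^bsub>completion v\<^esub> a) \<le> max (completion_abs v (b \<ominus>\<^bsub>completion v\<^esub> a)) (completion_abs v a)"
    using ac b by (intro completion_abs_add[OF v]) auto
  ultimately show "b \<in> completion_integers v" using b ac d by (simp add: completion_integers_iff)
qed (auto simp: completion_integers_iff)

lemma to_completion_carrier: "to_completion v x \<in> carrier (completion v)"
  by (simp add: to_completion_eq[OF v] cclass_carrier[OF v] cauchy_seqs_const[OF v])

lemma to_completion_add: "to_completion v (x + y) = to_completion v x \<oplus>\<^bsub>completion v\<^esub> to_completion v y"
  and to_completion_mult: "to_completion v (x * y) = to_completion v x \<otimes>\<^bsub>completion v\<^esub> to_completion v y"
  and to_completion_diff: "to_completion v (x - y) = to_completion v x \<ominus>\<^bsub>completion v\<^esub> to_completion v y"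
  and to_completion_one: "to_completion v 1 = \<one>\<^bsub>completion v\<^esub>"
  and to_completion_zero: "to_completion v 0 = \<zero>\<^bsub>completion v\<^esub>"
  by (simp_all add: to_completion_eq[OF v] cclass_add[OF v] cclass_mult[OF v] cclass_minus[OF v]
      cclass_one[OF v] cclass_zero[OF v] cauchy_seqs_const[OF v])

lemma completion_abs_to_completion: "completion_abs v (to_completion v x) = vabs v x"
  by (simp add: to_completion_eq[OF v] completion_abs_const[OF v])

lemma to_completion_integers_iff: "to_completion v x \<in> completion_integers v \<longleftrightarrow> x \<in> valuation_ring v"
  by (simp add: completion_integers_iff to_completion_carrier completion_abs_to_completion vabs_le_1_iff)

lemma completion_integers_closed:
  "\<one>\<^bsub>completion v\<^esub> \<in> completion_integers v" "\<zero>\<^bsub>completion v\<^esub> \<in> completion_integers v"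
  "a \<in> completion_integers v \<Longrightarrow> b \<in> completion_integers v \<Longrightarrow> a \<oplus>\<^bsub>completion v\<^esub> b \<in> completion_integers v"
  "a \<in> completion_integers v \<Longrightarrow> b \<in> completion_integers v \<Longrightarrow> a \<otimes>\<^bsub>completion v\<^esub> b \<in> completion_integers v"
  "a \<in> completion_integers v \<Longrightarrow> \<ominus>\<^bsub>completion v\<^esub> a \<in> completion_integers v"
proof -
  show "\<one>\<^bsub>completion v\<^esub> \<in> completion_integers v" "\<zero>\<^bsub>completion v\<^esub> \<in> completion_integers v"
    using to_completion_integers_iff[of 1] to_completion_integers_iff[of 0] vabs_le_1_iff[of v 1] vabs_1[OF v]
    by (simp_all add: to_completion_one to_completion_zero valuation_ring_def)
  show "a \<in> completion_integers v \<Longrightarrow> b \<in> completion_integers v \<Longrightarrow> a \<oplus>\<^bsub>completion v\<^esub> b \<in> completion_integers v"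
    using completion_abs_add[OF v, of a b] by (auto simp: completion_integers_iff)
  show "a \<in> completion_integers v \<Longrightarrow> b \<in> completion_integers v \<Longrightarrow> a \<otimes>\<^bsub>completion v\<^esub> b \<in> completion_integers v"
    using completion_abs_mult[OF v, of a b] completion_abs_nonneg[OF v, of a] completion_abs_nonneg[OF v, of b]
    by (simp add: completion_integers_iff mult_le_one)
  assume a: "a \<in> completion_integers v"
  then have ac: "a \<in> carrier (completion v)" by (simp add: completion_integers_iff)
  have "completion_abs v (\<ominus>\<^bsub>completion v\<^esub> a) = completion_abs v a"
    using completion_abs_minus_commute[OF v K.zero_closed ac] ac by (simp add: a_minus_def)
  then show "\<ominus>\<^bsub>completion v\<^esub> a \<in> completion_integers v" using a ac by (simp add: completion_integers_iff)
qed

end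

section \<open>Adeles\<close>

lemma adele_ring_simps [simp]:
  "x \<otimes>\<^bsub>adele_ring \<Omega>\<^esub> y = (\<lambda>v\<in>\<Omega>. x v \<otimes>\<^bsub>completion v\<^esub> y v)"
  "x \<oplus>\<^bsub>adele_ring \<Omega>\<^esub> y = (\<lambda>v\<in>\<Omega>. x v \<oplus>\<^bsub>completion v\<^esub> y v)"
  "\<one>\<^bsub>adele_ring \<Omega>\<^esub> = (\<lambda>v\<in>\<Omega>. \<one>\<^bsub>completion v\<^esub>)" "\<zero>\<^bsub>adele_ring \<Omega>\<^esub> = (\<lambda>v\<in>\<Omega>. \<zero>\<^bsub>completion v\<^esub>)"
  by (auto simp: adele_ring_def)

lemma adele_carrier_iff:
  "x \<in> carrier (adele_ring \<Omega>) \<longleftrightarrow> x \<in> (\<Pi>\<^sub>E v\<in>\<Omega>. carrier (completion v)) \<and> finite {v \<in> \<Omega>. x v \<notin> completion_integers v}"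
  by (simp add: adele_ring_def)

context
  fixes \<Omega> :: "'k::field place set"
  assumes \<Omega>: "\<And>v. v \<in> \<Omega> \<Longrightarrow> discrete_valuation v"
    and fin: "\<And>x. finite {v\<in>\<Omega>. x \<notin> valuation_ring v}"
begin

lemma cring_adele: "cring (adele_ring \<Omega>)"
proof -
  note K = cring_completion[OF \<Omega>]
  have Kr: "ring (completion v)" if "v \<in> \<Omega>" for v using K[OF that] by (rule cring.axioms)
  have Kg: "abelian_group (completion v)" if "v \<in> \<Omega>" for v using Kr[OF that] by (rule ring.is_abelian_group)
  have c: "x v \<in> carrier (completion v)" if "x \<in> carrier (adele_ring \<Omega>)" "v \<in> \<Omega>" for x v
    using that by (auto simp: adele_carrier_iff)
  have ext: "x = y" if "x \<in> extensional \<Omega>" "y \<in> extensional \<Omega>" "\<And>v. v \<in> \<Omega> \<Longrightarrow> x v = y v" for x y :: "'k adele"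
    using that by (metis extensionalityI)
  have e: "x \<in> extensional \<Omega>" if "x \<in> carrier (adele_ring \<Omega>)" for x using that by (auto simp: adele_carrier_iff PiE_def)
  \<comment> \<open>An operation that preserves local integrality can leave the integers only at
    places where one of its arguments does.\<close>
  have fin2: "finite {v\<in>\<Omega>. z v \<notin> completion_integers v}"
    if "x \<in> carrier (adele_ring \<Omega>)" "y \<in> carrier (adele_ring \<Omega>)"
      "\<And>v. v \<in> \<Omega> \<Longrightarrow> x v \<in> completion_integers v \<Longrightarrow> y v \<in> completion_integers v \<Longrightarrow> z v \<in> completion_integers v" for x y z
  proof (rule finite_subset)
    show "{v\<in>\<Omega>. z v \<notin> completion_integers v} \<subseteq> {v\<in>\<Omega>. x v \<notin> completion_integers v} \<union> {v\<in>\<Omega>. y v \<notin> completion_integers v}"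
      using that(3) by blast
    show "finite \<dots>" using that(1,2) by (simp add: adele_carrier_iff)
  qed
  have ad: "x \<oplus>\<^bsub>adele_ring \<Omega>\<^esub> y \<in> carrier (adele_ring \<Omega>)" "x \<otimes>\<^bsub>adele_ring \<Omega>\<^esub> y \<in> carrier (adele_ring \<Omega>)"
    if xy: "x \<in> carrier (adele_ring \<Omega>)" "y \<in> carrier (adele_ring \<Omega>)" for x y
  proof -
    show "x \<oplus>\<^bsub>adele_ring \<Omega>\<^esub> y \<in> carrier (adele_ring \<Omega>)" unfolding adele_carrier_iff
    proof
      show "x \<oplus>\<^bsub>adele_ring \<Omega>\<^esub> y \<in> (\<Pi>\<^sub>E v\<in>\<Omega>. carrier (completion v))"
        using abelian_groupE(1)[OF Kg] c xy by auto
      show "finite {v \<in> \<Omega>. (x \<oplus>\<^bsub>adele_ring \<Omega>\<^esub> y) v \<notin> completion_integers v}"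
        by (rule fin2[OF xy]) (auto intro: completion_integers_closed[OF \<Omega>])
    qed
    show "x \<otimes>\<^bsub>adele_ring \<Omega>\<^esub> y \<in> carrier (adele_ring \<Omega>)" unfolding adele_carrier_iff
    proof
      show "x \<otimes>\<^bsub>adele_ring \<Omega>\<^esub> y \<in> (\<Pi>\<^sub>E v\<in>\<Omega>. carrier (completion v))"
        using cring.cring_simprules(5)[OF K] c xy by auto
      show "finite {v \<in> \<Omega>. (x \<otimes>\<^bsub>adele_ring \<Omega>\<^esub> y) v \<notin> completion_integers v}"
        by (rule fin2[OF xy]) (auto intro: completion_integers_closed[OF \<Omega>])
    qed
  qed
  have one: "\<one>\<^bsub>adele_ring \<Omega>\<^esub> \<in> carrier (adele_ring \<Omega>)" "\<zero>\<^bsub>adele_ring \<Omega>\<^esub> \<in> carrier (adele_ring \<Omega>)"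
    unfolding adele_carrier_iff using completion_integers_closed(1,2)[OF \<Omega>] cring.cring_simprules(6)[OF K] abelian_groupE(2)[OF Kg]
    by (auto intro!: finite_subset[OF _ finite.emptyI])
  show ?thesis
  proof (rule cringI)
    show "abelian_group (adele_ring \<Omega>)"
    proof (rule abelian_groupI)
      fix x assume x: "x \<in> carrier (adele_ring \<Omega>)"
      define y where "y = (\<lambda>v\<in>\<Omega>. \<ominus>\<^bsub>completion v\<^esub> x v)"
      have "y \<in> carrier (adele_ring \<Omega>)" unfolding adele_carrier_iff
      proof
        show "y \<in> (\<Pi>\<^sub>E v\<in>\<Omega>. carrier (completion v))"
          using abelian_group.a_inv_closed[OF Kg] c[OF x] by (auto simp: y_def)
        show "finite {v \<in> \<Omega>. y v \<notin> completion_integers v}"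
          by (rule fin2[OF x x]) (auto simp: y_def intro: completion_integers_closed[OF \<Omega>])
      qed
      moreover have "y \<oplus>\<^bsub>adele_ring \<Omega>\<^esub> x = \<zero>\<^bsub>adele_ring \<Omega>\<^esub>"
        using abelian_group.l_neg[OF Kg] c[OF x] by (intro ext) (auto simp: y_def)
      ultimately show "\<exists>y\<in>carrier (adele_ring \<Omega>). y \<oplus>\<^bsub>adele_ring \<Omega>\<^esub> x = \<zero>\<^bsub>adele_ring \<Omega>\<^esub>" by blast
      show "\<zero>\<^bsub>adele_ring \<Omega>\<^esub> \<oplus>\<^bsub>adele_ring \<Omega>\<^esub> x = x"
        using abelian_groupE(5)[OF Kg] c[OF x] e[OF x] by (intro ext) auto
      fix y assume y: "y \<in> carrier (adele_ring \<Omega>)"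
      show "x \<oplus>\<^bsub>adele_ring \<Omega>\<^esub> y = y \<oplus>\<^bsub>adele_ring \<Omega>\<^esub> x"
        using abelian_groupE(4)[OF Kg] c[OF x] c[OF y] by (intro ext) auto
      fix z assume z: "z \<in> carrier (adele_ring \<Omega>)"
      show "x \<oplus>\<^bsub>adele_ring \<Omega>\<^esub> y \<oplus>\<^bsub>adele_ring \<Omega>\<^esub> z = x \<oplus>\<^bsub>adele_ring \<Omega>\<^esub> (y \<oplus>\<^bsub>adele_ring \<Omega>\<^esub> z)"
        using abelian_groupE(3)[OF Kg] c[OF x] c[OF y] c[OF z] by (intro ext) auto
    qed (fact ad one)+
    show "Group.comm_monoid (adele_ring \<Omega>)"
    proof (rule comm_monoidI)
      fix x assume x: "x \<in> carrier (adele_ring \<Omega>)"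
      show "\<one>\<^bsub>adele_ring \<Omega>\<^esub> \<otimes>\<^bsub>adele_ring \<Omega>\<^esub> x = x"
        using cring.cring_simprules(12)[OF K] c[OF x] e[OF x] by (intro ext) auto
      fix y assume y: "y \<in> carrier (adele_ring \<Omega>)"
      show "x \<otimes>\<^bsub>adele_ring \<Omega>\<^esub> y = y \<otimes>\<^bsub>adele_ring \<Omega>\<^esub> x"
        using cring.cring_simprules(14)[OF K] c[OF x] c[OF y] by (intro ext) auto
      fix z assume z: "z \<in> carrier (adele_ring \<Omega>)"
      show "x \<otimes>\<^bsub>adele_ring \<Omega>\<^esub> y \<otimes>\<^bsub>adele_ring \<Omega>\<^esub> z = x \<otimes>\<^bsub>adele_ring \<Omega>\<^esub> (y \<otimes>\<^bsub>adele_ring \<Omega>\<^esub> z)"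
        using cring.cring_simprules(11)[OF K] c[OF x] c[OF y] c[OF z] by (intro ext) auto
    qed (fact ad one)+
    fix x y z assume x: "x \<in> carrier (adele_ring \<Omega>)" and y: "y \<in> carrier (adele_ring \<Omega>)" and z: "z \<in> carrier (adele_ring \<Omega>)"
    show "(x \<oplus>\<^bsub>adele_ring \<Omega>\<^esub> y) \<otimes>\<^bsub>adele_ring \<Omega>\<^esub> z = x \<otimes>\<^bsub>adele_ring \<Omega>\<^esub> z \<oplus>\<^bsub>adele_ring \<Omega>\<^esub> y \<otimes>\<^bsub>adele_ring \<Omega>\<^esub> z"
      using ringE(3)[OF Kr] c[OF x] c[OF y] c[OF z] by (intro ext) auto
  qed
qed

lemma to_adele_carrier: "to_adele \<Omega> x \<in> carrier (adele_ring \<Omega>)"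
proof -
  have "{v \<in> \<Omega>. to_adele \<Omega> x v \<notin> completion_integers v} = {v\<in>\<Omega>. x \<notin> valuation_ring v}"
    by (auto simp: to_adele_def to_completion_integers_iff[OF \<Omega>])
  then show ?thesis unfolding adele_carrier_iff using fin[of x]
    by (simp add: to_adele_def to_completion_carrier[OF \<Omega>])
qed

lemma to_adele_add: "to_adele \<Omega> (x + y) = to_adele \<Omega> x \<oplus>\<^bsub>adele_ring \<Omega>\<^esub> to_adele \<Omega> y"
  and to_adele_mult: "to_adele \<Omega> (x * y) = to_adele \<Omega> x \<otimes>\<^bsub>adele_ring \<Omega>\<^esub> to_adele \<Omega> y"
  and to_adele_one: "to_adele \<Omega> 1 = \<one>\<^bsub>adele_ring \<Omega>\<^esub>"
  and to_adele_zero: "to_adele \<Omega> 0 = \<zero>\<^bsub>adele_ring \<Omega>\<^esub>"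
  by (auto simp: to_adele_def fun_eq_iff to_completion_add[OF \<Omega>] to_completion_mult[OF \<Omega>]
      to_completion_one[OF \<Omega>] to_completion_zero[OF \<Omega>])

lemma to_adele_eq_zero_iff:
  assumes "\<Omega> \<noteq> {}"
  shows "to_adele \<Omega> x = \<zero>\<^bsub>adele_ring \<Omega>\<^esub> \<longleftrightarrow> x = 0"
proof
  obtain v where v: "v \<in> \<Omega>" using assms by blast
  assume "to_adele \<Omega> x = \<zero>\<^bsub>adele_ring \<Omega>\<^esub>"
  then have "to_completion v x = to_completion v 0" using v unfolding to_adele_zero[symmetric]
    by (metis to_adele_def restrict_apply')
  then have "vabs v x = vabs v 0" using completion_abs_to_completion[OF \<Omega>[OF v]] by metis
  then show "x = 0" by simp
qed (simp add: to_adele_zero)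

text \<open>The bound on the variables of f matters: at indices from g on, \<open>diagonal\<close>
  is \<open>undefined\<close>.\<close>

lemma mpol_eval_in_diagonal:
  assumes f: "f \<in> carrier (mpol_ring {..<g})"
  shows "mpol_eval_in (adele_ring \<Omega>) (to_adele \<Omega>) (diagonal \<Omega> g x) f = to_adele \<Omega> (mpol_eval id x f)"
proof -
  interpret A: cring "adele_ring \<Omega>" by (rule cring_adele)
  have pw: "to_adele \<Omega> y [^]\<^bsub>adele_ring \<Omega>\<^esub> (i::nat) = to_adele \<Omega> (y ^ i)" for y i
  proof (induction i)
    case (Suc i)
    then show ?case using A.nat_pow_Suc[of "to_adele \<Omega> y" i] by (simp only: power_Suc2 to_adele_mult)
  qed (simp only: A.nat_pow_0 power_0 to_adele_one)
  have pr: "finprod (adele_ring \<Omega>) (\<lambda>k. to_adele \<Omega> (h k)) S = to_adele \<Omega> (prod h S)" if "finite S" for h :: "nat \<Rightarrow> 'k" and S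
    using that
  proof (induction S rule: finite_induct)
    case (insert k S)
    have "finprod (adele_ring \<Omega>) (\<lambda>k. to_adele \<Omega> (h k)) (insert k S) = to_adele \<Omega> (h k) \<otimes>\<^bsub>adele_ring \<Omega>\<^esub> finprod (adele_ring \<Omega>) (\<lambda>k. to_adele \<Omega> (h k)) S"
      using insert by (intro A.finprod_insert) (auto simp: to_adele_carrier)
    then show ?case using insert by (simp only: prod.insert[OF insert(1,2)] to_adele_mult)
  qed (simp only: A.finprod_empty prod.empty to_adele_one)
  have su: "finsum (adele_ring \<Omega>) (\<lambda>k. to_adele \<Omega> (h k)) S = to_adele \<Omega> (sum h S)" if "finite S" for h :: "(nat \<Rightarrow>\<^sub>0 nat) \<Rightarrow> 'k" and S
    using that
  proof (induction S rule: finite_induct)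
    case (insert k S)
    have "finsum (adele_ring \<Omega>) (\<lambda>k. to_adele \<Omega> (h k)) (insert k S) = to_adele \<Omega> (h k) \<oplus>\<^bsub>adele_ring \<Omega>\<^esub> finsum (adele_ring \<Omega>) (\<lambda>k. to_adele \<Omega> (h k)) S"
      using insert by (intro A.finsum_insert) (auto simp: to_adele_carrier)
    then show ?case using insert by (simp only: sum.insert[OF insert(1,2)] to_adele_add)
  qed (simp only: A.finsum_empty sum.empty to_adele_zero)
  have mon: "finprod (adele_ring \<Omega>) (\<lambda>k. diagonal \<Omega> g x k [^]\<^bsub>adele_ring \<Omega>\<^esub> Poly_Mapping.lookup m k) (Poly_Mapping.keys m) =
      to_adele \<Omega> (\<Prod>k\<in>Poly_Mapping.keys m. x k ^ Poly_Mapping.lookup m k)" if m: "m \<in> Poly_Mapping.keys f" for m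
  proof -
    have "finprod (adele_ring \<Omega>) (\<lambda>k. diagonal \<Omega> g x k [^]\<^bsub>adele_ring \<Omega>\<^esub> Poly_Mapping.lookup m k) (Poly_Mapping.keys m) =
      finprod (adele_ring \<Omega>) (\<lambda>k. to_adele \<Omega> (x k ^ Poly_Mapping.lookup m k)) (Poly_Mapping.keys m)"
    proof (rule A.finprod_cong')
      fix k assume "k \<in> Poly_Mapping.keys m"
      then have "k < g" using f m by (auto simp: mpol_carrier_iff)
      then show "diagonal \<Omega> g x k [^]\<^bsub>adele_ring \<Omega>\<^esub> Poly_Mapping.lookup m k = to_adele \<Omega> (x k ^ Poly_Mapping.lookup m k)"
        by (simp add: diagonal_def pw)
    qed (auto simp: to_adele_carrier)
    then show ?thesis by (simp add: pr)
  qed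
  have "mpol_eval_in (adele_ring \<Omega>) (to_adele \<Omega>) (diagonal \<Omega> g x) f =
    finsum (adele_ring \<Omega>) (\<lambda>m. to_adele \<Omega> (Poly_Mapping.lookup f m * (\<Prod>k\<in>Poly_Mapping.keys m. x k ^ Poly_Mapping.lookup m k))) (Poly_Mapping.keys f)"
    unfolding mpol_eval_in_def
    by (rule A.finsum_cong') (auto simp: to_adele_carrier mon to_adele_mult simp del: adele_ring_simps)
  also have "\<dots> = to_adele \<Omega> (mpol_eval id x f)"
    unfolding mpol_eval_def by (simp add: su)
  finally show ?thesis .
qed

section \<open>Neighbourhoods and closures in adelic space\<close>

lemma adele_neighbourhood:
  assumes x: "x \<in> carrier (adele_ring \<Omega>)" and w: "w \<in> \<Omega>" and r: "r > 0"
  obtains U where "openin (adele_topology \<Omega>) U" "x \<in> U"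
    "\<And>y. y \<in> U \<Longrightarrow> y w \<in> carrier (completion w) \<and> completion_abs w (y w \<ominus>\<^bsub>completion w\<^esub> x w) < r"
proof -
  have xc: "x v \<in> carrier (completion v)" if "v \<in> \<Omega>" for v using x that by (auto simp: adele_carrier_iff)
  define B where "B = {b\<in>carrier (completion w). completion_abs w (b \<ominus>\<^bsub>completion w\<^esub> x w) < r}"
  \<comment> \<open>Where x is not integral the whole completion is allowed. Apart from w this
    concerns finitely many places, so almost all factors are the integers, as a basic open set
    requires.\<close>
  define V where "V = (\<lambda>v. if v = w then B else if x v \<in> completion_integers v then completion_integers v else carrier (completion v))"
  have o: "openin (completion_topology v) (V v)" if "v \<in> \<Omega>" for v
    using that w xc[OF w] unfolding V_def B_def
    by (auto intro: openin_completion_ball[OF \<Omega>] openin_completion_integers[OF \<Omega>] openin_completion_carrier[OF \<Omega>])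
  have "{v \<in> \<Omega>. V v \<noteq> completion_integers v} \<subseteq> insert w {v\<in>\<Omega>. x v \<notin> completion_integers v}" by (auto simp: V_def)
  then have "finite {v \<in> \<Omega>. V v \<noteq> completion_integers v}"
    by (rule finite_subset) (use x in \<open>simp add: adele_carrier_iff\<close>)
  then have "openin (adele_topology \<Omega>) (\<Pi>\<^sub>E v\<in>\<Omega>. V v)"
    unfolding adele_topology_def using o by (intro topology_generated_by_Basis) blast
  moreover have "x \<in> (\<Pi>\<^sub>E v\<in>\<Omega>. V v)"
  proof -
    have "x w \<ominus>\<^bsub>completion w\<^esub> x w = \<zero>\<^bsub>completion w\<^esub>"
      using completion_dist_eq_0_iff[OF \<Omega>[OF w] xc[OF w] xc[OF w]]
      by (simp add: cring.cring_simprules(16) a_minus_def abelian_group.r_neg[OF ring.is_abelian_group[OF cring.axioms(1)[OF cring_completion[OF \<Omega>[OF w]]]] xc[OF w]])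
    then have "completion_abs w (x w \<ominus>\<^bsub>completion w\<^esub> x w) = 0"
      using completion_dist_eq_0_iff[OF \<Omega>[OF w] xc[OF w] xc[OF w]] by simp
    then have "x v \<in> V v" if "v \<in> \<Omega>" for v using xc that r by (auto simp: V_def B_def)
    moreover have "x \<in> extensional \<Omega>" using x by (auto simp: adele_carrier_iff PiE_def)
    ultimately show ?thesis by (auto simp: PiE_def)
  qed
  moreover have "y w \<in> carrier (completion w) \<and> completion_abs w (y w \<ominus>\<^bsub>completion w\<^esub> x w) < r" if "y \<in> (\<Pi>\<^sub>E v\<in>\<Omega>. V v)" for y
    using that w by (auto simp: V_def B_def PiE_iff)
  ultimately show ?thesis using that by blast
qed

lemma adele_carrier_subset_topspace:
  assumes "w \<in> \<Omega>"
  shows "carrier (adele_ring \<Omega>) \<subseteq> topspace (adele_topology \<Omega>)"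
proof
  fix x assume x: "x \<in> carrier (adele_ring \<Omega>)"
  obtain U where "openin (adele_topology \<Omega>) U" "x \<in> U" using adele_neighbourhood[OF x assms, of 1] by auto
  then show "x \<in> topspace (adele_topology \<Omega>)" using openin_subset by blast
qed

lemma diagonal_in_adelic_space: "diagonal \<Omega> g x \<in> (\<Pi>\<^sub>E k\<in>{..<g}. carrier (adele_ring \<Omega>))"
  by (simp add: diagonal_def to_adele_carrier)

text \<open>By the ultrametric inequality only one \<gamma> in \<Gamma> can be within r of x at w in
  all coordinates. If x were not \<gamma>, a neighbourhood of x that is small at w and excludes
  \<gamma> at a coordinate and place where they differ would contain no element of \<Gamma>.\<close>

lemma closure_of_discrete:
  assumes w: "w \<in> \<Omega>" and r: "r > 0"
    and disc: "\<And>\<gamma> \<gamma>'. \<gamma> \<in> \<Gamma> \<Longrightarrow> \<gamma>' \<in> \<Gamma> \<Longrightarrow> (\<And>k. k < g \<Longrightarrow> vabs w (\<gamma> k - \<gamma>' k) < r) \<Longrightarrow> \<gamma> = \<gamma>'"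
    and x: "x \<in> (\<Pi>\<^sub>E k\<in>{..<g}. carrier (adele_ring \<Omega>))"
      "x \<in> adelic_space_topology \<Omega> g closure_of (diagonal \<Omega> g ` \<Gamma>)"
  shows "x \<in> diagonal \<Omega> g ` \<Gamma>"
proof (rule ccontr)
  assume con: "x \<notin> diagonal \<Omega> g ` \<Gamma>"
  have xk: "x k \<in> carrier (adele_ring \<Omega>)" if "k < g" for k using x(1) that by auto
  have xc: "x k v \<in> carrier (completion v)" if "k < g" "v \<in> \<Omega>" for k v using xk[OF that(1)] that(2) by (auto simp: adele_carrier_iff)
  have "\<exists>U. openin (adele_topology \<Omega>) U \<and> x k \<in> U \<and> (\<forall>y\<in>U. completion_abs w (y w \<ominus>\<^bsub>completion w\<^esub> x k w) < r)" if "k < g" for k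
    using adele_neighbourhood[OF xk[OF that] w r] by metis
  then obtain U where U: "\<And>k. k < g \<Longrightarrow> openin (adele_topology \<Omega>) (U k)" "\<And>k. k < g \<Longrightarrow> x k \<in> U k"
    "\<And>k y. k < g \<Longrightarrow> y \<in> U k \<Longrightarrow> completion_abs w (y w \<ominus>\<^bsub>completion w\<^esub> x k w) < r" by metis
  have meet: "\<exists>\<gamma>\<in>\<Gamma>. \<forall>k<g. to_adele \<Omega> (\<gamma> k) \<in> T k"
    if T: "\<And>k. k < g \<Longrightarrow> openin (adele_topology \<Omega>) (T k)" "\<And>k. k < g \<Longrightarrow> x k \<in> T k" for T
  proof -
    have "openin (adelic_space_topology \<Omega> g) (\<Pi>\<^sub>E k\<in>{..<g}. T k)"
      unfolding adelic_space_topology_def using T(1) by (subst openin_PiE) auto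
    moreover have "x \<in> (\<Pi>\<^sub>E k\<in>{..<g}. T k)" using T(2) x(1) by (auto simp: PiE_iff)
    ultimately obtain y where "y \<in> diagonal \<Omega> g ` \<Gamma>" "y \<in> (\<Pi>\<^sub>E k\<in>{..<g}. T k)"
      using x(2) unfolding in_closure_of by blast
    moreover from this obtain \<gamma> where "\<gamma> \<in> \<Gamma>" "y = diagonal \<Omega> g \<gamma>" by blast
    ultimately show ?thesis by (intro bexI[of _ \<gamma>]) (auto simp: diagonal_def PiE_iff)
  qed
  obtain \<gamma> where \<gamma>: "\<gamma> \<in> \<Gamma>" "\<And>k. k < g \<Longrightarrow> to_adele \<Omega> (\<gamma> k) \<in> U k" using meet[OF U(1,2)] by blast
  have "x \<noteq> diagonal \<Omega> g \<gamma>" using con \<gamma> by blast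
  then obtain k where k: "k < g" "x k \<noteq> to_adele \<Omega> (\<gamma> k)"
    using PiE_ext[OF x(1) diagonal_in_adelic_space[of g \<gamma>]] by (auto simp: diagonal_def)
  then obtain v where v: "v \<in> \<Omega>" "x k v \<noteq> to_completion v (\<gamma> k)"
    using PiE_ext[of "x k" \<Omega> "\<lambda>v. carrier (completion v)" "to_adele \<Omega> (\<gamma> k)"] xk[OF k(1)] to_adele_carrier[of "\<gamma> k"]
    by (auto simp: adele_carrier_iff to_adele_def)
  \<comment> \<open>The exact distance from x to \<gamma> at v, so that a neighbourhood of this
    radius excludes \<gamma>.\<close>
  define s where "s = completion_abs v (to_completion v (\<gamma> k) \<ominus>\<^bsub>completion v\<^esub> x k v)"
  interpret K: cring "completion v" by (rule cring_completion[OF \<Omega>[OF v(1)]])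
  note tc = to_completion_carrier[OF \<Omega>]
  have "s \<noteq> 0" unfolding s_def using completion_dist_eq_0_iff[OF \<Omega>[OF v(1)] tc[OF v(1)] xc[OF k(1) v(1)]] v by metis
  moreover have "s \<ge> 0" unfolding s_def using tc[OF v(1)] xc[OF k(1) v(1)] by (intro completion_abs_nonneg[OF \<Omega>[OF v(1)]]) auto
  ultimately have "s > 0" by simp
  obtain U' where U': "openin (adele_topology \<Omega>) U'" "x k \<in> U'"
    "\<And>y. y \<in> U' \<Longrightarrow> completion_abs v (y v \<ominus>\<^bsub>completion v\<^esub> x k v) < s"
    using adele_neighbourhood[OF xk[OF k(1)] v(1) \<open>s > 0\<close>] by metis
  define T where "T = (\<lambda>i. if i = k then U i \<inter> U' else U i)"
  obtain \<gamma>' where \<gamma>': "\<gamma>' \<in> \<Gamma>" "\<And>k. k < g \<Longrightarrow> to_adele \<Omega> (\<gamma>' k) \<in> T k"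
    using meet[of T] U U' by (force simp: T_def)
  have "\<gamma>' = \<gamma>"
  proof (rule disc[OF \<gamma>'(1) \<gamma>(1)])
    fix i assume i: "i < g"
    interpret W: cring "completion w" by (rule cring_completion[OF \<Omega>[OF w]])
    have 1: "completion_abs w (to_completion w (\<gamma> i) \<ominus>\<^bsub>completion w\<^esub> x i w) < r"
      using U(3)[OF i \<gamma>(2)[OF i]] w by (simp add: to_adele_def)
    have "to_adele \<Omega> (\<gamma>' i) \<in> U i" using \<gamma>'(2)[OF i] by (auto simp: T_def split: if_splits)
    then have 2: "completion_abs w (to_completion w (\<gamma>' i) \<ominus>\<^bsub>completion w\<^esub> x i w) < r"
      using U(3)[OF i] w by (force simp: to_adele_def)
    have "vabs w (\<gamma>' i - \<gamma> i) = completion_abs w (to_completion w (\<gamma>' i) \<ominus>\<^bsub>completion w\<^esub> to_completion w (\<gamma> i))"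
      using completion_abs_to_completion[OF \<Omega>[OF w]] to_completion_diff[OF \<Omega>[OF w]] by metis
    also have "\<dots> \<le> max (completion_abs w (to_completion w (\<gamma>' i) \<ominus>\<^bsub>completion w\<^esub> x i w))
        (completion_abs w (x i w \<ominus>\<^bsub>completion w\<^esub> to_completion w (\<gamma> i)))"
      by (rule completion_ultrametric[OF \<Omega>[OF w] tc[OF w] xc[OF i w] tc[OF w]])
    also have "\<dots> < r" using 1 2 completion_abs_minus_commute[OF \<Omega>[OF w] tc[OF w] xc[OF i w]] by simp
    finally show "vabs w (\<gamma>' i - \<gamma> i) < r" .
  qed
  then have "to_adele \<Omega> (\<gamma> k) \<in> U'" using \<gamma>'(2)[OF k(1)] by (simp add: T_def)
  then have "s < s" using U'(3)[of "to_adele \<Omega> (\<gamma> k)"] v(1) by (simp add: s_def to_adele_def)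
  then show False by simp
qed

end

section \<open>Drinfeld modules\<close>

lemma poly_map_poly_const: "poly (map_poly (\<lambda>c. [:c:]) f) q = pcompose f q" for f :: "'a::field poly"
proof (induction f)
  case (pCons c f)
  then show ?case by (simp add: map_poly_pCons pcompose_pCons)
qed simp

lemma additive_polyD:
  fixes f :: "'a::field poly"
  assumes "additive_poly f"
  shows "poly f (x + y) = poly f x + poly f y"
proof -
  let ?F = "map_poly (\<lambda>c. [:c:]) f"
  have "poly (poly (pcompose ?F [:[:0, 1:], 1:]) [:y:]) x = poly (poly ([:f:] + ?F) [:y:]) x"
    using assms by (simp add: additive_poly_def)
  then show ?thesis by (simp add: poly_pcompose poly_map_poly_const add.commute)
qed

text \<open>Fraction-free elimination: with the pivot \<open>A s c\<close>, cross differences remove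
  column c, and the coefficient of s is then chosen to satisfy the equation for c.\<close>

lemma ex_linear_relation:
  fixes A :: "'i \<Rightarrow> 'b \<Rightarrow> 'a::idom"
  assumes "finite B" "finite I" "card I > card B"
  shows "\<exists>a. (\<exists>i\<in>I. a i \<noteq> 0) \<and> (\<forall>b\<in>B. (\<Sum>i\<in>I. a i * A i b) = 0)"
  using assms
proof (induction B arbitrary: A I rule: finite_induct)
  case empty
  then have "I \<noteq> {}" by auto
  then show ?case by (intro exI[of _ "\<lambda>_. 1"]) auto
next
  case (insert c B)
  show ?case
  proof (cases "\<forall>i\<in>I. A i c = 0")
    case True
    then show ?thesis using insert.IH[OF insert.prems(1), of A] insert by auto
  next
    case False
    then obtain s where s: "s \<in> I" "A s c \<noteq> 0" by blast
    define I' where "I' = I - {s}"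
    have I': "finite I'" "card I' > card B" "I = insert s I'" "s \<notin> I'" using insert s by (auto simp: I'_def)
    define A' where "A' = (\<lambda>i b. A s c * A i b - A i c * A s b)"
    obtain a where a: "\<exists>i\<in>I'. a i \<noteq> 0" "\<And>b. b \<in> B \<Longrightarrow> (\<Sum>i\<in>I'. a i * A' i b) = 0"
      using insert.IH[OF I'(1,2), of A'] by blast
    define a' where "a' = (\<lambda>i. if i = s then - (\<Sum>i\<in>I'. a i * A i c) else A s c * a i)"
    have ex: "\<exists>i\<in>I. a' i \<noteq> 0" using a(1) s I' by (auto simp: a'_def)
    have sum: "(\<Sum>i\<in>I. a' i * A i b) = (\<Sum>i\<in>I'. a i * A' i b)" for b
    proof -
      have "(\<Sum>i\<in>I. a' i * A i b) = a' s * A s b + (\<Sum>i\<in>I'. a' i * A i b)"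
        using I'(1,4) unfolding I'(3) by simp
      also have "(\<Sum>i\<in>I'. a' i * A i b) = (\<Sum>i\<in>I'. A s c * a i * A i b)"
        using I'(4) by (intro sum.cong) (auto simp: a'_def)
      also have "a' s * A s b + \<dots> = (\<Sum>i\<in>I'. a i * A' i b)"
        by (simp add: a'_def A'_def sum_distrib_right sum_distrib_left sum_subtractf algebra_simps)
      finally show ?thesis .
    qed
    have "(\<Sum>i\<in>I'. a i * A' i c) = 0" by (simp add: A'_def mult.commute)
    then have "\<forall>b\<in>insert c B. (\<Sum>i\<in>I. a' i * A i b) = 0" using sum a(2) by auto
    then show ?thesis using ex by blast
  qed
qed

text \<open>Zero is listed separately because \<open>v 0\<close> is only the dummy value 0.\<close>

definition vball :: "'k::field place \<Rightarrow> nat \<Rightarrow> 'k set" where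
  "vball v k = {x. x = 0 \<or> int k \<le> v x}"

context
  fixes v :: "'k::field place"
  assumes v: "discrete_valuation v"
begin

lemma vball_add: "x \<in> vball v k \<Longrightarrow> y \<in> vball v k \<Longrightarrow> x + y \<in> vball v k"
proof (cases "x = 0 \<or> y = 0 \<or> x + y = 0")
  case False
  assume "x \<in> vball v k" "y \<in> vball v k"
  moreover have "min (v x) (v y) \<le> v (x + y)" using v False by (simp add: discrete_valuation_def)
  ultimately show ?thesis using False by (auto simp: vball_def)
qed (auto simp: vball_def)

lemma vball_0: "0 \<in> vball v k"
  by (simp add: vball_def)

lemma vball_mult: "c \<in> valuation_ring v \<Longrightarrow> x \<in> vball v k \<Longrightarrow> c * x \<in> vball v k"
  by (cases "c = 0 \<or> x = 0") (auto simp: vball_def valuation_ring_def discrete_valuation_mult[OF v])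

lemma vball_uminus: "x \<in> vball v k \<Longrightarrow> - x \<in> vball v k"
  by (simp add: vball_def discrete_valuation_uminus[OF v])

lemma vball_diff: "x \<in> vball v k \<Longrightarrow> y \<in> vball v k \<Longrightarrow> x - y \<in> vball v k"
  using vball_add[of x k "- y"] vball_uminus[of y k] by simp

lemma vball_sum: "(\<And>i. i \<in> S \<Longrightarrow> f i \<in> vball v k) \<Longrightarrow> sum f S \<in> vball v k"
  by (induction S rule: infinite_finite_induct) (auto simp: vball_0 vball_add)

lemma vball_mono: "k \<le> l \<Longrightarrow> vball v l \<subseteq> vball v k"
  by (auto simp: vball_def)

end

section \<open>First-order approximation of the Drinfeld action near 0\<close>

context
  fixes v :: "'k::field place" and e :: "'p::prime_card mod_ring poly fract \<Rightarrow> 'k"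
    and \<Phi> :: "'p mod_ring poly \<Rightarrow> 'k poly"
  assumes v: "discrete_valuation v" and e: "field_hom e" and eR: "range e \<subseteq> valuation_ring v"
    and \<Phi>: "drinfeld_module_generic (e (Fract [:0, 1:] 1)) \<Phi>"
begin

interpretation e: field_hom e by (rule e)

lemma drinfeld_hom:
  "additive_poly (\<Phi> a)" "\<Phi> (a + b) = \<Phi> a + \<Phi> b" "\<Phi> (a * b) = pcompose (\<Phi> a) (\<Phi> b)" "\<Phi> 1 = [:0, 1:]"
proof -
  have h: "\<Phi> \<in> Ring.ring_hom ring_of_type_algebra End_Ga" using \<Phi> by (simp add: drinfeld_module_generic_def)
  show "additive_poly (\<Phi> a)" "\<Phi> (a + b) = \<Phi> a + \<Phi> b" "\<Phi> (a * b) = pcompose (\<Phi> a) (\<Phi> b)" "\<Phi> 1 = [:0, 1:]"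
    using ring_hom_closed[OF h, of a] ring_hom_add[OF h, of a b] ring_hom_mult[OF h, of a b] ring_hom_one[OF h]
    by (auto simp: ring_of_type_algebra_def End_Ga_def)
qed

lemma drinfeld_zero: "\<Phi> 0 = 0"
  using drinfeld_hom(2)[of 0 0] by (metis add_cancel_right_right)

lemma drinfeld_module: "Modules.module (drinfeld_action \<Phi>)"
  by unfold_locales
    (auto simp: drinfeld_action_def fun_eq_iff drinfeld_hom poly_pcompose additive_polyD[OF drinfeld_hom(1)])

text \<open>For i \<ge> 1 the exponent p^i is at least 2, so a nonzero i-th term has order at least
  v(c_i) + 2 v(x), which exceeds v(x) as soon as v(x) > - v(c_i).\<close>

lemma drinfeld_t_approx:
  "\<exists>k0. \<forall>k\<ge>k0. \<forall>x\<in>vball v k. poly (\<Phi> [:0, 1:]) x - e (Fract [:0, 1:] 1) * x \<in> vball v (Suc k)"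
proof -
  obtain D c where Dc: "c 0 = e (Fract [:0, 1:] 1)"
    "\<Phi> [:0, 1:] = (\<Sum>i\<le>D. monom (c i) (CARD('p) ^ i))"
    using \<Phi> unfolding drinfeld_module_generic_def by blast
  define p where "p = CARD('p)"
  have p: "p \<ge> 2" using prime_card[where 'a = 'p] prime_ge_2_nat by (simp add: p_def)
  \<comment> \<open>The sum of absolute values bounds every - v(c_i), and \<open>Suc\<close> makes
    the bound strict.\<close>
  define k0 where "k0 = Suc (\<Sum>i\<le>D. nat \<bar>v (c i)\<bar>)"
  have ck: "- v (c i) < int k0" if "i \<le> D" for i
  proof -
    have "nat \<bar>v (c i)\<bar> \<le> (\<Sum>i\<le>D. nat \<bar>v (c i)\<bar>)" using that by (intro member_le_sum) auto
    then show ?thesis unfolding k0_def by linarith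
  qed
  have "poly (\<Phi> [:0, 1:]) x - e (Fract [:0, 1:] 1) * x \<in> vball v (Suc k)" if k: "k \<ge> k0" and x: "x \<in> vball v k" for k x
  proof -
    have "poly (\<Phi> [:0, 1:]) x = (\<Sum>i\<le>D. c i * x ^ (p ^ i))"
      unfolding Dc(2) p_def by (simp add: poly_sum poly_monom)
    also have "\<dots> = c 0 * x + (\<Sum>i\<in>{..D} - {0}. c i * x ^ (p ^ i))"
      by (subst sum.remove[of _ 0]) auto
    finally have "poly (\<Phi> [:0, 1:]) x - e (Fract [:0, 1:] 1) * x = (\<Sum>i\<in>{..D} - {0}. c i * x ^ (p ^ i))" by (simp add: Dc(1))
    also have "\<dots> \<in> vball v (Suc k)"
    proof (rule vball_sum[OF v])
      fix i assume i: "i \<in> {..D} - {0}"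
      show "c i * x ^ (p ^ i) \<in> vball v (Suc k)"
      proof (cases "c i = 0 \<or> x = 0")
        case False
        then have vx: "int k \<le> v x" using x by (simp add: vball_def)
        have "p ^ i \<ge> 2" using i p by (cases i) (auto intro: order.trans[OF p] simp: Suc_le_eq)
        have "v (c i * x ^ (p ^ i)) = v (c i) + int (p ^ i) * v x"
          using False by (simp add: discrete_valuation_mult[OF v] discrete_valuation_power[OF v])
        moreover have "int (p ^ i) * v x \<ge> 2 * v x"
          using \<open>p ^ i \<ge> 2\<close> vx by (intro mult_right_mono) linarith+
        ultimately have "int (Suc k) \<le> v (c i * x ^ (p ^ i))" using ck[of i] i k vx by auto
        then show ?thesis by (simp add: vball_def)
      qed (use p in \<open>auto simp: vball_def\<close>)
    qed
    finally show ?thesis .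
  qed
  then show ?thesis by blast
qed

text \<open>One k0 serves all a, and the independence argument relies on this. When a is extended to
  c + t a, the value y = \<Phi>_a(x) stays in the ball of x because constants are integral, so the
  bound for t applies to y unchanged.\<close>

lemma drinfeld_approx:
  "\<exists>k0. \<forall>a. \<forall>k\<ge>k0. \<forall>x\<in>vball v k. poly (\<Phi> a) x - e (Fract a 1) * x \<in> vball v (Suc k)"
proof -
  let ?t = "[:0, 1:] :: 'p mod_ring poly"
  obtain k0 where k0: "\<And>k x. k \<ge> k0 \<Longrightarrow> x \<in> vball v k \<Longrightarrow> poly (\<Phi> ?t) x - e (Fract ?t 1) * x \<in> vball v (Suc k)"
    using drinfeld_t_approx by blast
  have eV: "e y \<in> valuation_ring v" for y using eR by auto
  have "poly (\<Phi> a) x - e (Fract a 1) * x \<in> vball v (Suc k)" if k: "k \<ge> k0" and x: "x \<in> vball v k" for a k x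
  proof (induction a)
    case 0
    show ?case by (simp add: drinfeld_zero vball_0[OF v] flip: Zero_fract_def)
  next
    case (pCons c a)
    obtain i where i: "c = of_nat i" using surj_of_nat_mod_ring[of c] by blast
    have dec: "pCons c a = of_nat i + ?t * a" by (simp add: i of_nat_poly)
    have "Fract (pCons c a) 1 = of_nat i + Fract ?t 1 * Fract a 1"
      unfolding dec by (simp add: of_nat_fract)
    then have ed: "e (Fract (pCons c a) 1) = of_nat i + e (Fract ?t 1) * e (Fract a 1)"
      by (simp only: e.hom_add e.hom_mult e.hom_of_nat)
    have nat: "poly (\<Phi> (of_nat i)) y = of_nat i * y" for i y
      by (induction i) (auto simp: drinfeld_zero drinfeld_hom algebra_simps)
    define y where "y = poly (\<Phi> a) x"
    have d1: "y - e (Fract a 1) * x \<in> vball v (Suc k)" using pCons by (simp add: y_def)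
    have "(y - e (Fract a 1) * x) + e (Fract a 1) * x \<in> vball v k"
      using d1 vball_mono[OF v, of k "Suc k"] vball_mult[OF v eV x] by (intro vball_add[OF v]) auto
    then have "y \<in> vball v k" by simp
    then have d2: "poly (\<Phi> ?t) y - e (Fract ?t 1) * y \<in> vball v (Suc k)" using k0[OF k] by blast
    have "(poly (\<Phi> ?t) y - e (Fract ?t 1) * y) + e (Fract ?t 1) * (y - e (Fract a 1) * x) \<in> vball v (Suc k)"
      by (intro vball_add[OF v] vball_mult[OF v] d1 d2 eV)
    moreover have "poly (\<Phi> (pCons c a)) x - e (Fract (pCons c a) 1) * x =
      (poly (\<Phi> ?t) y - e (Fract ?t 1) * y) + e (Fract ?t 1) * (y - e (Fract a 1) * x)"
      unfolding ed unfolding dec drinfeld_hom(2,3) poly_add nat poly_pcompose y_def by (simp add: algebra_simps)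
    ultimately show ?case by simp
  qed
  then show ?thesis by blast
qed

text \<open>
  If \<open>\<Gamma>\<close> met every ball, it would contain elements of infinitely many different orders at \<open>v\<close>;
  such elements are linearly independent because \<open>\<Phi>\<^sub>a\<close> preserves the order for \<open>a \<noteq> 0\<close>.
\<close>

theorem drinfeld_submodule_discrete:
  assumes \<Gamma>: "fg_drinfeld_submodule \<Phi> g \<Gamma>"
  shows "\<exists>k. \<forall>\<gamma>\<in>\<Gamma>. (\<forall>i<g. \<gamma> i \<in> vball v k) \<longrightarrow> \<gamma> = 0"
proof (rule ccontr)
  assume "\<not> ?thesis"
  then have con: "\<forall>k. \<exists>\<gamma>\<in>\<Gamma>. (\<forall>i<g. \<gamma> i \<in> vball v k) \<and> \<gamma> \<noteq> 0" by simp
  interpret m: Modules.module "drinfeld_action \<Phi>" by (rule drinfeld_module)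
  obtain B where B: "finite B" "\<Gamma> = m.span B" and aff: "\<Gamma> \<subseteq> affine_space g"
    using \<Gamma> unfolding fg_drinfeld_submodule_def by blast
  obtain k0 where k0: "\<And>a k x. k \<ge> k0 \<Longrightarrow> x \<in> vball v k \<Longrightarrow> poly (\<Phi> a) x - e (Fract a 1) * x \<in> vball v (Suc k)"
    using drinfeld_approx by blast
  have eV: "e y \<in> valuation_ring v" for y using eR by auto
  have act: "poly (\<Phi> a) x \<in> vball v k" if "k \<ge> k0" "x \<in> vball v k" for a k x
    using vball_add[OF v subsetD[OF vball_mono[OF v, of k "Suc k"] k0[OF that, of a]] vball_mult[OF v eV[of "Fract a 1"] that(2)]] by simp
  \<comment> \<open>A nonzero constant is a unit at v, so \<Phi>_a cannot raise the order of a small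
    element.\<close>
  have tf: "x \<in> vball v (Suc k)" if k: "k \<ge> k0" and x: "x \<in> vball v k" and a: "a \<noteq> 0" "poly (\<Phi> a) x \<in> vball v (Suc k)" for a k x
  proof -
    have "Fract a 1 \<noteq> 0" using a(1) by (simp add: Zero_fract_def eq_fract)
    then have ea: "e (Fract a 1) \<noteq> 0" using field_hom_eq_0_iff[OF e] by blast
    have "poly (\<Phi> a) x - (poly (\<Phi> a) x - e (Fract a 1) * x) \<in> vball v (Suc k)"
      by (rule vball_diff[OF v a(2) k0[OF k x]])
    then have "e (Fract a 1) * x \<in> vball v (Suc k)" by simp
    then have "e (inverse (Fract a 1)) * (e (Fract a 1) * x) \<in> vball v (Suc k)" by (rule vball_mult[OF v eV])
    moreover have "e (inverse (Fract a 1)) * (e (Fract a 1) * x) = x" using ea by (simp only: e.hom_inverse) simp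
    ultimately show ?thesis by (simp only:)
  qed
  define G where "G = (\<lambda>k. {\<gamma>\<in>\<Gamma>. \<forall>i<g. \<gamma> i \<in> vball v k})"
  \<comment> \<open>The jumps of the filtration G from k0 on. If no ball isolates 0 there are
    arbitrarily large ones, since a nonzero element of \<Gamma> must leave the filtration
    somewhere.\<close>
  define S where "S = {k. k \<ge> k0 \<and> (\<exists>\<gamma>. \<gamma> \<in> G k \<and> \<gamma> \<notin> G (Suc k))}"
  have "\<exists>k>n. k \<in> S" for n
  proof -
    define K where "K = max k0 (Suc n)"
    from spec[OF con, of K]
    obtain \<gamma> where \<gamma>: "\<gamma> \<in> \<Gamma>" "\<forall>i<g. \<gamma> i \<in> vball v K" "\<gamma> \<noteq> 0" by (elim bexE conjE) (rule that)
    then obtain i where i: "\<gamma> i \<noteq> 0" by (auto simp: fun_eq_iff)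
    have "\<gamma> \<in> affine_space g" using aff \<gamma>(1) by (rule subsetD)
    then have "\<forall>k\<ge>g. \<gamma> k = 0" unfolding affine_space_def by (rule CollectD)
    then have "\<not> g \<le> i" using i by auto
    then have ig: "i < g" by simp
    have "\<gamma> \<notin> G (Suc (nat (v (\<gamma> i))))" using i ig by (auto simp: G_def vball_def)
    moreover have GK: "\<gamma> \<in> G K" using \<gamma> by (simp add: G_def)
    moreover have "K \<le> Suc (nat (v (\<gamma> i)))" using \<gamma>(2) i ig by (auto simp: vball_def)
    ultimately obtain k where "k \<ge> K" "\<gamma> \<in> G k" "\<gamma> \<notin> G (Suc k)"
      using inc_induct[of K "Suc (nat (v (\<gamma> i)))" "\<lambda>k. \<gamma> \<notin> G k"] by (metis less_imp_le_nat)
    then show ?thesis unfolding S_def K_def by (intro exI[of _ k]) auto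
  qed
  then have infS: "infinite S" using infinite_nat_iff_unbounded by blast
  \<comment> \<open>One element more than there are generators, which forces a linear relation over
    the polynomial ring.\<close>
  obtain I where I: "I \<subseteq> S" "finite I" "card I = Suc (card B)" using infinite_arbitrarily_large[OF infS] by blast
  have "\<forall>k\<in>I. \<exists>\<gamma>. \<gamma> \<in> G k \<and> \<gamma> \<notin> G (Suc k)" using I(1) by (auto simp: S_def)
  then obtain \<gamma> where \<gamma>: "\<And>k. k \<in> I \<Longrightarrow> \<gamma> k \<in> G k \<and> \<gamma> k \<notin> G (Suc k)" by metis
  have "\<exists>u. \<gamma> k = (\<Sum>b\<in>B. drinfeld_action \<Phi> (u b) b)" if "k \<in> I" for k
    using \<gamma>[OF that] B m.span_finite[OF B(1)] unfolding G_def by auto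
  then obtain A where A: "\<And>k. k \<in> I \<Longrightarrow> \<gamma> k = (\<Sum>b\<in>B. drinfeld_action \<Phi> (A k b) b)" by metis
  have "\<exists>a. (\<exists>k\<in>I. a k \<noteq> 0) \<and> (\<forall>b\<in>B. (\<Sum>k\<in>I. a k * A k b) = 0)"
    by (rule ex_linear_relation[OF B(1) I(2)]) (simp add: I(3))
  then obtain a where "(\<exists>k\<in>I. a k \<noteq> 0) \<and> (\<forall>b\<in>B. (\<Sum>k\<in>I. a k * A k b) = 0)" by (elim exE) (rule that)
  then have a: "\<exists>k\<in>I. a k \<noteq> 0" "\<And>b. b \<in> B \<Longrightarrow> (\<Sum>k\<in>I. a k * A k b) = 0" by simp_all
  have "(\<Sum>k\<in>I. drinfeld_action \<Phi> (a k) (\<gamma> k)) = (\<Sum>k\<in>I. \<Sum>b\<in>B. drinfeld_action \<Phi> (a k * A k b) b)"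
    by (intro sum.cong refl) (simp add: A m.scale_sum_right)
  also have "\<dots> = (\<Sum>b\<in>B. drinfeld_action \<Phi> (\<Sum>k\<in>I. a k * A k b) b)"
    by (subst sum.swap) (simp add: m.scale_sum_left)
  also have "\<dots> = 0" using a(2) by simp
  finally have rel: "(\<Sum>k\<in>I. drinfeld_action \<Phi> (a k) (\<gamma> k)) = 0" .
  define J where "J = {k\<in>I. a k \<noteq> 0}"
  have J: "finite J" "J \<noteq> {}" using I a by (auto simp: J_def)
  \<comment> \<open>The smallest index with a nonzero coefficient. All other terms of the relation
    lie in the next ball, so applying the coefficient a_k to \<gamma>_k lands there as well, and by
    \<open>tf\<close> so does \<gamma>_k itself, coordinate by coordinate.\<close>
  define k where "k = Min J"
  have kJ: "k \<in> J" "\<And>l. l \<in> J \<Longrightarrow> k \<le> l" unfolding k_def using J by auto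
  have kI: "k \<in> I" "a k \<noteq> 0" using kJ by (auto simp: J_def)
  have kk: "k \<ge> k0" using kI I by (auto simp: S_def)
  have "\<gamma> k i \<in> vball v (Suc k)" if i: "i < g" for i
  proof -
    have "(\<Sum>l\<in>I. poly (\<Phi> (a l)) (\<gamma> l i)) = 0"
    proof -
      have "sum h S i = (\<Sum>l\<in>S. h l i)" for h :: "nat \<Rightarrow> nat \<Rightarrow> 'k" and S
        by (induction S rule: infinite_finite_induct) auto
      from this[of "\<lambda>l. drinfeld_action \<Phi> (a l) (\<gamma> l)" I] show ?thesis
        using rel by (simp add: drinfeld_action_def)
    qed
    then have "poly (\<Phi> (a k)) (\<gamma> k i) = - (\<Sum>l\<in>I - {k}. poly (\<Phi> (a l)) (\<gamma> l i))"
      using I(2) kI(1) by (simp add: sum.remove[of I k] eq_neg_iff_add_eq_0)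
    also have "\<dots> \<in> vball v (Suc k)"
    proof (intro vball_uminus[OF v] vball_sum[OF v])
      fix l assume l: "l \<in> I - {k}"
      show "poly (\<Phi> (a l)) (\<gamma> l i) \<in> vball v (Suc k)"
      proof (cases "a l = 0")
        case True
        then show ?thesis by (simp add: drinfeld_zero vball_0[OF v])
      next
        case False
        then have "k < l" using l kJ(2)[of l] by (auto simp: J_def)
        moreover have "\<gamma> l i \<in> vball v l" using \<gamma>[of l] l i by (auto simp: G_def)
        moreover have "l \<ge> k0" using l I by (auto simp: S_def)
        ultimately show ?thesis using act[of l "\<gamma> l i" "a l"] vball_mono[OF v, of "Suc k" l] by auto
      qed
    qed
    finally show ?thesis using tf[OF kk _ kI(2)] \<gamma>[OF kI(1)] i by (auto simp: G_def)
  qed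
  then have "\<gamma> k \<in> G (Suc k)" using \<gamma>[OF kI(1)] by (auto simp: G_def)
  then show False using \<gamma>[OF kI(1)] by blast
qed

end

section \<open>Constants at divisor places, and comparison of rational and adelic points\<close>

lemma constants_subset_valuation_ring:
  fixes \<iota> :: "'f::field \<Rightarrow> 'k::field"
  assumes \<iota>: "field_hom \<iota>" and v: "v \<in> divisor_places \<iota> n I z"
  shows "range \<iota> \<subseteq> valuation_ring v"
proof
  interpret i: field_hom \<iota> by (rule \<iota>)
  obtain P where P: "irreducible_divisor n I P" "valuation_ring v = local_ring_at \<iota> n z P"
    using v unfolding divisor_places_def by blast
  have P1: "1 \<notin> P" using P(1) by (auto simp: irreducible_divisor_def projective_variety_iff)
  fix x assume "x \<in> range \<iota>"
  then obtain c where c: "x = \<iota> c" by blast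
  have "x = mpol_eval \<iota> z (Poly_Mapping.single 0 c) / mpol_eval \<iota> z 1" using c by simp
  then show "x \<in> valuation_ring v" unfolding P(2) local_ring_at_def
    using P1 homog_const homog_one mpol_const_in_carrier subring_set_one[OF subring_set_mpol] by blast
qed

theorem theorem2p1:
  fixes j :: "'p::prime_card mod_ring poly fract \<Rightarrow> 'f::field"
    and \<iota> :: "'f \<Rightarrow> 'k::field"
    and n d g :: nat
    and I :: "'f mpol set"
    and z :: "nat \<Rightarrow> 'k"
    and \<Omega> \<Omega>1 :: "'k place set"
    and \<Phi> :: "'p mod_ring poly \<Rightarrow> 'k poly"
  assumes "field_hom j" and "finite_field_extension j"
    and "field_hom \<iota>" and "finitely_generated_extension \<iota>"
    and "has_transcendence_degree \<iota> d" and "d \<ge> 1"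
    and "algebraically_closed_in (range \<iota>)"
    and "projective_variety n I"
    and "geometrically_irreducible n I"
    and "smooth_of_dimension n d I"
    and "is_function_field \<iota> n I z"
    and "\<Omega> = divisor_places \<iota> n I z"
    and "\<Omega>1 \<subseteq> \<Omega>" and "finite (\<Omega> - \<Omega>1)"
    and "drinfeld_module_generic (\<iota> (j (Fract [:0, 1:] 1))) \<Phi>"
    and "g \<ge> 1"
  shows "\<forall>V \<Gamma>. V \<subseteq> carrier (mpol_ring {..<g}) \<and> fg_drinfeld_submodule \<Phi> g \<Gamma> \<longrightarrow>
    diagonal \<Omega>1 g ` (rational_points g V \<inter> \<Gamma>) =
    adelic_points \<Omega>1 g V \<inter> (adelic_space_topology \<Omega>1 g closure_of (diagonal \<Omega>1 g ` \<Gamma>))"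
proof (intro allI impI)
  fix V :: "'k mpol set" and \<Gamma> :: "(nat \<Rightarrow> 'k) set"
  assume "V \<subseteq> carrier (mpol_ring {..<g}) \<and> fg_drinfeld_submodule \<Phi> g \<Gamma>"
  then have V: "V \<subseteq> carrier (mpol_ring {..<g})" and \<Gamma>: "fg_drinfeld_submodule \<Phi> g \<Gamma>" by auto
  have "infinite \<Omega>" unfolding assms(12) by (rule infinite_divisor_places[OF assms(1-6,8,11)])
  then have "infinite \<Omega>1" using assms(14) by (metis finite_Diff2)
  then obtain w where w: "w \<in> \<Omega>1" by (metis ex_in_conv finite.emptyI)
  have \<Omega>1: "discrete_valuation v" if "v \<in> \<Omega>1" for v using that assms(12,13) by (auto simp: divisor_places_def)
  have fin: "finite {v\<in>\<Omega>1. x \<notin> valuation_ring v}" for x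
  proof (rule finite_subset)
    show "{v\<in>\<Omega>1. x \<notin> valuation_ring v} \<subseteq> {v \<in> divisor_places \<iota> n I z. x \<notin> valuation_ring v}" using assms(12,13) by auto
    show "finite \<dots>" by (rule finite_poles[OF assms(8,11)])
  qed
  have e: "field_hom (\<lambda>x. \<iota> (j x))" by (rule field_hom_comp[OF assms(1,3)])
  have "range \<iota> \<subseteq> valuation_ring w" using constants_subset_valuation_ring[OF assms(3)] w assms(12,13) by blast
  then have eR: "range (\<lambda>x. \<iota> (j x)) \<subseteq> valuation_ring w" by auto
  obtain k where k: "\<And>\<gamma>. \<gamma> \<in> \<Gamma> \<Longrightarrow> (\<And>i. i < g \<Longrightarrow> \<gamma> i \<in> vball w k) \<Longrightarrow> \<gamma> = 0"
    using drinfeld_submodule_discrete[OF \<Omega>1[OF w] e eR assms(15) \<Gamma>] by blast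
  \<comment> \<open>Absolute values are powers of 2, so for nonzero elements \<open>vabs\<close>
    below r means order at least k; this accounts for the 1 in the exponent.\<close>
  define r :: real where "r = 2 powi (1 - int k)"
  have r: "r > 0" by (simp add: r_def)
  interpret m: Modules.module "drinfeld_action \<Phi>" by (rule drinfeld_module[OF \<Omega>1[OF w] e eR assms(15)])
  have sub: "m.subspace \<Gamma>" and aff: "\<Gamma> \<subseteq> affine_space g" using \<Gamma> by (auto simp: fg_drinfeld_submodule_def)
  have disc: "\<gamma> = \<gamma>'" if "\<gamma> \<in> \<Gamma>" "\<gamma>' \<in> \<Gamma>" and small: "\<And>i. i < g \<Longrightarrow> vabs w (\<gamma> i - \<gamma>' i) < r" for \<gamma> \<gamma>'
  proof -
    have "\<gamma> - \<gamma>' \<in> \<Gamma>" using m.subspace_diff[OF sub] that by blast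
    moreover have "(\<gamma> - \<gamma>') i \<in> vball w k" if "i < g" for i
      using small[OF that] vabs_le_iff(2)[of "\<gamma> i - \<gamma>' i" w "1 - int k"]
      by (cases "\<gamma> i - \<gamma>' i = 0") (auto simp: vball_def r_def)
    ultimately have "\<gamma> - \<gamma>' = 0" by (rule k)
    then show ?thesis by simp
  qed
  \<comment> \<open>Polynomial values at diagonal points are diagonal, and K embeds injectively into
    the adeles because \<Omega>1 is nonempty.\<close>
  have pts: "diagonal \<Omega>1 g x \<in> adelic_points \<Omega>1 g V \<longleftrightarrow> (\<forall>f\<in>V. mpol_eval id x f = 0)" for x
  proof -
    have "mpol_eval_in (adele_ring \<Omega>1) (to_adele \<Omega>1) (diagonal \<Omega>1 g x) f = \<zero>\<^bsub>adele_ring \<Omega>1\<^esub> \<longleftrightarrow> mpol_eval id x f = 0"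
      if "f \<in> V" for f
      using mpol_eval_in_diagonal[OF \<Omega>1 fin, of f g x] to_adele_eq_zero_iff[OF \<Omega>1 fin, of "mpol_eval id x f"] that V w
      by (metis empty_iff subsetD)
    then show ?thesis unfolding adelic_points_def using diagonal_in_adelic_space[OF \<Omega>1 fin, of g x] by simp
  qed
  show "diagonal \<Omega>1 g ` (rational_points g V \<inter> \<Gamma>) =
    adelic_points \<Omega>1 g V \<inter> (adelic_space_topology \<Omega>1 g closure_of (diagonal \<Omega>1 g ` \<Gamma>))"
  proof
    have "diagonal \<Omega>1 g ` \<Gamma> \<subseteq> topspace (adelic_space_topology \<Omega>1 g)"
    proof
      fix y assume "y \<in> diagonal \<Omega>1 g ` \<Gamma>"
      then have "y \<in> (\<Pi>\<^sub>E k\<in>{..<g}. carrier (adele_ring \<Omega>1))" using diagonal_in_adelic_space[OF \<Omega>1 fin] by blast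
      then show "y \<in> topspace (adelic_space_topology \<Omega>1 g)"
        unfolding adelic_space_topology_def topspace_product_topology
        using adele_carrier_subset_topspace[OF \<Omega>1 fin w] by (auto simp: PiE_iff)
    qed
    then have "diagonal \<Omega>1 g ` \<Gamma> \<subseteq> adelic_space_topology \<Omega>1 g closure_of (diagonal \<Omega>1 g ` \<Gamma>)" by (rule closure_of_subset)
    then show "diagonal \<Omega>1 g ` (rational_points g V \<inter> \<Gamma>) \<subseteq>
      adelic_points \<Omega>1 g V \<inter> (adelic_space_topology \<Omega>1 g closure_of (diagonal \<Omega>1 g ` \<Gamma>))"
      using pts by (auto simp: rational_points_def)
    show "adelic_points \<Omega>1 g V \<inter> (adelic_space_topology \<Omega>1 g closure_of (diagonal \<Omega>1 g ` \<Gamma>)) \<subseteq>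
      diagonal \<Omega>1 g ` (rational_points g V \<inter> \<Gamma>)"
    proof
      fix x assume x: "x \<in> adelic_points \<Omega>1 g V \<inter> (adelic_space_topology \<Omega>1 g closure_of (diagonal \<Omega>1 g ` \<Gamma>))"
      then have "x \<in> (\<Pi>\<^sub>E k\<in>{..<g}. carrier (adele_ring \<Omega>1))" by (simp add: adelic_points_def)
      then have "x \<in> diagonal \<Omega>1 g ` \<Gamma>" using x closure_of_discrete[OF \<Omega>1 fin w r disc] by blast
      then obtain \<gamma> where \<gamma>: "\<gamma> \<in> \<Gamma>" "x = diagonal \<Omega>1 g \<gamma>" by blast
      then have "\<gamma> \<in> rational_points g V" using x pts aff by (auto simp: rational_points_def)
      then show "x \<in> diagonal \<Omega>1 g ` (rational_points g V \<inter> \<Gamma>)" using \<gamma> by blast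
    qed
  qed
qed

end
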